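(* Let $K$ be an algebraically closed field, $G$ a finite abelian group, $D=D(G)$ its Drinfel'd double over $K$, $L=D^*$, and $g\ge0$. For $h\ge 0$ put $\mathcal Z^m(\Sigma_h)=\mathrm{Ext}^m_D(K,L^{\otimes h})$ and $\mathcal Z^\infty(\Sigma_h)=\bigoplus_{m\ge0}\mathcal Z^m(\Sigma_h)$. Then $$\mathcal Z^\infty(\Sigma_g)\cong\mathcal Z^0(\Sigma_g)\otimes_K\mathcal Z^\infty(\Sigma_0)$$ as graded right modules over $\mathcal Z^\infty(\Sigma_0)$.
   Context: For a finite group $G$ with unit $e$, $D(G)$ has basis $\delta_a\otimes b$ ($a,b\in G$), product $(\delta_a\otimes b)(\delta_c\otimes d)=\delta_{a,bcb^{-1}}\,\delta_a\otimes bd$, unit $\varepsilon\otimes e$ with $\varepsilon=\sum_a\delta_a$, coproduct $\Delta(\delta_a\otimes b)=\sum_c(\delta_c\otimes b)\otimes(\delta_{ac^{-1}}\otimes b)$, counit $\delta_a\otimes b\mapsto\delta_{a,e}$; $K$ is the trivial module via the counit. $L=D^*$ has the dual basis $u(a,b)$ and carries the left coadjoint action $(\varepsilon\otimes h).u(a,b)=u(hah^{-1},hbh^{-1})$, $(\delta_h\otimes e).u(a,b)=\delta_{h,\,b^{-1}aba^{-1}}\,u(a,b)$. $L^{\otimes h}$ is a $D$-module via the coproduct, with $L^{\otimes0}=K$, so $\mathcal Z^\infty(\Sigma_0)=\mathrm{Ext}_D(K,K)$. This is a graded algebra under the Yoneda product, and $\mathcal Z^\infty(\Sigma_g)=\mathrm{Ext}_D(K,L^{\otimes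 g})$ is a graded right module over it via the Yoneda product $\mathrm{Ext}^m_D(K,L^{\otimes g})\times\mathrm{Ext}^l_D(K,K)\to\mathrm{Ext}^{m+l}_D(K,L^{\otimes g})$. On $\mathcal Z^0(\Sigma_g)\otimes_K\mathcal Z^\infty(\Sigma_0)$ the right module structure is on the right tensor factor, and the degree is that of the right factor. *)

theory Defs
  imports "HOL-Algebra.Algebra"
begin

text \<open>
  The record type of modules extends that of rings; the fields \<open>mult\<close> and \<open>one\<close> of a mere
  module carry no meaning and are filled with \<open>undefined\<close>.
\<close>

section \<open>Left modules over a not necessarily commutative ring\<close>

locale left_module = R?: ring R + M?: abelian_group M
  for R :: "('d, 'x) ring_scheme" (structure) and M :: "('d, 'm, 'y) module_scheme" (structure) +
  assumes smult_closed:
      "\<lbrakk>a \<in> carrier R; x \<in> carrier M\<rbrakk> \<Longrightarrow> a \<odot>\<^bsub>M\<^esub> x \<in> carrier M"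
    and smult_l_distr:
      "\<lbrakk>a \<in> carrier R; b \<in> carrier R; x \<in> carrier M\<rbrakk> \<Longrightarrow>
        (a \<oplus> b) \<odot>\<^bsub>M\<^esub> x = a \<odot>\<^bsub>M\<^esub> x \<oplus>\<^bsub>M\<^esub> b \<odot>\<^bsub>M\<^esub> x"
    and smult_r_distr:
      "\<lbrakk>a \<in> carrier R; x \<in> carrier M; y \<in> carrier M\<rbrakk> \<Longrightarrow>
        a \<odot>\<^bsub>M\<^esub> (x \<oplus>\<^bsub>M\<^esub> y) = a \<odot>\<^bsub>M\<^esub> x \<oplus>\<^bsub>M\<^esub> a \<odot>\<^bsub>M\<^esub> y"
    and smult_assoc:
      "\<lbrakk>a \<in> carrier R; b \<in> carrier R; x \<in> carrier M\<rbrakk> \<Longrightarrow>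
        (a \<otimes> b) \<odot>\<^bsub>M\<^esub> x = a \<odot>\<^bsub>M\<^esub> (b \<odot>\<^bsub>M\<^esub> x)"
    and smult_one:
      "x \<in> carrier M \<Longrightarrow> \<one> \<odot>\<^bsub>M\<^esub> x = x"

definition left_hom ::
  "('d, 'x) ring_scheme \<Rightarrow> ('d, 'm, 'y) module_scheme \<Rightarrow> ('d, 'n, 'z) module_scheme \<Rightarrow> ('m \<Rightarrow> 'n) set"
  where "left_hom R M N =
    {f \<in> carrier M \<rightarrow> carrier N.
      (\<forall>x\<in>carrier M. \<forall>y\<in>carrier M. f (x \<oplus>\<^bsub>M\<^esub> y) = f x \<oplus>\<^bsub>N\<^esub> f y) \<and>
      (\<forall>r\<in>carrier R. \<forall>x\<in>carrier M. f (r \<odot>\<^bsub>M\<^esub> x) = r \<odot>\<^bsub>N\<^esub> f x)}"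

definition free_module :: "('d, 'x) ring_scheme \<Rightarrow> 'i set \<Rightarrow> ('d, 'i \<Rightarrow> 'd) module"
  where "free_module R S =
    \<lparr>carrier = {f \<in> S \<rightarrow>\<^sub>E carrier R. finite {x \<in> S. f x \<noteq> \<zero>\<^bsub>R\<^esub>}},
     monoid.mult = undefined, one = undefined,
     ring.zero = (\<lambda>x\<in>S. \<zero>\<^bsub>R\<^esub>),
     ring.add = (\<lambda>f f'. \<lambda>x\<in>S. f x \<oplus>\<^bsub>R\<^esub> f' x),
     smult = (\<lambda>r f. \<lambda>x\<in>S. r \<otimes>\<^bsub>R\<^esub> f x)\<rparr>"

definition free_basis :: "('d, 'x) ring_scheme \<Rightarrow> 'i set \<Rightarrow> 'i \<Rightarrow> 'i \<Rightarrow> 'd"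
  where "free_basis R S i = (\<lambda>x\<in>S. if x = i then \<one>\<^bsub>R\<^esub> else \<zero>\<^bsub>R\<^esub>)"

text \<open>
  Projective means: direct summand of a free module. A projective module is always a summand of
  the free module on its own carrier, so it is no restriction that the index set of the free
  module is taken in the type of the module.
\<close>

definition projective_module :: "('d, 'x) ring_scheme \<Rightarrow> ('d, 'm, 'y) module_scheme \<Rightarrow> bool"
  where "projective_module R M \<longleftrightarrow> left_module R M \<and>
    (\<exists>(S :: 'm set) i p. i \<in> left_hom R M (free_module R S) \<and> p \<in> left_hom R (free_module R S) M \<and>
      (\<forall>x\<in>carrier M. p (i x) = x))"

definition subquotient_module ::
  "('k, 'm, 'y) module_scheme \<Rightarrow> 'm set \<Rightarrow> 'm set \<Rightarrow> ('k, 'm set) module"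
  where "subquotient_module M S N =
    \<lparr>carrier = {N +>\<^bsub>M\<^esub> x | x. x \<in> S},
     monoid.mult = undefined, one = undefined,
     ring.zero = N,
     ring.add = (\<lambda>A B. A <+>\<^bsub>M\<^esub> B),
     smult = (\<lambda>k A. \<Union>x\<in>A. N +>\<^bsub>M\<^esub> (k \<odot>\<^bsub>M\<^esub> x))\<rparr>"

definition submodule_span ::
  "('k, 'x) ring_scheme \<Rightarrow> ('k, 'm, 'y) module_scheme \<Rightarrow> 'm set \<Rightarrow> 'm set"
  where "submodule_span K M S = \<Inter>{N. submodule N K M \<and> S \<subseteq> N}"


section \<open>Tensor product of modules over a commutative ring\<close>

definition tensor_relations ::
  "('k, 'x) ring_scheme \<Rightarrow> ('k, 'v, 'y) module_scheme \<Rightarrow> ('k, 'w, 'z) module_scheme \<Rightarrow>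
    ('v \<times> 'w \<Rightarrow> 'k) set"
  where "tensor_relations K V W =
    (let S = carrier V \<times> carrier W; F = free_module K S; e = (\<lambda>v w. free_basis K S (v, w)) in
     submodule_span K F
      ({e (v \<oplus>\<^bsub>V\<^esub> v') w \<ominus>\<^bsub>F\<^esub> (e v w \<oplus>\<^bsub>F\<^esub> e v' w) | v v' w.
          v \<in> carrier V \<and> v' \<in> carrier V \<and> w \<in> carrier W} \<union>
       {e v (w \<oplus>\<^bsub>W\<^esub> w') \<ominus>\<^bsub>F\<^esub> (e v w \<oplus>\<^bsub>F\<^esub> e v w') | v w w'.
          v \<in> carrier V \<and> w \<in> carrier W \<and> w' \<in> carrier W} \<union>
       {e (k \<odot>\<^bsub>V\<^esub> v) w \<ominus>\<^bsub>F\<^esub> k \<odot>\<^bsub>F\<^esub> e v w | k v w.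
          k \<in> carrier K \<and> v \<in> carrier V \<and> w \<in> carrier W} \<union>
       {e v (k \<odot>\<^bsub>W\<^esub> w) \<ominus>\<^bsub>F\<^esub> k \<odot>\<^bsub>F\<^esub> e v w | k v w.
          k \<in> carrier K \<and> v \<in> carrier V \<and> w \<in> carrier W}))"

definition tensor_module ::
  "('k, 'x) ring_scheme \<Rightarrow> ('k, 'v, 'y) module_scheme \<Rightarrow> ('k, 'w, 'z) module_scheme \<Rightarrow>
    ('k, ('v \<times> 'w \<Rightarrow> 'k) set) module"
  where "tensor_module K V W =
    (let F = free_module K (carrier V \<times> carrier W) in
     subquotient_module F (carrier F) (tensor_relations K V W))"

definition pure_tensor ::
  "('k, 'x) ring_scheme \<Rightarrow> ('k, 'v, 'y) module_scheme \<Rightarrow> ('k, 'w, 'z) module_scheme \<Rightarrow>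
    'v \<Rightarrow> 'w \<Rightarrow> ('v \<times> 'w \<Rightarrow> 'k) set"
  where "pure_tensor K V W v w =
    (let S = carrier V \<times> carrier W in
     tensor_relations K V W +>\<^bsub>free_module K S\<^esub> free_basis K S (v, w))"

text \<open>The endomorphism \<open>id \<otimes> \<phi>\<close> of \<open>V \<otimes> W\<close>, for a linear endomorphism \<open>\<phi>\<close> of \<open>W\<close>.\<close>

definition tensor_id_map ::
  "('k, 'x) ring_scheme \<Rightarrow> ('k, 'v, 'y) module_scheme \<Rightarrow> ('k, 'w, 'z) module_scheme \<Rightarrow>
    ('w \<Rightarrow> 'w) \<Rightarrow> ('v \<times> 'w \<Rightarrow> 'k) set \<Rightarrow> ('v \<times> 'w \<Rightarrow> 'k) set"
  where "tensor_id_map K V W \<phi> T =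
    (let S = carrier V \<times> carrier W; F = free_module K S in
     \<Union>f\<in>T. tensor_relations K V W +>\<^bsub>F\<^esub>
       (\<Oplus>\<^bsub>F\<^esub>p\<in>{p \<in> S. f p \<noteq> \<zero>\<^bsub>K\<^esub>}. f p \<odot>\<^bsub>F\<^esub> free_basis K S (fst p, \<phi> (snd p))))"


section \<open>Graded right modules\<close>

text \<open>
  \<open>('k, 'v, 's) graded_right_module\<close>: a module over \<open>'k\<close> together with its homogeneous parts and
  the right action of an algebra with elements in \<open>'s\<close>.
\<close>

record ('k, 'v, 's) graded_right_module = "('k, 'v) module" +
  degree_part :: "nat \<Rightarrow> 'v set"
  right_act :: "'v \<Rightarrow> 's \<Rightarrow> 'v"

definition graded_right_module_isomorphic ::
  "('k, 'x) ring_scheme \<Rightarrow> ('k, 's, 'a) module_scheme \<Rightarrow>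
    ('k, 'v, 's, 'y) graded_right_module_scheme \<Rightarrow> ('k, 'w, 's, 'z) graded_right_module_scheme \<Rightarrow> bool"
  where "graded_right_module_isomorphic K A M N \<longleftrightarrow>
    (\<exists>\<theta>. \<theta> \<in> left_hom K M N \<and> bij_betw \<theta> (carrier M) (carrier N) \<and>
      (\<forall>m. \<theta> ` degree_part M m = degree_part N m) \<and>
      (\<forall>x\<in>carrier M. \<forall>a\<in>carrier A. \<theta> (right_act M x a) = right_act N (\<theta> x) a))"

definition tensor_graded ::
  "('k, 'x) ring_scheme \<Rightarrow> ('k, 'v, 'y) module_scheme \<Rightarrow> ('k, 'w, 's, 'z) graded_right_module_scheme \<Rightarrow>
    ('k, ('v \<times> 'w \<Rightarrow> 'k) set, 's) graded_right_module"
  where "tensor_graded K V W =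
    module.extend (tensor_module K V W)
      \<lparr>degree_part = (\<lambda>m. submodule_span K (tensor_module K V W)
         {pure_tensor K V W v w | v w. v \<in> carrier V \<and> w \<in> degree_part W m}),
       right_act = (\<lambda>t a. tensor_id_map K V W (\<lambda>w. right_act W w a) t)\<rparr>"


section \<open>Ext and the Yoneda product\<close>

text \<open>
  \<open>res_diff P n\<close> is the differential \<open>P\<^sub>n\<^sub>+\<^sub>1 \<rightarrow> P\<^sub>n\<close> and \<open>res_aug P\<close> the augmentation \<open>P\<^sub>0 \<rightarrow> N\<close>.
\<close>

record ('d, 'p, 'n) resolution =
  res_mod :: "nat \<Rightarrow> ('d, 'p) module"
  res_diff :: "nat \<Rightarrow> 'p \<Rightarrow> 'p"
  res_aug :: "'p \<Rightarrow> 'n"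

definition projective_resolution ::
  "('d, 'x) ring_scheme \<Rightarrow> ('d, 'n, 'y) module_scheme \<Rightarrow> ('d, 'p, 'n) resolution \<Rightarrow> bool"
  where "projective_resolution R N P \<longleftrightarrow>
    (\<forall>n. projective_module R (res_mod P n)) \<and>
    (\<forall>n. res_diff P n \<in> left_hom R (res_mod P (Suc n)) (res_mod P n)) \<and>
    res_aug P \<in> left_hom R (res_mod P 0) N \<and>
    res_aug P ` carrier (res_mod P 0) = carrier N \<and>
    res_diff P 0 ` carrier (res_mod P (Suc 0)) =
      {x \<in> carrier (res_mod P 0). res_aug P x = \<zero>\<^bsub>N\<^esub>} \<and>
    (\<forall>n. res_diff P (Suc n) ` carrier (res_mod P (Suc (Suc n))) =
      {x \<in> carrier (res_mod P (Suc n)). res_diff P n x = \<zero>\<^bsub>res_mod P n\<^esub>})"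

text \<open>
  Throughout, \<open>R\<close> is an algebra over a field by means of the central unit map \<open>\<eta>\<close>, which is what
  makes the groups of homomorphisms and of extensions vector spaces.
\<close>

definition hom_module ::
  "('d, 'x) ring_scheme \<Rightarrow> ('k \<Rightarrow> 'd) \<Rightarrow> ('d, 'm, 'y) module_scheme \<Rightarrow> ('d, 'n, 'z) module_scheme \<Rightarrow>
    ('k, 'm \<Rightarrow> 'n) module"
  where "hom_module R \<eta> M N =
    \<lparr>carrier = left_hom R M N \<inter> (carrier M \<rightarrow>\<^sub>E carrier N),
     monoid.mult = undefined, one = undefined,
     ring.zero = (\<lambda>x\<in>carrier M. \<zero>\<^bsub>N\<^esub>),
     ring.add = (\<lambda>f f'. \<lambda>x\<in>carrier M. f x \<oplus>\<^bsub>N\<^esub> f' x),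
     smult = (\<lambda>k f. \<lambda>x\<in>carrier M. \<eta> k \<odot>\<^bsub>N\<^esub> f x)\<rparr>"

definition cocycles ::
  "('d, 'x) ring_scheme \<Rightarrow> ('k \<Rightarrow> 'd) \<Rightarrow> ('d, 'p, 'n) resolution \<Rightarrow> ('d, 'm, 'y) module_scheme \<Rightarrow>
    nat \<Rightarrow> ('p \<Rightarrow> 'm) set"
  where "cocycles R \<eta> P M m =
    {f \<in> carrier (hom_module R \<eta> (res_mod P m) M).
      \<forall>x\<in>carrier (res_mod P (Suc m)). f (res_diff P m x) = \<zero>\<^bsub>M\<^esub>}"

fun coboundaries ::
  "('d, 'x) ring_scheme \<Rightarrow> ('k \<Rightarrow> 'd) \<Rightarrow> ('d, 'p, 'n) resolution \<Rightarrow> ('d, 'm, 'y) module_scheme \<Rightarrow>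
    nat \<Rightarrow> ('p \<Rightarrow> 'm) set"
  where
    "coboundaries R \<eta> P M 0 = {\<zero>\<^bsub>hom_module R \<eta> (res_mod P 0) M\<^esub>}"
  | "coboundaries R \<eta> P M (Suc m) =
      {\<lambda>x\<in>carrier (res_mod P (Suc m)). h (res_diff P m x) | h.
        h \<in> carrier (hom_module R \<eta> (res_mod P m) M)}"

text \<open>\<open>Ext\<^sup>m\<^sub>R(N, M)\<close>, computed by a projective resolution \<open>P\<close> of \<open>N\<close>.\<close>

definition ext_module ::
  "('d, 'x) ring_scheme \<Rightarrow> ('k \<Rightarrow> 'd) \<Rightarrow> ('d, 'p, 'n) resolution \<Rightarrow> ('d, 'm, 'y) module_scheme \<Rightarrow>
    nat \<Rightarrow> ('k, ('p \<Rightarrow> 'm) set) module"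
  where "ext_module R \<eta> P M m =
    subquotient_module (hom_module R \<eta> (res_mod P m) M) (cocycles R \<eta> P M m) (coboundaries R \<eta> P M m)"

text \<open>
  A lift of a cocycle \<open>\<phi> : P\<^sub>l \<rightarrow> N\<close> to a chain map \<open>t\<^sub>n : P\<^sub>l\<^sub>+\<^sub>n \<rightarrow> P\<^sub>n\<close>. Lifts exist and are unique up
  to homotopy by the comparison theorem, and a coboundary lifts to a nullhomotopic map; hence the
  class of \<open>f \<circ> t\<^sub>m\<close> in \<open>yoneda\<close> depends neither on the lift nor on the representatives.
\<close>

definition chain_lift ::
  "('d, 'x) ring_scheme \<Rightarrow> ('d, 'p, 'n) resolution \<Rightarrow> nat \<Rightarrow> ('p \<Rightarrow> 'n) \<Rightarrow> (nat \<Rightarrow> 'p \<Rightarrow> 'p) \<Rightarrow> bool"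
  where "chain_lift R P l \<phi> t \<longleftrightarrow>
    (\<forall>n. t n \<in> left_hom R (res_mod P (l + n)) (res_mod P n)) \<and>
    (\<forall>x\<in>carrier (res_mod P l). res_aug P (t 0 x) = \<phi> x) \<and>
    (\<forall>n. \<forall>x\<in>carrier (res_mod P (Suc (l + n))).
      res_diff P n (t (Suc n) x) = t n (res_diff P (l + n) x))"

definition class_lift ::
  "('d, 'x) ring_scheme \<Rightarrow> ('d, 'p, 'n) resolution \<Rightarrow> nat \<Rightarrow> ('p \<Rightarrow> 'n) set \<Rightarrow> nat \<Rightarrow> 'p \<Rightarrow> 'p"
  where "class_lift R P l B = (SOME t. \<exists>\<phi>\<in>B. chain_lift R P l \<phi> t)"

text \<open>The Yoneda product \<open>Ext\<^sup>m(N, M) \<times> Ext\<^sup>l(N, N) \<rightarrow> Ext\<^sup>m\<^sup>+\<^sup>l(N, M)\<close>.\<close>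

definition yoneda ::
  "('d, 'x) ring_scheme \<Rightarrow> ('k \<Rightarrow> 'd) \<Rightarrow> ('d, 'p, 'n) resolution \<Rightarrow> ('d, 'm, 'y) module_scheme \<Rightarrow>
    nat \<Rightarrow> nat \<Rightarrow> ('p \<Rightarrow> 'm) set \<Rightarrow> ('p \<Rightarrow> 'n) set \<Rightarrow> ('p \<Rightarrow> 'm) set"
  where "yoneda R \<eta> P M m l A B =
    (\<Union>f\<in>A. coboundaries R \<eta> P M (m + l) +>\<^bsub>hom_module R \<eta> (res_mod P (m + l)) M\<^esub>
      (\<lambda>x\<in>carrier (res_mod P (m + l)). f (class_lift R P l B m x)))"

text \<open>
  \<open>\<Oplus>\<^sub>m Ext\<^sup>m(N, M)\<close> with the right action of \<open>\<Oplus>\<^sub>l Ext\<^sup>l(N, N)\<close>.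
\<close>

definition ext_total ::
  "('d, 'x) ring_scheme \<Rightarrow> ('k \<Rightarrow> 'd) \<Rightarrow> ('d, 'p, 'n) resolution \<Rightarrow> ('d, 'm, 'y) module_scheme \<Rightarrow>
    ('k, nat \<Rightarrow> ('p \<Rightarrow> 'm) set, nat \<Rightarrow> ('p \<Rightarrow> 'n) set) graded_right_module"
  where "ext_total R \<eta> P M =
    (let E = ext_module R \<eta> P M;
         C = {x. (\<forall>m. x m \<in> carrier (E m)) \<and> finite {m. x m \<noteq> \<zero>\<^bsub>E m\<^esub>}} in
     \<lparr>carrier = C,
      monoid.mult = undefined, one = undefined,
      ring.zero = (\<lambda>m. \<zero>\<^bsub>E m\<^esub>),
      ring.add = (\<lambda>x y m. x m \<oplus>\<^bsub>E m\<^esub> y m),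
      smult = (\<lambda>k x m. k \<odot>\<^bsub>E m\<^esub> x m),
      degree_part = (\<lambda>m. {x \<in> C. \<forall>n. n \<noteq> m \<longrightarrow> x n = \<zero>\<^bsub>E n\<^esub>}),
      right_act = (\<lambda>x y n. \<Oplus>\<^bsub>E n\<^esub>m\<in>{..n}. yoneda R \<eta> P M m (n - m) (x m) (y (n - m)))\<rparr>)"

text \<open>
  The algebra \<open>\<Oplus>\<^sub>l Ext\<^sup>l(N, N)\<close>; its unit is the class of the augmentation.
\<close>

definition ext_algebra ::
  "('d, 'x) ring_scheme \<Rightarrow> ('k \<Rightarrow> 'd) \<Rightarrow> ('d, 'p, 'n) resolution \<Rightarrow> ('d, 'n, 'y) module_scheme \<Rightarrow>
    ('k, nat \<Rightarrow> ('p \<Rightarrow> 'n) set, nat \<Rightarrow> ('p \<Rightarrow> 'n) set) graded_right_module"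
  where "ext_algebra R \<eta> P N = (ext_total R \<eta> P N)
    \<lparr>monoid.mult := right_act (ext_total R \<eta> P N),
     one := (\<lambda>m. if m = 0
       then coboundaries R \<eta> P N 0 +>\<^bsub>hom_module R \<eta> (res_mod P 0) N\<^esub>
         restrict (res_aug P) (carrier (res_mod P 0))
       else \<zero>\<^bsub>ext_module R \<eta> P N m\<^esub>)\<rparr>"


section \<open>The Drinfel'd double of a finite group and its modules\<close>

definition indic :: "('k, 'x) ring_scheme \<Rightarrow> bool \<Rightarrow> 'k"
  where "indic K p = (if p then \<one>\<^bsub>K\<^esub> else \<zero>\<^bsub>K\<^esub>)"

text \<open>
  An element of the double is given by its coefficients: the value at \<open>(a, b)\<close> is the coefficient
  of \<open>\<delta>\<^sub>a \<otimes> b\<close>.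
\<close>

definition drinfeld_double ::
  "('a, 'y) monoid_scheme \<Rightarrow> ('k, 'x) ring_scheme \<Rightarrow> ('a \<times> 'a \<Rightarrow> 'k) ring"
  where "drinfeld_double G K =
    (let B = carrier G \<times> carrier G in
     \<lparr>carrier = B \<rightarrow>\<^sub>E carrier K,
      monoid.mult = (\<lambda>f f'. \<lambda>z\<in>B. \<Oplus>\<^bsub>K\<^esub>x\<in>B. \<Oplus>\<^bsub>K\<^esub>y\<in>B. f x \<otimes>\<^bsub>K\<^esub> f' y \<otimes>\<^bsub>K\<^esub>
        (case (x, y) of ((a, b), (c, d)) \<Rightarrow>
          indic K (a = b \<otimes>\<^bsub>G\<^esub> c \<otimes>\<^bsub>G\<^esub> inv\<^bsub>G\<^esub> b \<and> z = (a, b \<otimes>\<^bsub>G\<^esub> d)))),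
      one = (\<lambda>(a, b)\<in>B. indic K (b = \<one>\<^bsub>G\<^esub>)),
      ring.zero = (\<lambda>z\<in>B. \<zero>\<^bsub>K\<^esub>),
      ring.add = (\<lambda>f f'. \<lambda>z\<in>B. f z \<oplus>\<^bsub>K\<^esub> f' z)\<rparr>)"

definition double_unit ::
  "('a, 'y) monoid_scheme \<Rightarrow> ('k, 'x) ring_scheme \<Rightarrow> 'k \<Rightarrow> 'a \<times> 'a \<Rightarrow> 'k"
  where "double_unit G K k =
    (\<lambda>z\<in>carrier G \<times> carrier G. k \<otimes>\<^bsub>K\<^esub> \<one>\<^bsub>drinfeld_double G K\<^esub> z)"

text \<open>
  The module over the double whose vector space has the basis \<open>u\<^sub>x\<close> (\<open>x \<in> B\<close>), vectors being
  identified with their coordinate functions. The action of basis elements \<open>z\<close> of the double is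
  given by the matrix entries \<open>r z x y\<close>, the coefficient of \<open>u\<^sub>y\<close> in \<open>z.u\<^sub>x\<close>, and extended linearly.
\<close>

definition based_module ::
  "('a, 'y) monoid_scheme \<Rightarrow> ('k, 'x) ring_scheme \<Rightarrow> 'b set \<Rightarrow> ('a \<times> 'a \<Rightarrow> 'b \<Rightarrow> 'b \<Rightarrow> 'k) \<Rightarrow>
    ('a \<times> 'a \<Rightarrow> 'k, 'b \<Rightarrow> 'k) module"
  where "based_module G K B r =
    \<lparr>carrier = B \<rightarrow>\<^sub>E carrier K,
     monoid.mult = undefined, one = undefined,
     ring.zero = (\<lambda>y\<in>B. \<zero>\<^bsub>K\<^esub>),
     ring.add = (\<lambda>f f'. \<lambda>y\<in>B. f y \<oplus>\<^bsub>K\<^esub> f' y),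
     smult = (\<lambda>d f. \<lambda>y\<in>B. \<Oplus>\<^bsub>K\<^esub>z\<in>carrier G \<times> carrier G. \<Oplus>\<^bsub>K\<^esub>x\<in>B.
       d z \<otimes>\<^bsub>K\<^esub> f x \<otimes>\<^bsub>K\<^esub> r z x y)\<rparr>"

definition double_counit ::
  "('a, 'y) monoid_scheme \<Rightarrow> ('k, 'x) ring_scheme \<Rightarrow> 'a \<times> 'a \<Rightarrow> 'k"
  where "double_counit G K z = indic K (fst z = \<one>\<^bsub>G\<^esub>)"

text \<open>The field as the trivial module; its basis element is written as the empty tensor.\<close>

definition trivial_module ::
  "('a, 'y) monoid_scheme \<Rightarrow> ('k, 'x) ring_scheme \<Rightarrow> ('a \<times> 'a \<Rightarrow> 'k, 'b list \<Rightarrow> 'k) module"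
  where "trivial_module G K = based_module G K {[]} (\<lambda>z _ _. double_counit G K z)"

text \<open>
  The left coadjoint action on the dual, in the dual basis \<open>u(a, b)\<close>. As
  \<open>\<delta>\<^sub>h \<otimes> k = (\<delta>\<^sub>h \<otimes> e)(\<epsilon> \<otimes> k)\<close>, one first conjugates by \<open>k\<close> and then applies \<open>\<delta>\<^sub>h \<otimes> e\<close>.
\<close>

definition coadjoint ::
  "('a, 'y) monoid_scheme \<Rightarrow> ('k, 'x) ring_scheme \<Rightarrow> 'a \<times> 'a \<Rightarrow> 'a \<times> 'a \<Rightarrow> 'a \<times> 'a \<Rightarrow> 'k"
  where "coadjoint G K z x y =
    (let (h, k) = z;
         a = k \<otimes>\<^bsub>G\<^esub> fst x \<otimes>\<^bsub>G\<^esub> inv\<^bsub>G\<^esub> k;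
         b = k \<otimes>\<^bsub>G\<^esub> snd x \<otimes>\<^bsub>G\<^esub> inv\<^bsub>G\<^esub> k in
     indic K (h = inv\<^bsub>G\<^esub> b \<otimes>\<^bsub>G\<^esub> a \<otimes>\<^bsub>G\<^esub> b \<otimes>\<^bsub>G\<^esub> inv\<^bsub>G\<^esub> a \<and> y = (a, b)))"

text \<open>
  Matrix entries of the iterated tensor product, the basis tensor
  \<open>u\<^sub>x\<^sub>1 \<otimes> \<dots> \<otimes> u\<^sub>x\<^sub>h\<close> being written as the list \<open>[x\<^sub>1, \<dots>, x\<^sub>h]\<close>. The recursion applies the coproduct
  \<open>\<Delta>(\<delta>\<^sub>a \<otimes> b) = \<Sum>\<^sub>c (\<delta>\<^sub>c \<otimes> b) \<otimes> (\<delta>\<^bsub>a inv(c)\<^esub> \<otimes> b)\<close>, and the counit on the empty tensor.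
\<close>

fun tensor_coeff ::
  "('a, 'y) monoid_scheme \<Rightarrow> ('k, 'x) ring_scheme \<Rightarrow> ('a \<times> 'a \<Rightarrow> 'b \<Rightarrow> 'b \<Rightarrow> 'k) \<Rightarrow>
    'a \<times> 'a \<Rightarrow> 'b list \<Rightarrow> 'b list \<Rightarrow> 'k"
  where
    "tensor_coeff G K r z [] [] = double_counit G K z"
  | "tensor_coeff G K r (a, b) (x # xs) (y # ys) =
      (\<Oplus>\<^bsub>K\<^esub>c\<in>carrier G. r (c, b) x y \<otimes>\<^bsub>K\<^esub> tensor_coeff G K r (a \<otimes>\<^bsub>G\<^esub> inv\<^bsub>G\<^esub> c, b) xs ys)"
  | "tensor_coeff G K r z _ _ = \<zero>\<^bsub>K\<^esub>"

definition L_power ::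
  "('a, 'y) monoid_scheme \<Rightarrow> ('k, 'x) ring_scheme \<Rightarrow> nat \<Rightarrow>
    ('a \<times> 'a \<Rightarrow> 'k, ('a \<times> 'a) list \<Rightarrow> 'k) module"
  where "L_power G K h = based_module G K
    {w. set w \<subseteq> carrier G \<times> carrier G \<and> length w = h} (tensor_coeff G K (coadjoint G K))"

lemma L_power_0: "L_power G K 0 = trivial_module G K"
proof -
  have fold: "(A, x) \<in> foldSetD D g e"
    if "(A, x) \<in> foldSetD D f e" and "\<forall>a\<in>A. f a = g a"
    for D e A x and f g :: "('a \<times> 'a) list \<Rightarrow> 'b \<Rightarrow> 'b"
    using that
  proof (induction rule: foldSetD.induct)
    case emptyI
    then show ?case
      by (simp add: foldSetD.emptyI)
  next
    case (insertI x A y)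
    then have "f x = g x" and "(A, y) \<in> foldSetD D g e"
      by blast+
    then show ?case
      using insertI.hyps foldSetD.insertI[of x A g y D e] by metis
  qed
  have fold_eq: "((A, x) \<in> foldSetD D f e) = ((A, x) \<in> foldSetD D g e)"
    if "\<forall>a\<in>A. f a = g a" for D e A x and f g :: "('a \<times> 'a) list \<Rightarrow> 'b \<Rightarrow> 'b"
    using that fold[of A x D f e g] fold[of A x D g e f] by metis
  have sum: "finsum K f {[]} = finsum K g {[]}"
    if "f [] = g []" for f g :: "('a \<times> 'a) list \<Rightarrow> 'b"
  proof -
    have "(({[]}, x) \<in> foldSetD D (ring.add K \<circ> f) e) = (({[]}, x) \<in> foldSetD D (ring.add K \<circ> g) e)" for x D e
      by (rule fold_eq) (simp add: that)
    then show ?thesis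
      by (simp add: finsum_def finprod_def foldD_def)
  qed
  have coeff: "finsum K (\<lambda>x. d z \<otimes>\<^bsub>K\<^esub> f x \<otimes>\<^bsub>K\<^esub> tensor_coeff G K (coadjoint G K) z x []) {[]} =
    finsum K (\<lambda>x. d z \<otimes>\<^bsub>K\<^esub> f x \<otimes>\<^bsub>K\<^esub> double_counit G K z) {[]}"
    for d z and f :: "('a \<times> 'a) list \<Rightarrow> 'b"
    by (rule sum) simp
  have "(\<lambda>y\<in>{[]}. \<Oplus>\<^bsub>K\<^esub>z\<in>carrier G \<times> carrier G. \<Oplus>\<^bsub>K\<^esub>x\<in>{[]}.
      d z \<otimes>\<^bsub>K\<^esub> f x \<otimes>\<^bsub>K\<^esub> tensor_coeff G K (coadjoint G K) z x y) =
    (\<lambda>y\<in>{[]}. \<Oplus>\<^bsub>K\<^esub>z\<in>carrier G \<times> carrier G. \<Oplus>\<^bsub>K\<^esub>x\<in>{[]}.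
      d z \<otimes>\<^bsub>K\<^esub> f x \<otimes>\<^bsub>K\<^esub> double_counit G K z)"
    for d and f :: "('a \<times> 'a) list \<Rightarrow> 'b"
    by (intro restrict_ext) (simp only: singleton_iff coeff)
  moreover have "{w. set w \<subseteq> carrier G \<times> carrier G \<and> length w = 0} = {[]}"
    by auto
  ultimately show ?thesis
    unfolding L_power_def trivial_module_def based_module_def by (simp only:)
qed


section \<open>The state spaces\<close>

text \<open>Here \<open>P\<close> is a projective resolution of the trivial module.\<close>

definition state_space ::
  "('a, 'y) monoid_scheme \<Rightarrow> ('k, 'x) ring_scheme \<Rightarrow>
    ('a \<times> 'a \<Rightarrow> 'k, 'p, ('a \<times> 'a) list \<Rightarrow> 'k) resolution \<Rightarrow> nat \<Rightarrow> nat \<Rightarrow>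
    ('k, ('p \<Rightarrow> ('a \<times> 'a) list \<Rightarrow> 'k) set) module"
  where "state_space G K P h m =
    ext_module (drinfeld_double G K) (double_unit G K) P (L_power G K h) m"

definition state_space_total ::
  "('a, 'y) monoid_scheme \<Rightarrow> ('k, 'x) ring_scheme \<Rightarrow>
    ('a \<times> 'a \<Rightarrow> 'k, 'p, ('a \<times> 'a) list \<Rightarrow> 'k) resolution \<Rightarrow> nat \<Rightarrow>
    ('k, nat \<Rightarrow> ('p \<Rightarrow> ('a \<times> 'a) list \<Rightarrow> 'k) set,
      nat \<Rightarrow> ('p \<Rightarrow> ('a \<times> 'a) list \<Rightarrow> 'k) set) graded_right_module"
  where "state_space_total G K P h =
    ext_total (drinfeld_double G K) (double_unit G K) P (L_power G K h)"

definition state_algebra ::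
  "('a, 'y) monoid_scheme \<Rightarrow> ('k, 'x) ring_scheme \<Rightarrow>
    ('a \<times> 'a \<Rightarrow> 'k, 'p, ('a \<times> 'a) list \<Rightarrow> 'k) resolution \<Rightarrow>
    ('k, nat \<Rightarrow> ('p \<Rightarrow> ('a \<times> 'a) list \<Rightarrow> 'k) set,
      nat \<Rightarrow> ('p \<Rightarrow> ('a \<times> 'a) list \<Rightarrow> 'k) set) graded_right_module"
  where "state_algebra G K P =
    ext_algebra (drinfeld_double G K) (double_unit G K) P (trivial_module G K)"

end

theory Submission
  imports Defs
begin

text \<open>
  For abelian \<open>G\<close> conjugation is trivial and \<open>b\<inverse>aba\<inverse> = e\<close>, so in the coadjoint action
  \<open>\<delta>\<^sub>h \<otimes> k\<close> multiplies every \<open>u(a, b)\<close> by \<open>\<delta>\<^bsub>h,e\<^esub>\<close>: the double acts on \<open>L\<close> through its counit.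
  The same then holds for the tensor powers, and \<open>L\<^bsup>\<otimes>g\<^esup>\<close> is a direct sum of copies of the trivial
  module \<open>K\<close>, one for each basis tensor, that is, for each word \<open>i\<close> of length \<open>g\<close> over \<open>G \<times> G\<close>
  (\<open>L_power_scalar\<close>). Everything else holds for any algebra with an augmentation \<open>\<epsilon>\<close>.

  Let \<open>B\<close> be the finite set of words, and \<open>P\<close> the resolution of \<open>K\<close> with augmentation \<open>P\<^sub>0 \<rightarrow> K\<close>.
  A cochain with values in \<open>K\<^sup>B\<close> is a family of cochains with values in \<open>K\<close>, and it is a cocycle or
  a coboundary iff all members are; hence \<open>Ext\<^sup>m(K, K\<^sup>B) = Ext\<^sup>m(K, K)\<^sup>B\<close> by taking coordinates
  (\<open>ext_coord_inj\<close>, \<open>ext_coord_surj\<close>). A class in \<open>Ext\<^sup>l(K, K)\<close> acts from the right by composition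
  with a chain map \<open>t : P\<^bsub>l+n\<^esub> \<rightarrow> P\<^sub>n\<close> that lifts it, and taking coordinates happens after applying the
  cochain, so the two commute (\<open>ext_coord_yoneda\<close>).

  In degree \<open>0\<close> a cocycle factors through the augmentation, so it is a vector of \<open>K\<^sup>B\<close>, and
  \<open>Ext\<^sup>0(K, K\<^sup>B)\<close> has the basis of classes \<open>e\<^sub>i\<close> of the augmentation placed in coordinate \<open>i\<close>
  (\<open>tensor_basis_ext\<close>). Tensoring \<open>W = Ext\<^sup>*(K, K)\<close> with a space with basis indexed by \<open>B\<close>
  gives \<open>W\<^sup>B\<close> (locale \<open>tensor_basis\<close>). Altogether
  \<open>x \<mapsto> \<Sum>\<^sub>i e\<^sub>i \<otimes> x\<^sub>i\<close> is the isomorphism, with \<open>x\<^sub>i\<close> the coordinates of \<open>x\<close>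
  (\<open>ext_total_isomorphic_tensor\<close>).

  That the right action is by linear maps of the total module rests on the comparison theorem:
  cocycles lift to chain maps (\<open>chain_lift_exists\<close>), and lifts of coboundaries are null-homotopic
  (\<open>chain_lift_of_coboundary\<close>). The latter shows that the product with a zero class is zero,
  without which a product of two elements of finite support need not have finite support.
\<close>

section \<open>Linear maps\<close>

lemma left_homI:
  assumes "\<And>x. x \<in> carrier M \<Longrightarrow> f x \<in> carrier N"
    and "\<And>x y. x \<in> carrier M \<Longrightarrow> y \<in> carrier M \<Longrightarrow> f (x \<oplus>\<^bsub>M\<^esub> y) = f x \<oplus>\<^bsub>N\<^esub> f y"
    and "\<And>r x. r \<in> carrier R \<Longrightarrow> x \<in> carrier M \<Longrightarrow> f (r \<odot>\<^bsub>M\<^esub> x) = r \<odot>\<^bsub>N\<^esub> f x"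
  shows "f \<in> left_hom R M N"
  using assms by (auto simp: left_hom_def)

lemma left_hom_closed: "f \<in> left_hom R M N \<Longrightarrow> x \<in> carrier M \<Longrightarrow> f x \<in> carrier N"
  by (auto simp: left_hom_def)

lemma left_hom_add:
  "f \<in> left_hom R M N \<Longrightarrow> x \<in> carrier M \<Longrightarrow> y \<in> carrier M \<Longrightarrow> f (x \<oplus>\<^bsub>M\<^esub> y) = f x \<oplus>\<^bsub>N\<^esub> f y"
  by (auto simp: left_hom_def)

lemma left_hom_smult:
  "f \<in> left_hom R M N \<Longrightarrow> r \<in> carrier R \<Longrightarrow> x \<in> carrier M \<Longrightarrow> f (r \<odot>\<^bsub>M\<^esub> x) = r \<odot>\<^bsub>N\<^esub> f x"
  by (auto simp: left_hom_def)

lemma left_hom_compose: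
  "f \<in> left_hom R A M \<Longrightarrow> h \<in> left_hom R M N \<Longrightarrow> (\<lambda>x. h (f x)) \<in> left_hom R A N"
  by (auto simp: left_hom_def Pi_iff)

lemma left_hom_group_hom:
  assumes "f \<in> left_hom R M N" "abelian_group M" "abelian_group N"
  shows "abelian_group_hom M N f"
  using assms
  by (intro abelian_group_homI group_hom.intro group_hom_axioms.intro abelian_group.a_group)
    (auto simp: left_hom_def hom_def)

lemma left_hom_zero:
  assumes "f \<in> left_hom R M N" "abelian_group M" "abelian_group N"
  shows "f \<zero>\<^bsub>M\<^esub> = \<zero>\<^bsub>N\<^esub>"
  using abelian_group_hom.hom_zero[OF left_hom_group_hom[OF assms]] .

lemma left_hom_minus:
  assumes "f \<in> left_hom R M N" "abelian_group M" "abelian_group N"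
    and "x \<in> carrier M" "y \<in> carrier M"
  shows "f (x \<ominus>\<^bsub>M\<^esub> y) = f x \<ominus>\<^bsub>N\<^esub> f y"
proof -
  interpret abelian_group_hom M N f
    using left_hom_group_hom[OF assms(1-3)] .
  show ?thesis
    using assms(4,5) by (simp add: a_minus_def)
qed

lemma group_hom_finsum:
  assumes "abelian_group_hom M N f" "finite I" "q \<in> I \<rightarrow> carrier M"
  shows "f (\<Oplus>\<^bsub>M\<^esub>i\<in>I. q i) = (\<Oplus>\<^bsub>N\<^esub>i\<in>I. f (q i))"
proof -
  interpret abelian_group_hom M N f by fact
  show ?thesis
    using assms(2,3)
  proof (induction I)
    case empty
    then show ?case
      by (simp add: G.finsum_empty H.finsum_empty)
  next
    case (insert j J)
    then show ?case
      by (simp add: G.finsum_insert H.finsum_insert Pi_iff)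
  qed
qed

lemma left_hom_finsum:
  assumes "f \<in> left_hom R M N" "abelian_group M" "abelian_group N"
    and "finite I" "q \<in> I \<rightarrow> carrier M"
  shows "f (\<Oplus>\<^bsub>M\<^esub>i\<in>I. q i) = (\<Oplus>\<^bsub>N\<^esub>i\<in>I. f (q i))"
  using group_hom_finsum[OF left_hom_group_hom[OF assms(1-3)] assms(4,5)] .

lemma smult_group_hom:
  assumes "left_module R M" "r \<in> carrier R"
  shows "abelian_group_hom M M (\<lambda>x. r \<odot>\<^bsub>M\<^esub> x)"
proof -
  interpret left_module R M by fact
  show ?thesis
    using assms(2)
    by (intro abelian_group_homI group_hom.intro group_hom_axioms.intro M.a_group M.abelian_group_axioms)
      (auto simp: hom_def smult_closed smult_r_distr)
qed

lemma minus_eq_zero_iff: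
  assumes "abelian_group M" "x \<in> carrier M" "y \<in> carrier M"
  shows "x \<ominus>\<^bsub>M\<^esub> y = \<zero>\<^bsub>M\<^esub> \<longleftrightarrow> x = y"
proof -
  interpret abelian_group M by fact
  show ?thesis
    using assms(2,3) by (metis a_minus_def r_neg minus_equality minus_minus a_inv_closed)
qed

lemma minus_zero:
  assumes "abelian_group M"
  shows "\<ominus>\<^bsub>M\<^esub> \<zero>\<^bsub>M\<^esub> = \<zero>\<^bsub>M\<^esub>"
proof -
  interpret abelian_group M by fact
  show ?thesis
    using minus_equality[of "\<zero>\<^bsub>M\<^esub>" "\<zero>\<^bsub>M\<^esub>"] by simp
qed

lemma minus_zero_right:
  assumes "abelian_group M" "x \<in> carrier M"
  shows "x \<ominus>\<^bsub>M\<^esub> \<zero>\<^bsub>M\<^esub> = x"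
  using assms minus_zero[OF assms(1)] by (simp add: a_minus_def abelian_monoid.r_zero abelian_group.axioms)

lemma left_hom_diff:
  assumes "f \<in> left_hom R M N" "f' \<in> left_hom R M N" "abelian_group M" "left_module R N"
  shows "(\<lambda>x. f x \<ominus>\<^bsub>N\<^esub> f' x) \<in> left_hom R M N"
proof (rule left_homI)
  interpret N: left_module R N by fact
  interpret M: abelian_group M by fact
  fix x assume x: "x \<in> carrier M"
  show "f x \<ominus>\<^bsub>N\<^esub> f' x \<in> carrier N"
    using x assms(1,2) by (simp add: left_hom_closed)
  fix y assume y: "y \<in> carrier M"
  have "f x \<in> carrier N" "f' x \<in> carrier N" "f y \<in> carrier N" "f' y \<in> carrier N"
    using x y assms(1,2) by (simp_all add: left_hom_closed)
  then show "f (x \<oplus>\<^bsub>M\<^esub> y) \<ominus>\<^bsub>N\<^esub> f' (x \<oplus>\<^bsub>M\<^esub> y) = (f x \<ominus>\<^bsub>N\<^esub> f' x) \<oplus>\<^bsub>N\<^esub> (f y \<ominus>\<^bsub>N\<^esub> f' y)"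
    using x y assms(1,2)
    by (simp add: left_hom_add a_minus_def N.M.minus_add N.M.a_ac)
next
  interpret N: left_module R N by fact
  interpret M: abelian_group M by fact
  fix r x assume r: "r \<in> carrier R" and x: "x \<in> carrier M"
  have c: "f x \<in> carrier N" "f' x \<in> carrier N"
    using x assms(1,2) by (simp_all add: left_hom_closed)
  interpret S: abelian_group_hom N N "\<lambda>z. r \<odot>\<^bsub>N\<^esub> z"
    using smult_group_hom[OF assms(4) r] .
  show "f (r \<odot>\<^bsub>M\<^esub> x) \<ominus>\<^bsub>N\<^esub> f' (r \<odot>\<^bsub>M\<^esub> x) = r \<odot>\<^bsub>N\<^esub> (f x \<ominus>\<^bsub>N\<^esub> f' x)"
    using c r x assms(1,2) S.hom_add[of "f x" "\<ominus>\<^bsub>N\<^esub> f' x"] S.hom_a_inv[of "f' x"]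
    by (simp add: left_hom_smult a_minus_def)
qed

lemma left_module_smult_l_null:
  assumes "left_module R M" "x \<in> carrier M"
  shows "\<zero>\<^bsub>R\<^esub> \<odot>\<^bsub>M\<^esub> x = \<zero>\<^bsub>M\<^esub>"
proof -
  interpret left_module R M by fact
  have "\<zero>\<^bsub>R\<^esub> \<odot>\<^bsub>M\<^esub> x = \<zero>\<^bsub>R\<^esub> \<odot>\<^bsub>M\<^esub> x \<oplus>\<^bsub>M\<^esub> \<zero>\<^bsub>R\<^esub> \<odot>\<^bsub>M\<^esub> x"
    using smult_l_distr[of "\<zero>\<^bsub>R\<^esub>" "\<zero>\<^bsub>R\<^esub>" x] assms(2) by simp
  then show ?thesis
    using smult_closed[OF R.zero_closed assms(2)] by (metis M.add.r_cancel_one')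
qed

lemma module_imp_left_module: "module K M \<Longrightarrow> left_module K M"
  unfolding module_def left_module_def module_axioms_def left_module_axioms_def cring_def by auto

lemma left_module_imp_module: "cring K \<Longrightarrow> left_module K M \<Longrightarrow> module K M"
  unfolding module_def left_module_def module_axioms_def left_module_axioms_def by auto

lemma module_abelian_group: "module K M \<Longrightarrow> abelian_group M"
  by (simp add: module_def)

lemma left_module_abelian_group: "left_module R M \<Longrightarrow> abelian_group M"
  by (simp add: left_module_def)


section \<open>Free modules and linear extension\<close>

lemma free_module_sel:
  "carrier (free_module R S) = {f \<in> S \<rightarrow>\<^sub>E carrier R. finite {x \<in> S. f x \<noteq> \<zero>\<^bsub>R\<^esub>}}"
  "\<zero>\<^bsub>free_module R S\<^esub> = (\<lambda>x\<in>S. \<zero>\<^bsub>R\<^esub>)"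
  "f \<oplus>\<^bsub>free_module R S\<^esub> f' = (\<lambda>x\<in>S. f x \<oplus>\<^bsub>R\<^esub> f' x)"
  "r \<odot>\<^bsub>free_module R S\<^esub> f = (\<lambda>x\<in>S. r \<otimes>\<^bsub>R\<^esub> f x)"
  by (simp_all add: free_module_def)

lemma free_module_left_module:
  assumes "ring R"
  shows "left_module R (free_module R S)"
proof -
  interpret R: ring R by fact
  let ?F = "free_module R S"
  have add: "f \<oplus>\<^bsub>?F\<^esub> f' \<in> carrier ?F" if "f \<in> carrier ?F" "f' \<in> carrier ?F" for f f'
  proof -
    have "{x \<in> S. f x \<oplus>\<^bsub>R\<^esub> f' x \<noteq> \<zero>\<^bsub>R\<^esub>} \<subseteq> {x \<in> S. f x \<noteq> \<zero>\<^bsub>R\<^esub>} \<union> {x \<in> S. f' x \<noteq> \<zero>\<^bsub>R\<^esub>}"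
      by auto
    then show ?thesis
      using that by (auto simp: free_module_sel PiE_iff intro: finite_subset)
  qed
  have smult: "r \<odot>\<^bsub>?F\<^esub> f \<in> carrier ?F" if "r \<in> carrier R" "f \<in> carrier ?F" for r f
  proof -
    have "{x \<in> S. r \<otimes>\<^bsub>R\<^esub> f x \<noteq> \<zero>\<^bsub>R\<^esub>} \<subseteq> {x \<in> S. f x \<noteq> \<zero>\<^bsub>R\<^esub>}"
      using that by auto
    then show ?thesis
      using that by (auto simp: free_module_sel PiE_iff intro: finite_subset)
  qed
  have "abelian_group ?F"
  proof (rule abelian_groupI)
    fix f assume f: "f \<in> carrier ?F"
    have "{x \<in> S. (\<lambda>x\<in>S. \<ominus>\<^bsub>R\<^esub> f x) x \<noteq> \<zero>\<^bsub>R\<^esub>} \<subseteq> {x \<in> S. f x \<noteq> \<zero>\<^bsub>R\<^esub>}"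
      by auto
    moreover have "finite {x \<in> S. f x \<noteq> \<zero>\<^bsub>R\<^esub>}"
      using f by (auto simp: free_module_sel)
    ultimately have "finite {x \<in> S. (\<lambda>x\<in>S. \<ominus>\<^bsub>R\<^esub> f x) x \<noteq> \<zero>\<^bsub>R\<^esub>}"
      by (rule finite_subset)
    then have "(\<lambda>x\<in>S. \<ominus>\<^bsub>R\<^esub> f x) \<in> carrier ?F"
      using f by (auto simp: free_module_sel PiE_iff)
    moreover have "(\<lambda>x\<in>S. \<ominus>\<^bsub>R\<^esub> f x) \<oplus>\<^bsub>?F\<^esub> f = \<zero>\<^bsub>?F\<^esub>"
      using f by (auto simp: free_module_sel PiE_iff R.l_neg)
    ultimately show "\<exists>y\<in>carrier ?F. y \<oplus>\<^bsub>?F\<^esub> f = \<zero>\<^bsub>?F\<^esub>"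
      by blast
  qed (use add in \<open>auto simp: free_module_sel PiE_iff R.a_ac fun_eq_iff extensional_def\<close>)
  then show ?thesis
    unfolding left_module_def left_module_axioms_def using assms smult
    by (auto simp: free_module_sel PiE_iff R.l_distr R.r_distr R.m_assoc fun_eq_iff extensional_def)
qed

lemma free_basis_closed:
  assumes "ring R" "i \<in> S"
  shows "free_basis R S i \<in> carrier (free_module R S)"
proof -
  interpret ring R by fact
  have "{x \<in> S. free_basis R S i x \<noteq> \<zero>\<^bsub>R\<^esub>} \<subseteq> {i}"
    by (auto simp: free_basis_def split: if_splits)
  then show ?thesis
    by (auto simp: free_module_sel free_basis_def intro: finite_subset)
qed

definition linear_extension ::
  "('d, 'x) ring_scheme \<Rightarrow> 'i set \<Rightarrow> ('d, 'm, 'y) module_scheme \<Rightarrow> ('i \<Rightarrow> 'm) \<Rightarrow> ('i \<Rightarrow> 'd) \<Rightarrow> 'm"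
  where "linear_extension R S M q f = (\<Oplus>\<^bsub>M\<^esub>i\<in>{i \<in> S. f i \<noteq> \<zero>\<^bsub>R\<^esub>}. f i \<odot>\<^bsub>M\<^esub> q i)"

text \<open>
  The support of a sum of two functions may be smaller than the union of their supports. Summing
  over a larger finite set instead puts the sum and its two terms over one index set.
\<close>

lemma linear_extension_eq_finsum:
  assumes "left_module R M" "q \<in> S \<rightarrow> carrier M" "f \<in> S \<rightarrow> carrier R"
    and "finite A" "A \<subseteq> S" "{i \<in> S. f i \<noteq> \<zero>\<^bsub>R\<^esub>} \<subseteq> A"
  shows "linear_extension R S M q f = (\<Oplus>\<^bsub>M\<^esub>i\<in>A. f i \<odot>\<^bsub>M\<^esub> q i)"
proof -
  interpret left_module R M by fact
  show ?thesis
    unfolding linear_extension_def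
  proof (rule M.add.finprod_mono_neutral_cong_left[OF assms(4,6)])
    show "(\<lambda>i. f i \<odot>\<^bsub>M\<^esub> q i) \<in> A \<rightarrow> carrier M"
      using assms(2,3,5) by (auto intro!: smult_closed)
    show "f i \<odot>\<^bsub>M\<^esub> q i = \<zero>\<^bsub>M\<^esub>" if "i \<in> A - {i \<in> S. f i \<noteq> \<zero>\<^bsub>R\<^esub>}" for i
    proof -
      have "f i = \<zero>\<^bsub>R\<^esub>" "q i \<in> carrier M"
        using that assms(2,5) by auto
      then show ?thesis
        by (simp add: left_module_smult_l_null[OF assms(1)])
    qed
  qed auto
qed

lemma linear_extension_hom:
  assumes "left_module R M" "q \<in> S \<rightarrow> carrier M"
  shows "linear_extension R S M q \<in> left_hom R (free_module R S) M"
proof -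
  interpret left_module R M by fact
  interpret F: left_module R "free_module R S"
    using free_module_left_module[OF R.ring_axioms] .
  let ?F = "free_module R S"
  let ?supp = "\<lambda>f. {i \<in> S. f i \<noteq> \<zero>\<^bsub>R\<^esub>}"
  have PiF: "f \<in> S \<rightarrow> carrier R" "finite (?supp f)" if "f \<in> carrier ?F" for f
    using that by (auto simp: free_module_sel)
  have eq: "linear_extension R S M q f = (\<Oplus>\<^bsub>M\<^esub>i\<in>A. f i \<odot>\<^bsub>M\<^esub> q i)"
    if "f \<in> carrier ?F" "finite A" "A \<subseteq> S" "?supp f \<subseteq> A" for f A
    using linear_extension_eq_finsum[OF assms PiF(1)] that by blast
  have cl: "(\<lambda>i. f i \<odot>\<^bsub>M\<^esub> q i) \<in> A \<rightarrow> carrier M" if "f \<in> carrier ?F" "A \<subseteq> S" for f A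
    using that PiF(1)[of f] assms(2) by (auto intro!: smult_closed)
  show ?thesis
  proof (rule left_homI)
    fix f assume f: "f \<in> carrier ?F"
    show "linear_extension R S M q f \<in> carrier M"
      unfolding linear_extension_def by (rule M.finsum_closed) (rule cl[OF f], auto)
    fix f' assume f': "f' \<in> carrier ?F"
    let ?A = "?supp f \<union> ?supp f'"
    have A: "finite ?A" "?A \<subseteq> S" "?supp f \<subseteq> ?A" "?supp f' \<subseteq> ?A"
      using PiF[OF f] PiF[OF f'] by auto
    have sub: "?supp (f \<oplus>\<^bsub>?F\<^esub> f') \<subseteq> ?A"
      by (auto simp: free_module_sel)
    have "linear_extension R S M q (f \<oplus>\<^bsub>?F\<^esub> f')
        = (\<Oplus>\<^bsub>M\<^esub>i\<in>?A. (f \<oplus>\<^bsub>?F\<^esub> f') i \<odot>\<^bsub>M\<^esub> q i)"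
      using eq[OF F.M.a_closed[OF f f'] A(1,2) sub] .
    also have "\<dots> = (\<Oplus>\<^bsub>M\<^esub>i\<in>?A. f i \<odot>\<^bsub>M\<^esub> q i \<oplus>\<^bsub>M\<^esub> f' i \<odot>\<^bsub>M\<^esub> q i)"
    proof (rule M.add.finprod_cong')
      show "(\<lambda>i. f i \<odot>\<^bsub>M\<^esub> q i \<oplus>\<^bsub>M\<^esub> f' i \<odot>\<^bsub>M\<^esub> q i) \<in> ?A \<rightarrow> carrier M"
        using cl[OF f A(2)] cl[OF f' A(2)] by (auto simp: Pi_iff)
      fix i assume "i \<in> ?A"
      then show "(f \<oplus>\<^bsub>?F\<^esub> f') i \<odot>\<^bsub>M\<^esub> q i = f i \<odot>\<^bsub>M\<^esub> q i \<oplus>\<^bsub>M\<^esub> f' i \<odot>\<^bsub>M\<^esub> q i"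
        using PiF(1)[OF f] PiF(1)[OF f'] assms(2) smult_l_distr
        by (auto simp: free_module_sel Pi_iff)
    qed simp
    also have "\<dots> = (\<Oplus>\<^bsub>M\<^esub>i\<in>?A. f i \<odot>\<^bsub>M\<^esub> q i) \<oplus>\<^bsub>M\<^esub> (\<Oplus>\<^bsub>M\<^esub>i\<in>?A. f' i \<odot>\<^bsub>M\<^esub> q i)"
      using M.finsum_addf[OF cl[OF f A(2)] cl[OF f' A(2)]] .
    finally show "linear_extension R S M q (f \<oplus>\<^bsub>?F\<^esub> f')
        = linear_extension R S M q f \<oplus>\<^bsub>M\<^esub> linear_extension R S M q f'"
      using eq[OF f A(1-3)] eq[OF f' A(1,2,4)] by simp
  next
    fix r f assume r: "r \<in> carrier R" and f: "f \<in> carrier ?F"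
    let ?A = "?supp f"
    have A: "finite ?A" "?A \<subseteq> S"
      using PiF[OF f] by auto
    have sub: "?supp (r \<odot>\<^bsub>?F\<^esub> f) \<subseteq> ?A"
      using r by (auto simp: free_module_sel)
    note dist = group_hom_finsum[OF smult_group_hom[OF assms(1) r] A(1) cl[OF f A(2)]]
    have "linear_extension R S M q (r \<odot>\<^bsub>?F\<^esub> f)
        = (\<Oplus>\<^bsub>M\<^esub>i\<in>?A. (r \<odot>\<^bsub>?F\<^esub> f) i \<odot>\<^bsub>M\<^esub> q i)"
      using eq[OF F.smult_closed[OF r f] A sub] .
    also have "\<dots> = (\<Oplus>\<^bsub>M\<^esub>i\<in>?A. r \<odot>\<^bsub>M\<^esub> (f i \<odot>\<^bsub>M\<^esub> q i))"
    proof (rule M.add.finprod_cong')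
      show "(\<lambda>i. r \<odot>\<^bsub>M\<^esub> (f i \<odot>\<^bsub>M\<^esub> q i)) \<in> ?A \<rightarrow> carrier M"
        using cl[OF f A(2)] r by (auto simp: Pi_iff smult_closed)
      fix i assume "i \<in> ?A"
      then show "(r \<odot>\<^bsub>?F\<^esub> f) i \<odot>\<^bsub>M\<^esub> q i = r \<odot>\<^bsub>M\<^esub> (f i \<odot>\<^bsub>M\<^esub> q i)"
        using PiF(1)[OF f] assms(2) smult_assoc[OF r] by (auto simp: free_module_sel Pi_iff)
    qed simp
    also have "\<dots> = r \<odot>\<^bsub>M\<^esub> linear_extension R S M q f"
      unfolding dist[symmetric] linear_extension_def ..
    finally show "linear_extension R S M q (r \<odot>\<^bsub>?F\<^esub> f) = r \<odot>\<^bsub>M\<^esub> linear_extension R S M q f" .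
  qed
qed

lemma linear_extension_basis:
  assumes "left_module R M" "q \<in> S \<rightarrow> carrier M" "i \<in> S"
  shows "linear_extension R S M q (free_basis R S i) = q i"
proof -
  interpret left_module R M by fact
  have qi: "q i \<in> carrier M"
    using assms by auto
  have "linear_extension R S M q (free_basis R S i) = (\<Oplus>\<^bsub>M\<^esub>j\<in>{i}. free_basis R S i j \<odot>\<^bsub>M\<^esub> q j)"
    using assms free_basis_closed[OF R.ring_axioms assms(3)]
    by (intro linear_extension_eq_finsum) (auto simp: free_module_sel free_basis_def split: if_splits)
  also have "\<dots> = q i"
    using qi assms(3) by (simp add: free_basis_def M.finsum_insert M.finsum_empty smult_one)
  finally show ?thesis .
qed

lemma free_module_expand:
  assumes "ring R" "f \<in> carrier (free_module R S)"
  shows "linear_extension R S (free_module R S) (free_basis R S) f = f"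
proof -
  interpret F: left_module R "free_module R S"
    using free_module_left_module[OF assms(1)] .
  let ?F = "free_module R S"
  have fR: "f \<in> S \<rightarrow>\<^sub>E carrier R"
    using assms(2) by (auto simp: free_module_sel)
  have sum: "(\<Oplus>\<^bsub>?F\<^esub>i\<in>A. f i \<odot>\<^bsub>?F\<^esub> free_basis R S i) = (\<lambda>x\<in>S. if x \<in> A then f x else \<zero>\<^bsub>R\<^esub>)"
    if "finite A" "A \<subseteq> S" for A
    using that
  proof (induction A)
    case empty
    then show ?case
      by (simp add: F.M.finsum_empty free_module_sel)
  next
    case (insert j J)
    have "f i \<odot>\<^bsub>?F\<^esub> free_basis R S i \<in> carrier ?F" if "i \<in> S" for i
      using fR that F.smult_closed[OF _ free_basis_closed[OF assms(1) that]] by (auto simp: PiE_iff)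
    then have "(\<Oplus>\<^bsub>?F\<^esub>i\<in>insert j J. f i \<odot>\<^bsub>?F\<^esub> free_basis R S i)
      = f j \<odot>\<^bsub>?F\<^esub> free_basis R S j \<oplus>\<^bsub>?F\<^esub> (\<Oplus>\<^bsub>?F\<^esub>i\<in>J. f i \<odot>\<^bsub>?F\<^esub> free_basis R S i)"
      using insert.hyps insert.prems by (intro F.M.finsum_insert) auto
    also have "\<dots> = f j \<odot>\<^bsub>?F\<^esub> free_basis R S j \<oplus>\<^bsub>?F\<^esub> (\<lambda>x\<in>S. if x \<in> J then f x else \<zero>\<^bsub>R\<^esub>)"
      using insert.IH insert.prems by (simp only: insert_subset)
    also have "\<dots> = (\<lambda>x\<in>S. if x \<in> insert j J then f x else \<zero>\<^bsub>R\<^esub>)"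
      using insert.prems insert.hyps fR by (auto simp: free_module_sel free_basis_def PiE_iff fun_eq_iff)
    finally show ?case .
  qed
  have "linear_extension R S ?F (free_basis R S) f = (\<lambda>x\<in>S. if x \<in> {i \<in> S. f i \<noteq> \<zero>\<^bsub>R\<^esub>} then f x else \<zero>\<^bsub>R\<^esub>)"
    unfolding linear_extension_def using assms(2) by (intro sum) (auto simp: free_module_sel)
  also have "\<dots> = f"
    using fR by (auto simp: fun_eq_iff PiE_iff extensional_def)
  finally show ?thesis .
qed

text \<open>
  The target is a group with a scalar multiplication that need not satisfy the module laws; the
  values of \<open>h\<close> inherit the ones that matter from the free module. Augmentations are maps into such
  targets.
\<close>

lemma hom_eq_linear_extension:
  assumes "ring R" "abelian_group M"
    and "h \<in> left_hom R (free_module R S) M" "f \<in> carrier (free_module R S)"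
  shows "h f = linear_extension R S M (\<lambda>i. h (free_basis R S i)) f"
proof -
  interpret M: abelian_group M by fact
  interpret F: left_module R "free_module R S"
    using free_module_left_module[OF assms(1)] .
  let ?F = "free_module R S" and ?A = "{i \<in> S. f i \<noteq> \<zero>\<^bsub>R\<^esub>}"
  have fin: "finite ?A" and fR: "f \<in> S \<rightarrow> carrier R"
    using assms(4) by (auto simp: free_module_sel)
  have cl: "(\<lambda>i. f i \<odot>\<^bsub>?F\<^esub> free_basis R S i) \<in> ?A \<rightarrow> carrier ?F"
    using fR free_basis_closed[OF assms(1)] by (auto intro!: F.smult_closed)
  have smult: "h (f i \<odot>\<^bsub>?F\<^esub> free_basis R S i) = f i \<odot>\<^bsub>M\<^esub> h (free_basis R S i)" if "i \<in> ?A" for i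
    using that fR free_basis_closed[OF assms(1)] by (intro left_hom_smult[OF assms(3)]) auto
  from left_hom_finsum[OF assms(3) F.M.abelian_group_axioms assms(2) fin cl]
  have "h f = (\<Oplus>\<^bsub>M\<^esub>i\<in>?A. h (f i \<odot>\<^bsub>?F\<^esub> free_basis R S i))"
    using free_module_expand[OF assms(1,4)] by (simp add: linear_extension_def)
  also have "\<dots> = (\<Oplus>\<^bsub>M\<^esub>i\<in>?A. f i \<odot>\<^bsub>M\<^esub> h (free_basis R S i))"
  proof (rule M.add.finprod_cong')
    show "(\<lambda>i. f i \<odot>\<^bsub>M\<^esub> h (free_basis R S i)) \<in> ?A \<rightarrow> carrier M"
    proof
      fix i assume i: "i \<in> ?A"
      then have "h (f i \<odot>\<^bsub>?F\<^esub> free_basis R S i) \<in> carrier M"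
        using cl by (blast intro: left_hom_closed[OF assms(3)])
      then show "f i \<odot>\<^bsub>M\<^esub> h (free_basis R S i) \<in> carrier M"
        using smult[OF i] by simp
    qed
  qed (use smult in auto)
  finally show ?thesis
    by (simp add: linear_extension_def)
qed

lemma hom_eq_on_basis:
  assumes "ring R" "abelian_group M"
    and "h \<in> left_hom R (free_module R S) M" "h' \<in> left_hom R (free_module R S) M"
    and "\<And>i. i \<in> S \<Longrightarrow> h (free_basis R S i) = h' (free_basis R S i)"
    and "f \<in> carrier (free_module R S)"
  shows "h f = h' f"
proof -
  interpret M: abelian_group M by fact
  interpret F: left_module R "free_module R S"
    using free_module_left_module[OF assms(1)] .
  have "f i \<odot>\<^bsub>M\<^esub> h (free_basis R S i) \<in> carrier M" if "i \<in> S" for i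
  proof -
    have "f i \<in> carrier R"
      using that assms(6) by (auto simp: free_module_sel)
    then show ?thesis
      using that free_basis_closed[OF assms(1)] left_hom_smult[OF assms(3)] left_hom_closed[OF assms(3)]
        F.smult_closed by metis
  qed
  then have "linear_extension R S M (\<lambda>i. h (free_basis R S i)) f
      = linear_extension R S M (\<lambda>i. h' (free_basis R S i)) f"
    unfolding linear_extension_def using assms(5) by (intro M.add.finprod_cong') auto
  then show ?thesis
    using hom_eq_linear_extension[OF assms(1,2,3,6)] hom_eq_linear_extension[OF assms(1,2,4,6)] by simp
qed


section \<open>Lifting through projective modules\<close>

text \<open>
  A lift is chosen on the basis of a free module of which \<open>A\<close> is a summand, extended linearly, and
  restricted to \<open>A\<close>.
\<close>

lemma projective_lift:
  fixes A :: "('d, 'm, 'y) module_scheme"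
  assumes "projective_module R A" "left_module R Q" "abelian_group N"
    and "\<alpha> \<in> left_hom R A N" "\<beta> \<in> left_hom R Q N" "\<alpha> ` carrier A \<subseteq> \<beta> ` carrier Q"
  obtains \<gamma> where "\<gamma> \<in> left_hom R A Q" "\<And>x. x \<in> carrier A \<Longrightarrow> \<beta> (\<gamma> x) = \<alpha> x"
proof -
  interpret A: left_module R A
    using assms(1) by (simp add: projective_module_def)
  obtain S :: "'m set" and i p where i: "i \<in> left_hom R A (free_module R S)" and p: "p \<in> left_hom R (free_module R S) A"
    and pi: "\<And>x. x \<in> carrier A \<Longrightarrow> p (i x) = x"
    using assms(1) unfolding projective_module_def by auto
  let ?F = "free_module R S" and ?e = "free_basis R S"
  have "\<exists>y\<in>carrier Q. \<beta> y = \<alpha> (p (?e s))" if "s \<in> S" for s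
    using assms(6) left_hom_closed[OF p free_basis_closed[OF A.R.ring_axioms that]] by force
  then obtain q where q: "\<And>s. s \<in> S \<Longrightarrow> q s \<in> carrier Q \<and> \<beta> (q s) = \<alpha> (p (?e s))"
    by metis
  \<comment> \<open>the lift on the free module; the two sides agree on the basis\<close>
  let ?h = "linear_extension R S Q q"
  have h: "?h \<in> left_hom R ?F Q"
    using q by (intro linear_extension_hom[OF assms(2)]) auto
  have "\<beta> (?h f) = \<alpha> (p f)" if "f \<in> carrier ?F" for f
    using A.R.ring_axioms assms(3) left_hom_compose[OF h assms(5)] left_hom_compose[OF p assms(4)] _ that
  proof (rule hom_eq_on_basis)
    show "\<beta> (?h (?e s)) = \<alpha> (p (?e s))" if "s \<in> S" for s
      using linear_extension_basis[OF assms(2) _ that, of q] q that by auto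
  qed
  then have "\<beta> (?h (i x)) = \<alpha> x" if "x \<in> carrier A" for x
    using left_hom_closed[OF i that] pi[OF that] by simp
  then show thesis
    using that left_hom_compose[OF i h] by blast
qed


section \<open>Subquotient modules and spans\<close>

text \<open>
  The subquotients in question are cohomology (cocycles modulo coboundaries) and the tensor product
  (the free module on pairs modulo the bilinearity relations).
\<close>

locale subquotient = module R M for R (structure) and M (structure) +
  fixes S N
  assumes num: "submodule S R M" and den: "submodule N R M" and den_le: "N \<subseteq> S"
begin

sublocale N: abelian_subgroup N M
proof (rule abelian_subgroupI3)
  show "additive_subgroup N M"
    using den by (simp add: additive_subgroup_def submodule_def)
qed (rule M.abelian_group_axioms)

abbreviation Q where "Q \<equiv> subquotient_module M S N"

lemma num_closed: "x \<in> S \<Longrightarrow> x \<in> carrier M"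
  using submoduleE(1)[OF num] by auto

lemma coset_self: "x \<in> S \<Longrightarrow> x \<in> N +>\<^bsub>M\<^esub> x"
  using N.a_rcos_self num_closed by simp

lemma mem_coset_iff:
  assumes "x \<in> carrier M" "y \<in> carrier M"
  shows "y \<in> N +>\<^bsub>M\<^esub> x \<longleftrightarrow> y \<ominus>\<^bsub>M\<^esub> x \<in> N"
  using N.a_rcos_module[OF assms] by (simp add: a_minus_def)

lemma coset_eq_iff:
  assumes "x \<in> carrier M" "y \<in> carrier M"
  shows "N +>\<^bsub>M\<^esub> x = N +>\<^bsub>M\<^esub> y \<longleftrightarrow> x \<ominus>\<^bsub>M\<^esub> y \<in> N"
  using N.a_repr_independence'[of x y] N.a_repr_independenceD[of x y] mem_coset_iff[OF assms(2,1)] assms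
  by metis

lemma coset_den: "x \<in> N \<Longrightarrow> N +>\<^bsub>M\<^esub> x = N"
  by (rule N.a_rcos_const)

lemma coset_eq_if_mem: "x \<in> carrier M \<Longrightarrow> y \<in> N +>\<^bsub>M\<^esub> x \<Longrightarrow> N +>\<^bsub>M\<^esub> y = N +>\<^bsub>M\<^esub> x"
  using N.a_repr_independence' by metis

lemma subquotient_sel:
  "carrier Q = {N +>\<^bsub>M\<^esub> x | x. x \<in> S}"
  "\<zero>\<^bsub>Q\<^esub> = N"
  "A \<oplus>\<^bsub>Q\<^esub> B = A <+>\<^bsub>M\<^esub> B"
  "k \<odot>\<^bsub>Q\<^esub> A = (\<Union>x\<in>A. N +>\<^bsub>M\<^esub> (k \<odot>\<^bsub>M\<^esub> x))"
  by (simp_all add: subquotient_module_def)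

lemma coset_closed: "x \<in> S \<Longrightarrow> N +>\<^bsub>M\<^esub> x \<in> carrier Q"
  by (auto simp: subquotient_sel)

lemma coset_cases:
  assumes "A \<in> carrier Q"
  obtains x where "x \<in> S" "A = N +>\<^bsub>M\<^esub> x"
  using assms by (auto simp: subquotient_sel)

lemma coset_memD:
  assumes "A \<in> carrier Q" "x \<in> A"
  shows "x \<in> S" "A = N +>\<^bsub>M\<^esub> x"
proof -
  obtain y where y: "y \<in> S" "A = N +>\<^bsub>M\<^esub> y"
    using assms(1) by (rule coset_cases)
  then obtain n where "n \<in> N" "x = n \<oplus>\<^bsub>M\<^esub> y"
    using assms(2) by (auto simp: a_r_coset_def')
  then show "x \<in> S"
    using y den_le submoduleE(5)[OF num] by auto
  show "A = N +>\<^bsub>M\<^esub> x"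
    using y assms(2) coset_eq_if_mem[OF num_closed[OF y(1)], of x] by simp
qed

lemma coset_add:
  "x \<in> S \<Longrightarrow> y \<in> S \<Longrightarrow> N +>\<^bsub>M\<^esub> (x \<oplus>\<^bsub>M\<^esub> y) = (N +>\<^bsub>M\<^esub> x) \<oplus>\<^bsub>Q\<^esub> (N +>\<^bsub>M\<^esub> y)"
  using N.a_rcos_sum num_closed by (simp add: subquotient_sel)

lemma coset_smult:
  assumes "k \<in> carrier R" "x \<in> S"
  shows "N +>\<^bsub>M\<^esub> (k \<odot>\<^bsub>M\<^esub> x) = k \<odot>\<^bsub>Q\<^esub> (N +>\<^bsub>M\<^esub> x)"
proof -
  have "N +>\<^bsub>M\<^esub> (k \<odot>\<^bsub>M\<^esub> y) = N +>\<^bsub>M\<^esub> (k \<odot>\<^bsub>M\<^esub> x)" if y: "y \<in> N +>\<^bsub>M\<^esub> x" for y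
  proof -
    have x: "x \<in> carrier M" and yM: "y \<in> carrier M"
      using assms(2) num_closed N.a_elemrcos_carrier y by auto
    have "y \<ominus>\<^bsub>M\<^esub> x \<in> N"
      using mem_coset_iff[OF x yM] y by simp
    then have "k \<odot>\<^bsub>M\<^esub> (y \<ominus>\<^bsub>M\<^esub> x) \<in> N"
      using submoduleE(4)[OF den assms(1)] by simp
    moreover have "k \<odot>\<^bsub>M\<^esub> (y \<ominus>\<^bsub>M\<^esub> x) = k \<odot>\<^bsub>M\<^esub> y \<ominus>\<^bsub>M\<^esub> k \<odot>\<^bsub>M\<^esub> x"
      using x yM assms(1) by (simp add: a_minus_def smult_r_distr smult_r_minus)
    ultimately show ?thesis
      using coset_eq_iff x yM assms(1) by simp
  qed
  then have "(\<Union>y\<in>N +>\<^bsub>M\<^esub> x. N +>\<^bsub>M\<^esub> (k \<odot>\<^bsub>M\<^esub> y)) = (\<Union>y\<in>N +>\<^bsub>M\<^esub> x. N +>\<^bsub>M\<^esub> (k \<odot>\<^bsub>M\<^esub> x))"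
    by (intro SUP_cong) auto
  also have "\<dots> = N +>\<^bsub>M\<^esub> (k \<odot>\<^bsub>M\<^esub> x)"
    using coset_self[OF assms(2)] by (intro UN_constant_eq) auto
  finally show ?thesis
    by (simp only: subquotient_sel)
qed

lemma zero_in_num: "\<zero>\<^bsub>M\<^esub> \<in> S"
  using den_le N.zero_closed by auto

lemma coset_zero: "N +>\<^bsub>M\<^esub> \<zero>\<^bsub>M\<^esub> = \<zero>\<^bsub>Q\<^esub>"
  using coset_den[OF N.zero_closed] by (simp add: subquotient_sel)

lemma subquotient_is_module: "module R Q"
proof (rule moduleI)
  note numE = submoduleE[OF num]
  show "abelian_group Q"
  proof (rule abelian_groupI)
    fix A B assume "A \<in> carrier Q" "B \<in> carrier Q"
    then obtain x y where xy: "x \<in> S" "A = N +>\<^bsub>M\<^esub> x" "y \<in> S" "B = N +>\<^bsub>M\<^esub> y"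
      by (auto simp: subquotient_sel(1))
    show "A \<oplus>\<^bsub>Q\<^esub> B \<in> carrier Q"
      using xy coset_add[symmetric] coset_closed numE(5) by simp
    show "A \<oplus>\<^bsub>Q\<^esub> B = B \<oplus>\<^bsub>Q\<^esub> A"
      using xy coset_add[symmetric] num_closed by (simp add: M.a_comm)
    fix C assume "C \<in> carrier Q"
    then obtain z where z: "z \<in> S" "C = N +>\<^bsub>M\<^esub> z"
      by (auto simp: subquotient_sel(1))
    show "A \<oplus>\<^bsub>Q\<^esub> B \<oplus>\<^bsub>Q\<^esub> C = A \<oplus>\<^bsub>Q\<^esub> (B \<oplus>\<^bsub>Q\<^esub> C)"
      using xy z coset_add[symmetric] numE(5) num_closed by (simp add: M.a_assoc)
  next
    show "\<zero>\<^bsub>Q\<^esub> \<in> carrier Q"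
      using coset_closed[OF zero_in_num] coset_zero by simp
  next
    fix A assume "A \<in> carrier Q"
    then obtain x where x: "x \<in> S" "A = N +>\<^bsub>M\<^esub> x"
      by (auto simp: subquotient_sel(1))
    show "\<zero>\<^bsub>Q\<^esub> \<oplus>\<^bsub>Q\<^esub> A = A"
      using x coset_add[OF zero_in_num x(1)] coset_zero num_closed by simp
    have "(N +>\<^bsub>M\<^esub> (\<ominus>\<^bsub>M\<^esub> x)) \<oplus>\<^bsub>Q\<^esub> A = \<zero>\<^bsub>Q\<^esub>"
      using x coset_add[OF numE(3)[OF x(1)] x(1)] coset_zero num_closed by (simp add: M.l_neg)
    then show "\<exists>B\<in>carrier Q. B \<oplus>\<^bsub>Q\<^esub> A = \<zero>\<^bsub>Q\<^esub>"
      using coset_closed[OF numE(3)[OF x(1)]] by blast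
  qed
  show "cring R"
    by (rule R.cring_axioms)
  show "\<one> \<odot>\<^bsub>Q\<^esub> A = A" if "A \<in> carrier Q" for A
    using coset_cases[OF that] coset_smult[OF R.one_closed] num_closed smult_one by metis
  fix a A assume a: "a \<in> carrier R" and "A \<in> carrier Q"
  then obtain x where x: "x \<in> S" "A = N +>\<^bsub>M\<^esub> x"
    by (auto simp: subquotient_sel(1))
  show "a \<odot>\<^bsub>Q\<^esub> A \<in> carrier Q"
    using a x coset_smult[symmetric] coset_closed numE(4) by simp
  fix b assume b: "b \<in> carrier R"
  show "(a \<oplus> b) \<odot>\<^bsub>Q\<^esub> A = a \<odot>\<^bsub>Q\<^esub> A \<oplus>\<^bsub>Q\<^esub> b \<odot>\<^bsub>Q\<^esub> A"
    using a b x coset_smult[symmetric] coset_add[symmetric] numE(4) num_closed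
    by (simp add: smult_l_distr)
  show "a \<otimes> b \<odot>\<^bsub>Q\<^esub> A = a \<odot>\<^bsub>Q\<^esub> (b \<odot>\<^bsub>Q\<^esub> A)"
    using a b x coset_smult[symmetric] numE(4) num_closed
    by (simp add: smult_assoc1)
next
  note numE = submoduleE[OF num]
  fix a A B assume a: "a \<in> carrier R" and "A \<in> carrier Q" "B \<in> carrier Q"
  then obtain x y where xy: "x \<in> S" "A = N +>\<^bsub>M\<^esub> x" "y \<in> S" "B = N +>\<^bsub>M\<^esub> y"
    by (auto simp: subquotient_sel(1))
  show "a \<odot>\<^bsub>Q\<^esub> (A \<oplus>\<^bsub>Q\<^esub> B) = a \<odot>\<^bsub>Q\<^esub> A \<oplus>\<^bsub>Q\<^esub> a \<odot>\<^bsub>Q\<^esub> B"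
    using a xy coset_smult[symmetric] coset_add[symmetric] numE(4,5) num_closed
    by (simp add: smult_r_distr)
qed

end

context module
begin

lemma submodule_span_is_submodule:
  assumes "S \<subseteq> carrier M"
  shows "submodule (submodule_span R M S) R M"
proof (rule submoduleI)
  show "submodule_span R M S \<subseteq> carrier M"
    using carrier_is_submodule assms by (auto simp: submodule_span_def)
  show "\<zero>\<^bsub>M\<^esub> \<in> submodule_span R M S"
    by (auto simp: submodule_span_def submodule_def dest: subgroup.one_closed)
qed (auto simp: submodule_span_def submoduleE)

lemma submodule_span_mem: "x \<in> S \<Longrightarrow> x \<in> submodule_span R M S"
  by (auto simp: submodule_span_def)

lemma submodule_span_least: "submodule N R M \<Longrightarrow> S \<subseteq> N \<Longrightarrow> submodule_span R M S \<subseteq> N"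
  by (auto simp: submodule_span_def)

lemma submodule_finsum_closed:
  assumes "submodule N R M" "finite I" "q \<in> I \<rightarrow> N"
  shows "(\<Oplus>\<^bsub>M\<^esub>i\<in>I. q i) \<in> N"
  using assms(2,3)
proof (induction I)
  case empty
  then show ?case
    using submoduleE(2,3,5)[OF assms(1)] subgroup.one_closed[OF submodule.axioms(1)[OF assms(1)]]
    by (simp add: M.finsum_empty)
next
  case (insert i I)
  have "q \<in> I \<rightarrow> carrier M" "q i \<in> carrier M"
    using insert.prems submoduleE(1)[OF assms(1)] by auto
  then show ?case
    using insert submoduleE(5)[OF assms(1)] by (simp add: M.finsum_insert)
qed

lemma kernel_submodule:
  assumes "f \<in> left_hom R M N" "left_module R N"
  shows "submodule {x \<in> carrier M. f x = \<zero>\<^bsub>N\<^esub>} R M"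
proof (rule submoduleI)
  interpret N: left_module R N by fact
  interpret h: abelian_group_hom M N f
    using left_hom_group_hom[OF assms(1) M.abelian_group_axioms N.M.abelian_group_axioms] .
  show "\<zero>\<^bsub>M\<^esub> \<in> {x \<in> carrier M. f x = \<zero>\<^bsub>N\<^esub>}"
    by simp
  show "\<ominus>\<^bsub>M\<^esub> a \<in> {x \<in> carrier M. f x = \<zero>\<^bsub>N\<^esub>}" if "a \<in> {x \<in> carrier M. f x = \<zero>\<^bsub>N\<^esub>}" for a
    using that by simp
  show "a \<oplus>\<^bsub>M\<^esub> b \<in> {x \<in> carrier M. f x = \<zero>\<^bsub>N\<^esub>}"
    if "a \<in> {x \<in> carrier M. f x = \<zero>\<^bsub>N\<^esub>}" "b \<in> {x \<in> carrier M. f x = \<zero>\<^bsub>N\<^esub>}" for a b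
    using that by simp
  have z: "r \<odot>\<^bsub>N\<^esub> \<zero>\<^bsub>N\<^esub> = \<zero>\<^bsub>N\<^esub>" if "r \<in> carrier R" for r
    using abelian_group_hom.hom_zero[OF smult_group_hom[OF assms(2) that]] .
  show "r \<odot>\<^bsub>M\<^esub> x \<in> {x \<in> carrier M. f x = \<zero>\<^bsub>N\<^esub>}"
    if "r \<in> carrier R" "x \<in> {x \<in> carrier M. f x = \<zero>\<^bsub>N\<^esub>}" for r x
    using that z left_hom_smult[OF assms(1)] by simp
qed auto

end


section \<open>Tensor products\<close>

locale tensor_pair = V: module K V + W: module K W for K V W
begin

abbreviation pairs where "pairs \<equiv> carrier V \<times> carrier W"
abbreviation F where "F \<equiv> free_module K pairs"
abbreviation e where "e v w \<equiv> free_basis K pairs (v, w)"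
abbreviation T where "T \<equiv> tensor_relations K V W"
abbreviation VW where "VW \<equiv> tensor_module K V W"
abbreviation pure where "pure \<equiv> pure_tensor K V W"

definition relators where
  "relators =
     {e (v \<oplus>\<^bsub>V\<^esub> v') w \<ominus>\<^bsub>F\<^esub> (e v w \<oplus>\<^bsub>F\<^esub> e v' w) | v v' w.
          v \<in> carrier V \<and> v' \<in> carrier V \<and> w \<in> carrier W} \<union>
       {e v (w \<oplus>\<^bsub>W\<^esub> w') \<ominus>\<^bsub>F\<^esub> (e v w \<oplus>\<^bsub>F\<^esub> e v w') | v w w'.
          v \<in> carrier V \<and> w \<in> carrier W \<and> w' \<in> carrier W} \<union>
       {e (k \<odot>\<^bsub>V\<^esub> v) w \<ominus>\<^bsub>F\<^esub> k \<odot>\<^bsub>F\<^esub> e v w | k v w.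
          k \<in> carrier K \<and> v \<in> carrier V \<and> w \<in> carrier W} \<union>
       {e v (k \<odot>\<^bsub>W\<^esub> w) \<ominus>\<^bsub>F\<^esub> k \<odot>\<^bsub>F\<^esub> e v w | k v w.
          k \<in> carrier K \<and> v \<in> carrier V \<and> w \<in> carrier W}"

lemma T_eq: "T = submodule_span K F relators"
  by (simp add: tensor_relations_def relators_def Let_def)

lemma ring_K: "ring K"
  by (rule V.R.ring_axioms)

sublocale F: module K F
  using left_module_imp_module[OF V.R.cring_axioms free_module_left_module[OF ring_K]] .

lemma e_closed: "v \<in> carrier V \<Longrightarrow> w \<in> carrier W \<Longrightarrow> e v w \<in> carrier F"
  by (rule free_basis_closed[OF ring_K]) simp

lemma relators_closed: "relators \<subseteq> carrier F"
  by (auto simp: relators_def e_closed)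

sublocale Q: subquotient K F "carrier F" T
  rewrites "subquotient_module F (carrier F) T = VW"
proof -
  have T: "submodule T K F"
    unfolding T_eq by (rule F.submodule_span_is_submodule[OF relators_closed])
  then show "subquotient K F (carrier F) T"
    unfolding subquotient_def subquotient_axioms_def
    using F.module_axioms F.carrier_is_submodule F.submoduleE(1)[OF T] by blast
  show "subquotient_module F (carrier F) T = VW"
    by (simp add: tensor_module_def Let_def)
qed

sublocale VW: module K VW
  by (rule Q.subquotient_is_module)

lemma pure_eq: "pure v w = T +>\<^bsub>F\<^esub> e v w"
  by (simp add: pure_tensor_def Let_def)

lemma projection_hom: "(\<lambda>f. T +>\<^bsub>F\<^esub> f) \<in> left_hom K F VW"
  by (intro left_homI Q.coset_closed Q.coset_add Q.coset_smult)

lemma pure_closed: "v \<in> carrier V \<Longrightarrow> w \<in> carrier W \<Longrightarrow> pure v w \<in> carrier VW"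
  unfolding pure_eq by (intro Q.coset_closed e_closed)

lemma relators_in_T: "x \<in> relators \<Longrightarrow> x \<in> T"
  unfolding T_eq by (rule F.submodule_span_mem)

lemma pure_add_left:
  assumes "v \<in> carrier V" "v' \<in> carrier V" "w \<in> carrier W"
  shows "pure (v \<oplus>\<^bsub>V\<^esub> v') w = pure v w \<oplus>\<^bsub>VW\<^esub> pure v' w"
proof -
  have "e (v \<oplus>\<^bsub>V\<^esub> v') w \<ominus>\<^bsub>F\<^esub> (e v w \<oplus>\<^bsub>F\<^esub> e v' w) \<in> T"
    using assms by (intro relators_in_T) (auto simp: relators_def)
  then show ?thesis
    using assms e_closed unfolding pure_eq by (simp add: Q.coset_eq_iff Q.coset_add[symmetric])
qed

lemma pure_add_right:
  assumes "v \<in> carrier V" "w \<in> carrier W" "w' \<in> carrier W"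
  shows "pure v (w \<oplus>\<^bsub>W\<^esub> w') = pure v w \<oplus>\<^bsub>VW\<^esub> pure v w'"
proof -
  have "e v (w \<oplus>\<^bsub>W\<^esub> w') \<ominus>\<^bsub>F\<^esub> (e v w \<oplus>\<^bsub>F\<^esub> e v w') \<in> T"
    using assms by (intro relators_in_T) (auto simp: relators_def)
  then show ?thesis
    using assms e_closed unfolding pure_eq by (simp add: Q.coset_eq_iff Q.coset_add[symmetric])
qed

lemma pure_smult_left:
  assumes "k \<in> carrier K" "v \<in> carrier V" "w \<in> carrier W"
  shows "pure (k \<odot>\<^bsub>V\<^esub> v) w = k \<odot>\<^bsub>VW\<^esub> pure v w"
proof -
  have "e (k \<odot>\<^bsub>V\<^esub> v) w \<ominus>\<^bsub>F\<^esub> k \<odot>\<^bsub>F\<^esub> e v w \<in> T"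
    using assms by (intro relators_in_T) (auto simp: relators_def)
  then show ?thesis
    using assms e_closed unfolding pure_eq by (simp add: Q.coset_eq_iff Q.coset_smult[symmetric])
qed

lemma pure_smult_right:
  assumes "k \<in> carrier K" "v \<in> carrier V" "w \<in> carrier W"
  shows "pure v (k \<odot>\<^bsub>W\<^esub> w) = k \<odot>\<^bsub>VW\<^esub> pure v w"
proof -
  have "e v (k \<odot>\<^bsub>W\<^esub> w) \<ominus>\<^bsub>F\<^esub> k \<odot>\<^bsub>F\<^esub> e v w \<in> T"
    using assms by (intro relators_in_T) (auto simp: relators_def)
  then show ?thesis
    using assms e_closed unfolding pure_eq by (simp add: Q.coset_eq_iff Q.coset_smult[symmetric])
qed

lemma pure_hom_left: "w \<in> carrier W \<Longrightarrow> (\<lambda>v. pure v w) \<in> left_hom K V VW"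
  by (intro left_homI) (simp_all add: pure_closed pure_add_left pure_smult_left)

lemma pure_hom_right: "v \<in> carrier V \<Longrightarrow> pure v \<in> left_hom K W VW"
  by (intro left_homI) (simp_all add: pure_closed pure_add_right pure_smult_right)

text \<open>
  The pure tensors generate: a class is the combination of pure tensors that any of its
  representatives spells out.
\<close>

lemma tensor_in_submodule:
  assumes "submodule Z K VW" "t \<in> carrier VW"
    and "\<And>v w. v \<in> carrier V \<Longrightarrow> w \<in> carrier W \<Longrightarrow> pure v w \<in> Z"
  shows "t \<in> Z"
proof -
  obtain f where f: "f \<in> carrier F" "t = T +>\<^bsub>F\<^esub> f"
    using assms(2) by (rule Q.coset_cases)
  have "t = linear_extension K pairs VW (\<lambda>p. T +>\<^bsub>F\<^esub> free_basis K pairs p) f"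
    unfolding f(2)
    by (rule hom_eq_linear_extension[OF ring_K VW.M.abelian_group_axioms projection_hom f(1)])
  moreover have "linear_extension K pairs VW (\<lambda>p. T +>\<^bsub>F\<^esub> free_basis K pairs p) f \<in> Z"
    unfolding linear_extension_def
  proof (rule VW.submodule_finsum_closed[OF assms(1)])
    show "finite {p \<in> pairs. f p \<noteq> \<zero>\<^bsub>K\<^esub>}"
      using f(1) by (simp add: free_module_sel)
    show "(\<lambda>p. f p \<odot>\<^bsub>VW\<^esub> (T +>\<^bsub>F\<^esub> free_basis K pairs p)) \<in> {p \<in> pairs. f p \<noteq> \<zero>\<^bsub>K\<^esub>} \<rightarrow> Z"
    proof
      fix p assume p: "p \<in> {p \<in> pairs. f p \<noteq> \<zero>\<^bsub>K\<^esub>}"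
      then have "f p \<in> carrier K"
        using f(1) by (auto simp: free_module_sel)
      moreover have "T +>\<^bsub>F\<^esub> free_basis K pairs p \<in> Z"
        using p assms(3)[of "fst p" "snd p"] by (auto simp: pure_eq)
      ultimately show "f p \<odot>\<^bsub>VW\<^esub> (T +>\<^bsub>F\<^esub> free_basis K pairs p) \<in> Z"
        using VW.submoduleE(4)[OF assms(1)] by blast
    qed
  qed
  ultimately show ?thesis
    by simp
qed

text \<open>
  The linear extension of \<open>\<beta>\<close> to the free module on pairs kills the relators, hence the submodule
  they span, and so descends to the quotient. The second conclusion keeps track of the values on all
  representatives, which is what comparing with \<open>tensor_id_map\<close> requires.
\<close>

lemma tensor_universal:
  assumes "left_module K U"
    and closed: "\<And>v w. v \<in> carrier V \<Longrightarrow> w \<in> carrier W \<Longrightarrow> \<beta> v w \<in> carrier U"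
    and left: "\<And>w. w \<in> carrier W \<Longrightarrow> (\<lambda>v. \<beta> v w) \<in> left_hom K V U"
    and right: "\<And>v. v \<in> carrier V \<Longrightarrow> \<beta> v \<in> left_hom K W U"
  obtains h where "h \<in> left_hom K VW U"
    and "\<And>f. f \<in> carrier F \<Longrightarrow> h (T +>\<^bsub>F\<^esub> f) = linear_extension K pairs U (\<lambda>p. \<beta> (fst p) (snd p)) f"
    and "\<And>v w. v \<in> carrier V \<Longrightarrow> w \<in> carrier W \<Longrightarrow> h (pure v w) = \<beta> v w"
proof -
  interpret U: left_module K U by fact
  let ?l = "linear_extension K pairs U (\<lambda>p. \<beta> (fst p) (snd p))"
  have U: "abelian_group U"
    by (rule U.M.abelian_group_axioms)
  have q: "(\<lambda>p. \<beta> (fst p) (snd p)) \<in> pairs \<rightarrow> carrier U"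
    using closed by auto
  have l: "?l \<in> left_hom K F U"
    by (rule linear_extension_hom[OF assms(1) q])
  have le: "?l (e v w) = \<beta> v w" if "v \<in> carrier V" "w \<in> carrier W" for v w
    using linear_extension_basis[OF assms(1) q, of "(v, w)"] that by simp
  note minus = left_hom_minus[OF l F.M.abelian_group_axioms U]
  have "relators \<subseteq> {x \<in> carrier F. ?l x = \<zero>\<^bsub>U\<^esub>}"
  proof
    fix x assume x: "x \<in> relators"
    have "?l x = \<zero>\<^bsub>U\<^esub>"
      using x unfolding relators_def
      by (elim UnE CollectE exE conjE)
        (simp_all add: minus e_closed le closed left_hom_add[OF l] left_hom_smult[OF l]
          left_hom_add[OF left] left_hom_add[OF right] left_hom_smult[OF left] left_hom_smult[OF right]
          U.smult_closed minus_eq_zero_iff[OF U])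
    then show "x \<in> {x \<in> carrier F. ?l x = \<zero>\<^bsub>U\<^esub>}"
      using x relators_closed by auto
  qed
  then have kernel: "T \<subseteq> {x \<in> carrier F. ?l x = \<zero>\<^bsub>U\<^esub>}"
    unfolding T_eq by (intro F.submodule_span_least F.kernel_submodule[OF l assms(1)])
  define h where "h A = ?l (SOME f. f \<in> A)" for A
  have h: "h (T +>\<^bsub>F\<^esub> f) = ?l f" if f: "f \<in> carrier F" for f
  proof -
    let ?f = "SOME f'. f' \<in> T +>\<^bsub>F\<^esub> f"
    have mem: "?f \<in> T +>\<^bsub>F\<^esub> f"
      using Q.coset_self[OF f] by (rule someI[where P = "\<lambda>f'. f' \<in> T +>\<^bsub>F\<^esub> f"])
    then have f': "?f \<in> carrier F"
      using Q.coset_memD(1)[OF Q.coset_closed[OF f]] by simp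
    have "?f \<ominus>\<^bsub>F\<^esub> f \<in> T"
      using Q.mem_coset_iff[OF f f'] mem by simp
    then have "?l ?f \<ominus>\<^bsub>U\<^esub> ?l f = \<zero>\<^bsub>U\<^esub>"
      using kernel minus[OF f' f] by auto
    then show ?thesis
      unfolding h_def using left_hom_closed[OF l] f f' by (simp add: minus_eq_zero_iff[OF U])
  qed
  have "h \<in> left_hom K VW U"
  proof (rule left_homI)
    fix t assume "t \<in> carrier VW"
    then obtain f where f: "f \<in> carrier F" "t = T +>\<^bsub>F\<^esub> f"
      by (rule Q.coset_cases)
    show "h t \<in> carrier U"
      using f h left_hom_closed[OF l] by simp
    show "h (k \<odot>\<^bsub>VW\<^esub> t) = k \<odot>\<^bsub>U\<^esub> h t" if "k \<in> carrier K" for k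
      using that f h left_hom_smult[OF l] by (simp add: Q.coset_smult[symmetric])
    fix t' assume "t' \<in> carrier VW"
    then obtain f' where f': "f' \<in> carrier F" "t' = T +>\<^bsub>F\<^esub> f'"
      by (rule Q.coset_cases)
    show "h (t \<oplus>\<^bsub>VW\<^esub> t') = h t \<oplus>\<^bsub>U\<^esub> h t'"
      using f f' h left_hom_add[OF l] by (simp add: Q.coset_add[symmetric])
  qed
  then show thesis
    using that h le e_closed by (simp add: pure_eq)
qed

text \<open>
  On the class of \<open>f\<close>, the defining union of \<open>tensor_id_map\<close> runs over the classes of the linear
  extension of \<open>(v, w) \<mapsto> (v, \<phi> w)\<close> at the representatives. By the universal property for
  \<open>v \<otimes> \<phi> w\<close> all of these classes agree.
\<close>

lemma tensor_id_map_hom: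
  assumes "\<phi> \<in> left_hom K W W"
  shows "tensor_id_map K V W \<phi> \<in> left_hom K VW VW"
    and "\<And>v w. v \<in> carrier V \<Longrightarrow> w \<in> carrier W \<Longrightarrow> tensor_id_map K V W \<phi> (pure v w) = pure v (\<phi> w)"
proof -
  let ?\<beta> = "\<lambda>v w. pure v (\<phi> w)" and ?q = "\<lambda>p. e (fst p) (\<phi> (snd p))"
  have \<phi>: "\<phi> w \<in> carrier W" if "w \<in> carrier W" for w
    using left_hom_closed[OF assms that] .
  have VW: "left_module K VW"
    by (rule module_imp_left_module[OF VW.module_axioms])
  obtain h where h: "h \<in> left_hom K VW VW"
    and hf: "\<And>f. f \<in> carrier F \<Longrightarrow> h (T +>\<^bsub>F\<^esub> f) = linear_extension K pairs VW (\<lambda>p. ?\<beta> (fst p) (snd p)) f"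
    and hp: "\<And>v w. v \<in> carrier V \<Longrightarrow> w \<in> carrier W \<Longrightarrow> h (pure v w) = ?\<beta> v w"
  proof (rule tensor_universal[OF VW, of ?\<beta>])
    show "(\<lambda>v. ?\<beta> v w) \<in> left_hom K V VW" if "w \<in> carrier W" for w
      using pure_hom_left \<phi> that by simp
    show "?\<beta> v \<in> left_hom K W VW" if "v \<in> carrier V" for v
      using left_hom_compose[OF assms pure_hom_right[OF that]] .
  qed (use pure_closed \<phi> in auto)
  have F: "left_module K F"
    by (rule module_imp_left_module[OF F.module_axioms])
  have q: "?q \<in> pairs \<rightarrow> carrier F"
    using e_closed \<phi> by auto
  have "T +>\<^bsub>F\<^esub> linear_extension K pairs F ?q f = h (T +>\<^bsub>F\<^esub> f)" if "f \<in> carrier F" for f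
    using ring_K VW.M.abelian_group_axioms left_hom_compose[OF linear_extension_hom[OF F q] projection_hom]
      left_hom_compose[OF projection_hom h] _ that
  proof (rule hom_eq_on_basis)
    fix p assume "p \<in> pairs"
    then show "T +>\<^bsub>F\<^esub> linear_extension K pairs F ?q (free_basis K pairs p) = h (T +>\<^bsub>F\<^esub> free_basis K pairs p)"
      using linear_extension_basis[OF F q] hp[of "fst p" "snd p"] by (auto simp: pure_eq)
  qed
  then have eq: "tensor_id_map K V W \<phi> t = h t" if "t \<in> carrier VW" for t
  proof -
    have "T +>\<^bsub>F\<^esub> linear_extension K pairs F ?q f = h t" if "f \<in> t" for f
      using Q.coset_memD[OF \<open>t \<in> carrier VW\<close> that]
        \<open>\<And>f. f \<in> carrier F \<Longrightarrow> T +>\<^bsub>F\<^esub> linear_extension K pairs F ?q f = h (T +>\<^bsub>F\<^esub> f)\<close> by simp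
    moreover have "t \<noteq> {}"
      using Q.coset_cases[OF \<open>t \<in> carrier VW\<close>] Q.coset_self by (metis empty_iff)
    ultimately have "(\<Union>f\<in>t. T +>\<^bsub>F\<^esub> linear_extension K pairs F ?q f) = h t"
      by auto
    then show ?thesis
      by (simp add: tensor_id_map_def Let_def linear_extension_def)
  qed
  show "tensor_id_map K V W \<phi> \<in> left_hom K VW VW"
    using h eq by (auto simp: left_hom_def)
  show "tensor_id_map K V W \<phi> (pure v w) = pure v (\<phi> w)" if "v \<in> carrier V" "w \<in> carrier W" for v w
    using hp[OF that] eq[OF pure_closed[OF that]] by simp
qed

end

text \<open>
  Here \<open>V\<close> has the finite basis \<open>b\<close>. Spanning is expressed by the coordinate functions \<open>c\<close> being
  jointly injective, which is what one can see directly for cocycles; the expansion in the basis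
  follows. The outcome is that \<open>combine\<close> identifies \<open>W\<^sup>B\<close> with \<open>V \<otimes> W\<close>.
\<close>

locale tensor_basis = tensor_pair K V W for K V W +
  fixes B :: "'i set" and b c
  assumes finite_B: "finite B" and b_closed: "i \<in> B \<Longrightarrow> b i \<in> carrier V"
    and c_closed: "i \<in> B \<Longrightarrow> v \<in> carrier V \<Longrightarrow> c i v \<in> carrier K"
    and c_add: "i \<in> B \<Longrightarrow> v \<in> carrier V \<Longrightarrow> v' \<in> carrier V \<Longrightarrow> c i (v \<oplus>\<^bsub>V\<^esub> v') = c i v \<oplus>\<^bsub>K\<^esub> c i v'"
    and c_smult: "i \<in> B \<Longrightarrow> k \<in> carrier K \<Longrightarrow> v \<in> carrier V \<Longrightarrow> c i (k \<odot>\<^bsub>V\<^esub> v) = k \<otimes>\<^bsub>K\<^esub> c i v"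
    and c_b: "i \<in> B \<Longrightarrow> j \<in> B \<Longrightarrow> c i (b j) = indic K (i = j)"
    and c_inj: "v \<in> carrier V \<Longrightarrow> v' \<in> carrier V \<Longrightarrow> (\<And>i. i \<in> B \<Longrightarrow> c i v = c i v') \<Longrightarrow> v = v'"
begin

definition combine where "combine w = (\<Oplus>\<^bsub>VW\<^esub>i\<in>B. pure (b i) (w i))"

text \<open>
  Both sides have the same coordinates.
\<close>

lemma basis_expand:
  assumes v: "v \<in> carrier V"
  shows "v = (\<Oplus>\<^bsub>V\<^esub>i\<in>B. c i v \<odot>\<^bsub>V\<^esub> b i)"
proof (rule c_inj[OF v])
  have cl: "(\<lambda>i. c i v \<odot>\<^bsub>V\<^esub> b i) \<in> A \<rightarrow> carrier V" if "A \<subseteq> B" for A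
    using that v c_closed b_closed by auto
  show "(\<Oplus>\<^bsub>V\<^esub>i\<in>B. c i v \<odot>\<^bsub>V\<^esub> b i) \<in> carrier V"
    using cl by (intro V.M.finsum_closed) auto
  fix j assume j: "j \<in> B"
  have cz: "c j \<zero>\<^bsub>V\<^esub> = \<zero>\<^bsub>K\<^esub>"
    using c_smult[OF j V.R.zero_closed V.M.zero_closed] c_closed[OF j V.M.zero_closed] by simp
  have "c j (\<Oplus>\<^bsub>V\<^esub>i\<in>A. c i v \<odot>\<^bsub>V\<^esub> b i) = (if j \<in> A then c j v else \<zero>\<^bsub>K\<^esub>)"
    if "finite A" "A \<subseteq> B" for A
    using that
  proof (induction A)
    case empty
    then show ?case
      by (simp add: V.M.finsum_empty cz)
  next
    case (insert i A)
    have i: "i \<in> B" and A: "A \<subseteq> B"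
      using insert.prems by auto
    have "c j (\<Oplus>\<^bsub>V\<^esub>i\<in>insert i A. c i v \<odot>\<^bsub>V\<^esub> b i) = c j (c i v \<odot>\<^bsub>V\<^esub> b i) \<oplus>\<^bsub>K\<^esub> (if j \<in> A then c j v else \<zero>\<^bsub>K\<^esub>)"
      using insert.hyps insert.IH[OF A] cl[OF A] i j v
      by (simp add: V.M.finsum_insert b_closed c_closed c_add V.M.finsum_closed)
    also have "c j (c i v \<odot>\<^bsub>V\<^esub> b i) = (if j = i then c j v else \<zero>\<^bsub>K\<^esub>)"
      using i j v by (simp add: b_closed c_closed c_smult c_b indic_def)
    finally show ?case
      using insert.hyps j v by (auto simp: c_closed)
  qed
  from this[OF finite_B] show "c j v = c j (\<Oplus>\<^bsub>V\<^esub>i\<in>B. c i v \<odot>\<^bsub>V\<^esub> b i)"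
    using j by simp
qed

lemma pure_b_closed: "w \<in> B \<rightarrow> carrier W \<Longrightarrow> (\<lambda>i. pure (b i) (w i)) \<in> B \<rightarrow> carrier VW"
  using b_closed pure_closed by auto

lemma combine_closed: "w \<in> B \<rightarrow> carrier W \<Longrightarrow> combine w \<in> carrier VW"
  unfolding combine_def by (intro VW.M.finsum_closed pure_b_closed)

lemma combine_cong: "(\<And>i. i \<in> B \<Longrightarrow> w i = w' i) \<Longrightarrow> w' \<in> B \<rightarrow> carrier W \<Longrightarrow> combine w = combine w'"
  unfolding combine_def by (intro VW.M.add.finprod_cong' pure_b_closed) auto

lemma combine_add:
  assumes "w \<in> B \<rightarrow> carrier W" "w' \<in> B \<rightarrow> carrier W"
  shows "combine (\<lambda>i. w i \<oplus>\<^bsub>W\<^esub> w' i) = combine w \<oplus>\<^bsub>VW\<^esub> combine w'"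
proof -
  have "combine (\<lambda>i. w i \<oplus>\<^bsub>W\<^esub> w' i) = (\<Oplus>\<^bsub>VW\<^esub>i\<in>B. pure (b i) (w i) \<oplus>\<^bsub>VW\<^esub> pure (b i) (w' i))"
    unfolding combine_def using assms
    by (intro VW.M.add.finprod_cong') (auto simp: pure_add_right b_closed Pi_iff intro!: VW.M.a_closed pure_closed)
  also have "\<dots> = combine w \<oplus>\<^bsub>VW\<^esub> combine w'"
    unfolding combine_def by (intro VW.M.finsum_addf pure_b_closed assms)
  finally show ?thesis .
qed

lemma combine_smult:
  assumes "k \<in> carrier K" "w \<in> B \<rightarrow> carrier W"
  shows "combine (\<lambda>i. k \<odot>\<^bsub>W\<^esub> w i) = k \<odot>\<^bsub>VW\<^esub> combine w"
proof -
  have "combine (\<lambda>i. k \<odot>\<^bsub>W\<^esub> w i) = (\<Oplus>\<^bsub>VW\<^esub>i\<in>B. k \<odot>\<^bsub>VW\<^esub> pure (b i) (w i))"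
    unfolding combine_def using assms
    by (intro VW.M.add.finprod_cong') (auto simp: pure_smult_right b_closed Pi_iff intro!: VW.smult_closed pure_closed)
  also have "\<dots> = k \<odot>\<^bsub>VW\<^esub> combine w"
    unfolding combine_def by (intro VW.finsum_smult_ldistr[symmetric] finite_B assms(1) pure_b_closed assms(2))
  finally show ?thesis .
qed

lemma pure_eq_combine:
  assumes "v \<in> carrier V" "w \<in> carrier W"
  shows "pure v w = combine (\<lambda>i. c i v \<odot>\<^bsub>W\<^esub> w)"
proof -
  have cl: "(\<lambda>i. c i v \<odot>\<^bsub>V\<^esub> b i) \<in> B \<rightarrow> carrier V"
    using assms c_closed b_closed by auto
  have "pure v w = pure (\<Oplus>\<^bsub>V\<^esub>i\<in>B. c i v \<odot>\<^bsub>V\<^esub> b i) w"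
    using basis_expand[OF assms(1)] by simp
  also have "\<dots> = (\<Oplus>\<^bsub>VW\<^esub>i\<in>B. pure (c i v \<odot>\<^bsub>V\<^esub> b i) w)"
    by (rule left_hom_finsum[OF pure_hom_left[OF assms(2)] V.M.abelian_group_axioms VW.M.abelian_group_axioms
          finite_B cl])
  also have "\<dots> = combine (\<lambda>i. c i v \<odot>\<^bsub>W\<^esub> w)"
    unfolding combine_def using assms c_closed b_closed
    by (intro VW.M.add.finprod_cong') (auto simp: pure_smult_left pure_smult_right intro!: pure_closed VW.smult_closed)
  finally show ?thesis .
qed

lemma combine_image_submodule:
  assumes "submodule Z K W"
  shows "submodule (combine ` (B \<rightarrow> Z)) K VW"
proof (rule VW.submoduleI)
  note Z = W.submoduleE[OF assms]
  have sub: "w \<in> B \<rightarrow> carrier W" if "w \<in> B \<rightarrow> Z" for w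
    using that Z(1) by auto
  show "combine ` (B \<rightarrow> Z) \<subseteq> carrier VW"
    using combine_closed sub by auto
  have smult: "k \<odot>\<^bsub>VW\<^esub> t \<in> combine ` (B \<rightarrow> Z)" if "k \<in> carrier K" "t \<in> combine ` (B \<rightarrow> Z)" for k t
  proof -
    obtain w where w: "w \<in> B \<rightarrow> Z" "t = combine w"
      using \<open>t \<in> _\<close> by blast
    then have "(\<lambda>i. k \<odot>\<^bsub>W\<^esub> w i) \<in> B \<rightarrow> Z"
      using that(1) Z(4) by auto
    then show ?thesis
      unfolding w(2) combine_smult[OF that(1) sub[OF w(1)], symmetric] by (rule imageI)
  qed
  obtain z where z: "z \<in> Z"
    using Z(2) by auto
  have "combine (\<lambda>_. z) \<in> combine ` (B \<rightarrow> Z)"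
    using z by auto
  from smult[OF V.R.zero_closed this] show "\<zero>\<^bsub>VW\<^esub> \<in> combine ` (B \<rightarrow> Z)"
    using combine_closed z Z(1) by (auto simp: Pi_iff subset_iff)
  show "\<ominus>\<^bsub>VW\<^esub> t \<in> combine ` (B \<rightarrow> Z)" if t: "t \<in> combine ` (B \<rightarrow> Z)" for t
  proof -
    have "t \<in> carrier VW"
      using t combine_closed sub by auto
    then have "\<ominus>\<^bsub>VW\<^esub> t = (\<ominus>\<^bsub>K\<^esub> \<one>\<^bsub>K\<^esub>) \<odot>\<^bsub>VW\<^esub> t"
      by (simp add: VW.smult_l_minus)
    then show ?thesis
      using smult[OF _ t] by simp
  qed
  show "t \<oplus>\<^bsub>VW\<^esub> t' \<in> combine ` (B \<rightarrow> Z)" if t: "t \<in> combine ` (B \<rightarrow> Z)" "t' \<in> combine ` (B \<rightarrow> Z)" for t t'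
  proof -
    obtain w w' where w: "w \<in> B \<rightarrow> Z" "t = combine w" "w' \<in> B \<rightarrow> Z" "t' = combine w'"
      using t by blast
    then have "(\<lambda>i. w i \<oplus>\<^bsub>W\<^esub> w' i) \<in> B \<rightarrow> Z"
      using Z(5) by auto
    then show ?thesis
      unfolding w(2,4) combine_add[OF sub[OF w(1)] sub[OF w(3)], symmetric] by (rule imageI)
  qed
  show "k \<odot>\<^bsub>VW\<^esub> t \<in> combine ` (B \<rightarrow> Z)" if "k \<in> carrier K" "t \<in> combine ` (B \<rightarrow> Z)" for k t
    using smult that .
qed

lemma combine_surj:
  assumes "t \<in> carrier VW"
  shows "t \<in> combine ` (B \<rightarrow> carrier W)"
proof (rule tensor_in_submodule[OF combine_image_submodule[OF W.carrier_is_submodule] assms])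
  fix v w assume "v \<in> carrier V" "w \<in> carrier W"
  moreover from this have "(\<lambda>i. c i v \<odot>\<^bsub>W\<^esub> w) \<in> B \<rightarrow> carrier W"
    using c_closed by auto
  ultimately show "pure v w \<in> combine ` (B \<rightarrow> carrier W)"
    unfolding pure_eq_combine[OF \<open>v \<in> carrier V\<close> \<open>w \<in> carrier W\<close>] by (rule_tac imageI)
qed

text \<open>
  The bilinear map \<open>(v, w) \<mapsto> c\<^sub>j(v) w\<close> induces a map on the tensor product that recovers the
  \<open>j\<close>-th entry.
\<close>

lemma combine_inj:
  assumes "w \<in> B \<rightarrow> carrier W" "w' \<in> B \<rightarrow> carrier W" "combine w = combine w'" "j \<in> B"
  shows "w j = w' j"
proof -
  have W: "left_module K W"
    by (rule module_imp_left_module[OF W.module_axioms])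
  let ?\<beta> = "\<lambda>v w. c j v \<odot>\<^bsub>W\<^esub> w"
  have left: "(\<lambda>v. ?\<beta> v w) \<in> left_hom K V W" if "w \<in> carrier W" for w
    using that assms(4) by (intro left_homI) (auto simp: c_closed c_add c_smult W.smult_l_distr W.smult_assoc1)
  have right: "?\<beta> v \<in> left_hom K W W" if "v \<in> carrier V" for v
  proof (rule left_homI)
    have cv: "c j v \<in> carrier K"
      using c_closed assms(4) that .
    fix w assume w: "w \<in> carrier W"
    show "?\<beta> v w \<in> carrier W"
      using cv w by simp
    show "?\<beta> v (w \<oplus>\<^bsub>W\<^esub> w') = ?\<beta> v w \<oplus>\<^bsub>W\<^esub> ?\<beta> v w'" if "w' \<in> carrier W" for w'
      using cv w that by (rule W.smult_r_distr)
    show "?\<beta> v (k \<odot>\<^bsub>W\<^esub> w) = k \<odot>\<^bsub>W\<^esub> ?\<beta> v w" if k: "k \<in> carrier K" for k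
      using W.smult_assoc1[OF cv k w] W.smult_assoc1[OF k cv w] V.R.m_comm[OF cv k] by simp
  qed
  have cl: "?\<beta> v w \<in> carrier W" if "v \<in> carrier V" "w \<in> carrier W" for v w
    using c_closed[OF assms(4) that(1)] that(2) by (rule W.smult_closed)
  obtain h where h: "h \<in> left_hom K VW W"
    and hp: "\<And>v w. v \<in> carrier V \<Longrightarrow> w \<in> carrier W \<Longrightarrow> h (pure v w) = ?\<beta> v w"
  proof (rule tensor_universal[OF W cl left right])
    fix h
    assume "h \<in> left_hom K VW W"
      and "\<And>v w. v \<in> carrier V \<Longrightarrow> w \<in> carrier W \<Longrightarrow> h (pure v w) = ?\<beta> v w"
    then show thesis
      by (rule that)
  qed
  have "h (combine u) = u j" if u: "u \<in> B \<rightarrow> carrier W" for u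
  proof -
    have "h (combine u) = (\<Oplus>\<^bsub>W\<^esub>i\<in>B. h (pure (b i) (u i)))"
      unfolding combine_def
      by (rule left_hom_finsum[OF h VW.M.abelian_group_axioms W.M.abelian_group_axioms finite_B pure_b_closed[OF u]])
    also have "\<dots> = (\<Oplus>\<^bsub>W\<^esub>i\<in>B. if j = i then u i else \<zero>\<^bsub>W\<^esub>)"
      using u assms(4) by (intro W.M.add.finprod_cong') (auto simp: hp b_closed c_b indic_def Pi_iff)
    also have "\<dots> = u j"
      using W.M.add.finprod_singleton[OF assms(4) finite_B u] .
    finally show ?thesis .
  qed
  then show ?thesis
    using assms(1-3) by metis
qed

lemma combine_tensor_id_map:
  assumes "\<phi> \<in> left_hom K W W" "w \<in> B \<rightarrow> carrier W"
  shows "tensor_id_map K V W \<phi> (combine w) = combine (\<lambda>i. \<phi> (w i))"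
proof -
  have "tensor_id_map K V W \<phi> (combine w) = (\<Oplus>\<^bsub>VW\<^esub>i\<in>B. tensor_id_map K V W \<phi> (pure (b i) (w i)))"
    unfolding combine_def
    by (rule left_hom_finsum[OF tensor_id_map_hom(1)[OF assms(1)] VW.M.abelian_group_axioms VW.M.abelian_group_axioms
          finite_B pure_b_closed[OF assms(2)]])
  also have "\<dots> = combine (\<lambda>i. \<phi> (w i))"
    unfolding combine_def using assms left_hom_closed[OF assms(1)]
    by (intro VW.M.add.finprod_cong') (auto simp: tensor_id_map_hom(2) b_closed Pi_iff intro!: pure_closed)
  finally show ?thesis .
qed

text \<open>
  For \<open>Z\<close> the homogeneous part of some degree this describes the homogeneous part of the tensor
  product.
\<close>

lemma span_pure_eq_combine_image:
  assumes "submodule Z K W"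
  shows "submodule_span K VW {pure v w | v w. v \<in> carrier V \<and> w \<in> Z} = combine ` (B \<rightarrow> Z)"
proof
  note Z = W.submoduleE[OF assms]
  let ?G = "{pure v w | v w. v \<in> carrier V \<and> w \<in> Z}"
  have "pure v w \<in> combine ` (B \<rightarrow> Z)" if "v \<in> carrier V" "w \<in> Z" for v w
  proof -
    have "(\<lambda>i. c i v \<odot>\<^bsub>W\<^esub> w) \<in> B \<rightarrow> Z"
      using that c_closed Z(4) by auto
    then show ?thesis
      using that Z(1) by (subst pure_eq_combine) auto
  qed
  then show "submodule_span K VW ?G \<subseteq> combine ` (B \<rightarrow> Z)"
    by (intro VW.submodule_span_least combine_image_submodule assms) auto
  have span: "submodule (submodule_span K VW ?G) K VW"
    using Z(1) pure_closed by (intro VW.submodule_span_is_submodule) auto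
  show "combine ` (B \<rightarrow> Z) \<subseteq> submodule_span K VW ?G"
  proof (rule image_subsetI)
    fix w assume "w \<in> B \<rightarrow> Z"
    then have "(\<lambda>i. pure (b i) (w i)) \<in> B \<rightarrow> submodule_span K VW ?G"
      using b_closed by (intro Pi_I VW.submodule_span_mem) auto
    then show "combine w \<in> submodule_span K VW ?G"
      unfolding combine_def by (rule VW.submodule_finsum_closed[OF span finite_B])
  qed
qed

end


section \<open>The comparison theorem\<close>

locale resolved =
  fixes R :: "('d, 'x) ring_scheme" and N :: "('d, 'n, 'y) module_scheme"
    and P :: "('d, 'p, 'n) resolution"
  assumes resolution: "projective_resolution R N P" and target_group: "abelian_group N"
begin

abbreviation "Pm \<equiv> res_mod P"
abbreviation "d \<equiv> res_diff P"
abbreviation "aug \<equiv> res_aug P"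

lemma projective: "projective_module R (Pm n)"
  using resolution by (simp add: projective_resolution_def)

lemma left_module_P: "left_module R (Pm n)"
  using projective by (simp add: projective_module_def)

lemma group_P: "abelian_group (Pm n)"
  by (rule left_module_abelian_group[OF left_module_P])

lemma d_hom: "d n \<in> left_hom R (Pm (Suc n)) (Pm n)"
  using resolution by (simp add: projective_resolution_def)

lemma aug_hom: "aug \<in> left_hom R (Pm 0) N"
  using resolution by (simp add: projective_resolution_def)

lemma aug_image: "aug ` carrier (Pm 0) = carrier N"
  using resolution by (simp add: projective_resolution_def)

lemma exact_0: "d 0 ` carrier (Pm (Suc 0)) = {x \<in> carrier (Pm 0). aug x = \<zero>\<^bsub>N\<^esub>}"
  using resolution by (simp add: projective_resolution_def)

lemma exact_Suc: "d (Suc n) ` carrier (Pm (Suc (Suc n))) = {x \<in> carrier (Pm (Suc n)). d n x = \<zero>\<^bsub>Pm n\<^esub>}"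
  using resolution by (simp add: projective_resolution_def)

lemma d_closed: "x \<in> carrier (Pm (Suc n)) \<Longrightarrow> d n x \<in> carrier (Pm n)"
  by (rule left_hom_closed[OF d_hom])

lemma aug_d: "x \<in> carrier (Pm (Suc 0)) \<Longrightarrow> aug (d 0 x) = \<zero>\<^bsub>N\<^esub>"
  using exact_0 by blast

lemma d_d: "x \<in> carrier (Pm (Suc (Suc n))) \<Longrightarrow> d n (d (Suc n) x) = \<zero>\<^bsub>Pm n\<^esub>"
  using exact_Suc by blast

lemma lift_through_d:
  assumes "\<alpha> \<in> left_hom R (Pm m) (Pm n)" "\<And>x. x \<in> carrier (Pm m) \<Longrightarrow> \<alpha> x \<in> d n ` carrier (Pm (Suc n))"
  obtains \<gamma> where "\<gamma> \<in> left_hom R (Pm m) (Pm (Suc n))" "\<And>x. x \<in> carrier (Pm m) \<Longrightarrow> d n (\<gamma> x) = \<alpha> x"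
  using projective_lift[OF projective left_module_P group_P assms(1) d_hom] assms(2) by (metis image_subsetI)

lemma lift_through_aug:
  assumes "\<alpha> \<in> left_hom R (Pm m) N"
  obtains \<gamma> where "\<gamma> \<in> left_hom R (Pm m) (Pm 0)" "\<And>x. x \<in> carrier (Pm m) \<Longrightarrow> aug (\<gamma> x) = \<alpha> x"
  using projective_lift[OF projective left_module_P target_group assms aug_hom] left_hom_closed[OF assms] aug_image
  by (metis image_subsetI)

text \<open>
  The components are built one after the other: \<open>t (d x)\<close> is a cycle, hence by exactness a boundary,
  and projectivity lifts it through \<open>d\<close>. The induction carries along that \<open>t (d x)\<close> is a boundary; in
  degree \<open>0\<close> this is the cocycle condition.
\<close>

lemma chain_lift_exists:
  assumes \<phi>: "\<phi> \<in> left_hom R (Pm l) N" and cocycle: "\<And>x. x \<in> carrier (Pm (Suc l)) \<Longrightarrow> \<phi> (d l x) = \<zero>\<^bsub>N\<^esub>"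
  shows "\<exists>t. chain_lift R P l \<phi> t"
proof -
  let ?good = "\<lambda>n t. t \<in> left_hom R (Pm (l + n)) (Pm n) \<and>
      (\<forall>x\<in>carrier (Pm (Suc (l + n))). t (d (l + n) x) \<in> d n ` carrier (Pm (Suc n))) \<and>
      (n = 0 \<longrightarrow> (\<forall>x\<in>carrier (Pm l). aug (t x) = \<phi> x))"
  have "\<exists>t. \<forall>n. ?good n (t n) \<and>
    (\<forall>x\<in>carrier (Pm (Suc (l + n))). d n (t (Suc n) x) = t n (d (l + n) x))"
  proof (rule dependent_nat_choice)
    obtain t where t: "t \<in> left_hom R (Pm l) (Pm 0)" "\<And>x. x \<in> carrier (Pm l) \<Longrightarrow> aug (t x) = \<phi> x"
      using lift_through_aug[OF \<phi>] by blast
    have "t (d l x) \<in> d 0 ` carrier (Pm (Suc 0))" if "x \<in> carrier (Pm (Suc l))" for x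
      using that t d_closed left_hom_closed[OF t(1)] cocycle by (auto simp: exact_0)
    then show "\<exists>t. ?good 0 t"
      using t by (intro exI[of _ t]) simp
  next
    fix t n assume t: "?good n t"
    let ?\<alpha> = "\<lambda>x. t (d (l + n) x)"
    have "?\<alpha> \<in> left_hom R (Pm (Suc (l + n))) (Pm n)"
      using t left_hom_compose[OF d_hom] by blast
    then obtain t' where t': "t' \<in> left_hom R (Pm (Suc (l + n))) (Pm (Suc n))"
      "\<And>x. x \<in> carrier (Pm (Suc (l + n))) \<Longrightarrow> d n (t' x) = ?\<alpha> x"
      using lift_through_d[of ?\<alpha>] t by blast
    have "t' (d (Suc (l + n)) x) \<in> d (Suc n) ` carrier (Pm (Suc (Suc n)))"
      if x: "x \<in> carrier (Pm (Suc (Suc (l + n))))" for x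
    proof -
      have "d n (t' (d (Suc (l + n)) x)) = \<zero>\<^bsub>Pm n\<^esub>"
        using t' d_closed[OF x] d_d[OF x] t left_hom_zero[OF _ group_P group_P] by auto
      then show ?thesis
        using left_hom_closed[OF t'(1) d_closed[OF x]] by (simp add: exact_Suc)
    qed
    then show "\<exists>t'. ?good (Suc n) t' \<and> (\<forall>x\<in>carrier (Pm (Suc (l + n))). d n (t' x) = t (d (l + n) x))"
      using t' by (intro exI[of _ t']) simp
  qed
  then show ?thesis
    unfolding chain_lift_def by (metis add_0_right)
qed

lemma restrict_in_hom_module:
  assumes "h \<in> left_hom R (Pm n) M"
  shows "restrict h (carrier (Pm n)) \<in> carrier (hom_module R \<eta> (Pm n) M)"
proof -
  interpret left_module R "Pm n"
    by (rule left_module_P)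
  show ?thesis
    unfolding hom_module_def using smult_closed
    by (auto intro!: left_homI simp: left_hom_add[OF assms] left_hom_smult[OF assms] left_hom_closed[OF assms])
qed

lemma coboundary_SucI:
  assumes "h \<in> left_hom R (Pm n) M"
  shows "(\<lambda>x\<in>carrier (Pm (Suc n)). h (d n x)) \<in> coboundaries R \<eta> P M (Suc n)"
proof -
  have "(\<lambda>x\<in>carrier (Pm (Suc n)). h (d n x))
      = (\<lambda>x\<in>carrier (Pm (Suc n)). restrict h (carrier (Pm n)) (d n x))"
    using d_closed by (auto simp: fun_eq_iff)
  then show ?thesis
    using restrict_in_hom_module[OF assms, of \<eta>] by (auto simp del: restrict_apply)
qed

text \<open>
  The zero map, which is the only coboundary in degree \<open>0\<close>, is linear only if scalars fix zero.
\<close>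

lemma coboundary_hom:
  assumes "abelian_group M" "\<And>r. r \<in> carrier R \<Longrightarrow> r \<odot>\<^bsub>M\<^esub> \<zero>\<^bsub>M\<^esub> = \<zero>\<^bsub>M\<^esub>"
    and "f \<in> coboundaries R \<eta> P M n"
  shows "f \<in> carrier (hom_module R \<eta> (Pm n) M)"
    and "x \<in> carrier (Pm (Suc n)) \<Longrightarrow> f (d n x) = \<zero>\<^bsub>M\<^esub>"
proof -
  interpret M: abelian_group M by fact
  have "f \<in> carrier (hom_module R \<eta> (Pm n) M) \<and> (\<forall>x\<in>carrier (Pm (Suc n)). f (d n x) = \<zero>\<^bsub>M\<^esub>)"
  proof (cases n)
    case 0
    interpret P: left_module R "Pm 0"
      by (rule left_module_P)
    from 0 have f: "f = (\<lambda>x\<in>carrier (Pm 0). \<zero>\<^bsub>M\<^esub>)"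
      using assms(3) by (simp add: hom_module_def)
    show ?thesis
      unfolding f 0 using assms(2) d_closed P.smult_closed
      by (auto simp: hom_module_def intro!: left_homI)
  next
    case (Suc m)
    from Suc obtain h where h: "h \<in> left_hom R (Pm m) M" "f = (\<lambda>x\<in>carrier (Pm (Suc m)). h (d m x))"
      using assms(3) by (auto simp: hom_module_def)
    have hd: "(\<lambda>x. h (d m x)) \<in> left_hom R (Pm (Suc m)) M"
      by (rule left_hom_compose[OF d_hom h(1)])
    have "f \<in> carrier (hom_module R \<eta> (Pm n) M)"
      using restrict_in_hom_module[OF hd] by (simp add: h(2) Suc)
    moreover have "f (d n x) = \<zero>\<^bsub>M\<^esub>" if "x \<in> carrier (Pm (Suc n))" for x
      using that d_closed d_d left_hom_zero[OF h(1) group_P assms(1)] by (simp add: h(2) Suc)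
    ultimately show ?thesis
      by blast
  qed
  then show "f \<in> carrier (hom_module R \<eta> (Pm n) M)"
    and "x \<in> carrier (Pm (Suc n)) \<Longrightarrow> f (d n x) = \<zero>\<^bsub>M\<^esub>"
    by blast+
qed

lemma coboundary_compose:
  assumes "f \<in> coboundaries R \<eta> P M n" "h \<in> left_hom R M M'" "abelian_group M" "abelian_group M'"
  shows "(\<lambda>x\<in>carrier (Pm n). h (f x)) \<in> coboundaries R \<eta> P M' n"
proof (cases n)
  case 0
  then show ?thesis
    using assms(1) left_hom_zero[OF assms(2-4)] by (auto simp: hom_module_def)
next
  case (Suc m)
  from Suc obtain k where k: "k \<in> left_hom R (Pm m) M" "f = (\<lambda>x\<in>carrier (Pm (Suc m)). k (d m x))"
    using assms(1) by (auto simp: hom_module_def)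
  have hk: "(\<lambda>x. h (k x)) \<in> left_hom R (Pm m) M'"
    by (rule left_hom_compose[OF k(1) assms(2)])
  have "(\<lambda>x\<in>carrier (Pm n). h (f x)) = (\<lambda>x\<in>carrier (Pm (Suc m)). h (k (d m x)))"
    by (auto simp: k(2) Suc fun_eq_iff)
  then show ?thesis
    using coboundary_SucI[OF hk, of \<eta>] by (simp add: Suc)
qed

lemma chain_lift_commute:
  assumes "chain_lift R P l \<phi> t" "x \<in> carrier (Pm (Suc (l + n)))"
  shows "d n (t (Suc n) x) = t n (d (l + n) x)"
  using assms by (auto simp: chain_lift_def)

lemma chain_lift_hom: "chain_lift R P l \<phi> t \<Longrightarrow> t n \<in> left_hom R (Pm (l + n)) (Pm n)"
  by (auto simp: chain_lift_def)

text \<open>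
  A null-homotopy \<open>t\<^sub>n = d s\<^sub>n + s\<^bsub>n-1\<^esub> d\<close>, stated one degree at a time. The term \<open>s\<^bsub>n-1\<^esub> d\<close> is
  recorded as a coboundary \<open>\<rho>\<close> with values in \<open>P\<^sub>n\<close>, which includes the start \<open>l = n = 0\<close>, where
  there is no \<open>s\<^bsub>n-1\<^esub>\<close> and \<open>\<rho> = 0\<close>. For \<open>l > 0\<close> the cochain that bounds \<open>\<phi>\<close> is lifted through the
  augmentation to give the first \<open>\<rho>\<close>; in the step, \<open>s\<^sub>n\<close> lifts \<open>t\<^sub>n - \<rho>\<close> through \<open>d\<close>.
\<close>

lemma chain_lift_of_coboundary:
  assumes t: "chain_lift R P l \<phi> t" and \<phi>: "\<phi> \<in> coboundaries R \<eta> P N l"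
  shows "\<exists>\<rho>\<in>coboundaries R \<eta> P (Pm n) (l + n). \<forall>x\<in>carrier (Pm (l + n)).
    t n x \<ominus>\<^bsub>Pm n\<^esub> \<rho> x \<in> d n ` carrier (Pm (Suc n))"
proof (induction n)
  case 0
  interpret P0: left_module R "Pm 0"
    by (rule left_module_P)
  have t0: "t 0 \<in> left_hom R (Pm l) (Pm 0)" and augt: "\<And>x. x \<in> carrier (Pm l) \<Longrightarrow> aug (t 0 x) = \<phi> x"
    using t by (auto simp: chain_lift_def dest: spec[of _ 0])
  obtain \<rho> where \<rho>: "\<rho> \<in> coboundaries R \<eta> P (Pm 0) l"
    and \<rho>c: "\<And>x. x \<in> carrier (Pm l) \<Longrightarrow> \<rho> x \<in> carrier (Pm 0)"
    and \<rho>a: "\<And>x. x \<in> carrier (Pm l) \<Longrightarrow> aug (\<rho> x) = \<phi> x"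
  proof (cases l)
    case 0
    then have "\<phi> = (\<lambda>x\<in>carrier (Pm 0). \<zero>\<^bsub>N\<^esub>)"
      using \<phi> by (simp add: hom_module_def)
    then show thesis
      using that[of "\<lambda>x\<in>carrier (Pm 0). \<zero>\<^bsub>Pm 0\<^esub>"] 0 left_hom_zero[OF aug_hom group_P target_group]
      by (simp add: hom_module_def)
  next
    case (Suc k)
    then obtain h where h: "h \<in> left_hom R (Pm k) N" "\<phi> = (\<lambda>x\<in>carrier (Pm (Suc k)). h (d k x))"
      using \<phi> by (auto simp: hom_module_def)
    obtain \<gamma> where \<gamma>: "\<gamma> \<in> left_hom R (Pm k) (Pm 0)" "\<And>x. x \<in> carrier (Pm k) \<Longrightarrow> aug (\<gamma> x) = h x"
      using lift_through_aug[OF h(1)] by blast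
    have "(\<lambda>x\<in>carrier (Pm (Suc k)). \<gamma> (d k x)) \<in> coboundaries R \<eta> P (Pm 0) l"
      unfolding Suc by (rule coboundary_SucI[OF \<gamma>(1)])
    then show thesis
      using that \<gamma> d_closed left_hom_closed[OF \<gamma>(1)] by (simp add: Suc h(2))
  qed
  have "\<phi> x \<in> carrier N" if x: "x \<in> carrier (Pm l)" for x
    using left_hom_closed[OF aug_hom \<rho>c[OF x]] \<rho>a[OF x] by simp
  then have "t 0 x \<ominus>\<^bsub>Pm 0\<^esub> \<rho> x \<in> d 0 ` carrier (Pm (Suc 0))" if x: "x \<in> carrier (Pm l)" for x
    using left_hom_minus[OF aug_hom group_P target_group left_hom_closed[OF t0 x] \<rho>c[OF x]]
      augt[OF x] \<rho>a[OF x] left_hom_closed[OF t0 x] \<rho>c[OF x] x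
    by (simp add: exact_0 minus_eq_zero_iff[OF target_group])
  then show ?case
    using \<rho> by auto
next
  case (Suc n)
  obtain \<rho> where \<rho>: "\<rho> \<in> coboundaries R \<eta> P (Pm n) (l + n)"
    and im: "\<And>x. x \<in> carrier (Pm (l + n)) \<Longrightarrow> t n x \<ominus>\<^bsub>Pm n\<^esub> \<rho> x \<in> d n ` carrier (Pm (Suc n))"
    using Suc.IH by blast
  have null: "r \<odot>\<^bsub>Pm n\<^esub> \<zero>\<^bsub>Pm n\<^esub> = \<zero>\<^bsub>Pm n\<^esub>" if "r \<in> carrier R" for r
    using abelian_group_hom.hom_zero[OF smult_group_hom[OF left_module_P that]] .
  have \<rho>h: "\<rho> \<in> left_hom R (Pm (l + n)) (Pm n)"
    and \<rho>d: "\<And>x. x \<in> carrier (Pm (Suc (l + n))) \<Longrightarrow> \<rho> (d (l + n) x) = \<zero>\<^bsub>Pm n\<^esub>"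
    using coboundary_hom[OF group_P null \<rho>] by (auto simp: hom_module_def)
  obtain s where s: "s \<in> left_hom R (Pm (l + n)) (Pm (Suc n))"
    and ds: "\<And>x. x \<in> carrier (Pm (l + n)) \<Longrightarrow> d n (s x) = t n x \<ominus>\<^bsub>Pm n\<^esub> \<rho> x"
    using lift_through_d[OF left_hom_diff[OF chain_lift_hom[OF t] \<rho>h group_P left_module_P]] im by blast
  let ?\<rho> = "\<lambda>x\<in>carrier (Pm (Suc (l + n))). s (d (l + n) x)"
  have "?\<rho> \<in> coboundaries R \<eta> P (Pm (Suc n)) (l + Suc n)"
    unfolding add_Suc_right by (rule coboundary_SucI[OF s])
  moreover have "t (Suc n) x \<ominus>\<^bsub>Pm (Suc n)\<^esub> ?\<rho> x \<in> d (Suc n) ` carrier (Pm (Suc (Suc n)))"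
    if x: "x \<in> carrier (Pm (l + Suc n))" for x
  proof -
    have x': "x \<in> carrier (Pm (Suc (l + n)))" and dx: "d (l + n) x \<in> carrier (Pm (l + n))"
      using x d_closed by auto
    have tx: "t (Suc n) x \<in> carrier (Pm (Suc n))"
      using left_hom_closed[OF chain_lift_hom[OF t] x] .
    have sx: "s (d (l + n) x) \<in> carrier (Pm (Suc n))"
      by (rule left_hom_closed[OF s dx])
    have "d n (t (Suc n) x \<ominus>\<^bsub>Pm (Suc n)\<^esub> s (d (l + n) x))
      = t n (d (l + n) x) \<ominus>\<^bsub>Pm n\<^esub> (t n (d (l + n) x) \<ominus>\<^bsub>Pm n\<^esub> \<zero>\<^bsub>Pm n\<^esub>)"
      using left_hom_minus[OF d_hom group_P group_P tx sx] chain_lift_commute[OF t x'] ds[OF dx] \<rho>d[OF x'] by simp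
    also have "\<dots> = \<zero>\<^bsub>Pm n\<^esub>"
      using left_hom_closed[OF chain_lift_hom[OF t] dx]
      by (simp add: minus_zero_right[OF group_P] minus_eq_zero_iff[OF group_P])
    finally show ?thesis
      using abelian_group.minus_closed[OF group_P tx sx] x' by (simp add: exact_Suc)
  qed
  ultimately show ?case
    by blast
qed

text \<open>
  With \<open>t = d s + s' d\<close> as above, the cocycle \<open>f\<close> kills \<open>d s\<close> and turns \<open>s' d\<close> into a coboundary.
\<close>

lemma compose_lift_of_coboundary:
  assumes t: "chain_lift R P l \<phi> t" and \<phi>: "\<phi> \<in> coboundaries R \<eta> P N l"
    and f: "f \<in> left_hom R (Pm m) M" "\<And>x. x \<in> carrier (Pm (Suc m)) \<Longrightarrow> f (d m x) = \<zero>\<^bsub>M\<^esub>"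
    and M: "abelian_group M"
  shows "(\<lambda>x\<in>carrier (Pm (l + m)). f (t m x)) \<in> coboundaries R \<eta> P M (l + m)"
proof -
  obtain \<rho> where \<rho>: "\<rho> \<in> coboundaries R \<eta> P (Pm m) (l + m)"
    and im: "\<And>x. x \<in> carrier (Pm (l + m)) \<Longrightarrow> t m x \<ominus>\<^bsub>Pm m\<^esub> \<rho> x \<in> d m ` carrier (Pm (Suc m))"
    using chain_lift_of_coboundary[OF t \<phi>] by blast
  have null: "r \<odot>\<^bsub>Pm m\<^esub> \<zero>\<^bsub>Pm m\<^esub> = \<zero>\<^bsub>Pm m\<^esub>" if "r \<in> carrier R" for r
    using abelian_group_hom.hom_zero[OF smult_group_hom[OF left_module_P that]] .
  have "\<rho> \<in> left_hom R (Pm (l + m)) (Pm m)"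
    using coboundary_hom(1)[OF group_P null \<rho>] by (auto simp: hom_module_def)
  note \<rho>c = left_hom_closed[OF this]
  have "f (t m x) = f (\<rho> x)" if x: "x \<in> carrier (Pm (l + m))" for x
  proof -
    have tx: "t m x \<in> carrier (Pm m)"
      using left_hom_closed[OF chain_lift_hom[OF t] x] .
    have "f (t m x) \<ominus>\<^bsub>M\<^esub> f (\<rho> x) = \<zero>\<^bsub>M\<^esub>"
      using left_hom_minus[OF f(1) group_P M tx \<rho>c[OF x]] im[OF x] f(2) by auto
    then show ?thesis
      using minus_eq_zero_iff[OF M] left_hom_closed[OF f(1)] tx \<rho>c[OF x] by blast
  qed
  then have "(\<lambda>x\<in>carrier (Pm (l + m)). f (t m x)) = (\<lambda>x\<in>carrier (Pm (l + m)). f (\<rho> x))"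
    by auto
  then show ?thesis
    using coboundary_compose[OF \<rho> f(1) group_P M] by simp
qed

end


section \<open>Induced maps of subquotients\<close>

lemma image_submodule:
  assumes "module K M" "module K M'" "h \<in> left_hom K M M'"
  shows "submodule (h ` carrier M) K M'"
proof -
  interpret M: module K M by fact
  interpret M': module K M' by fact
  interpret h: abelian_group_hom M M' h
    using left_hom_group_hom[OF assms(3) M.M.abelian_group_axioms M'.M.abelian_group_axioms] .
  show ?thesis
  proof (rule M'.submoduleI)
    show "h ` carrier M \<subseteq> carrier M'"
      by auto
    show "\<zero>\<^bsub>M'\<^esub> \<in> h ` carrier M"
      using M.M.zero_closed by (intro image_eqI[of _ _ "\<zero>\<^bsub>M\<^esub>"]) simp_all
    show "\<ominus>\<^bsub>M'\<^esub> y \<in> h ` carrier M" if "y \<in> h ` carrier M" for y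
      using that by (auto simp flip: h.hom_a_inv)
    show "y \<oplus>\<^bsub>M'\<^esub> z \<in> h ` carrier M" if "y \<in> h ` carrier M" "z \<in> h ` carrier M" for y z
      using that by (auto simp flip: h.hom_add)
    show "k \<odot>\<^bsub>M'\<^esub> y \<in> h ` carrier M" if "k \<in> carrier K" "y \<in> h ` carrier M" for k y
      using that left_hom_smult[OF assms(3)] by (auto simp: image_iff) (metis M.smult_closed)
  qed
qed

text \<open>
  The union runs over the images of all representatives. This is the form in which the Yoneda
  product is defined, and it is a single coset as soon as \<open>h\<close> respects the denominators.
\<close>

definition induced ::
  "('k, 'm, 'y) module_scheme \<Rightarrow> 'm set \<Rightarrow> ('n \<Rightarrow> 'm) \<Rightarrow> 'n set \<Rightarrow> 'm set"
  where "induced M' N' h A = (\<Union>x\<in>A. N' +>\<^bsub>M'\<^esub> h x)"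

locale subquotient_map = dom: subquotient K M S N + cod: subquotient K M' S' N'
  for K M S N M' S' N' +
  fixes h
  assumes hom: "h \<in> left_hom K M M'" and num_map: "x \<in> S \<Longrightarrow> h x \<in> S'" and den_map: "x \<in> N \<Longrightarrow> h x \<in> N'"
begin

lemma induced_coset:
  assumes "x \<in> S"
  shows "induced M' N' h (N +>\<^bsub>M\<^esub> x) = N' +>\<^bsub>M'\<^esub> h x"
proof -
  have x: "x \<in> carrier M"
    using assms by (rule dom.num_closed)
  have "N' +>\<^bsub>M'\<^esub> h y = N' +>\<^bsub>M'\<^esub> h x" if y: "y \<in> N +>\<^bsub>M\<^esub> x" for y
  proof -
    have yM: "y \<in> carrier M"
      using dom.num_closed dom.coset_memD(1)[OF dom.coset_closed[OF assms] y] .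
    have "h (y \<ominus>\<^bsub>M\<^esub> x) \<in> N'"
      using den_map dom.mem_coset_iff[OF x yM] y by simp
    then show ?thesis
      using left_hom_minus[OF hom dom.M.abelian_group_axioms cod.M.abelian_group_axioms yM x]
        cod.coset_eq_iff left_hom_closed[OF hom] x yM by simp
  qed
  then have "(\<Union>y\<in>N +>\<^bsub>M\<^esub> x. N' +>\<^bsub>M'\<^esub> h y) = (\<Union>y\<in>N +>\<^bsub>M\<^esub> x. N' +>\<^bsub>M'\<^esub> h x)"
    by (intro SUP_cong) auto
  also have "\<dots> = N' +>\<^bsub>M'\<^esub> h x"
    using dom.coset_self[OF assms] by (intro UN_constant_eq) auto
  finally show ?thesis
    by (simp only: induced_def)
qed

lemma induced_hom: "induced M' N' h \<in> left_hom K dom.Q cod.Q"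
proof (rule left_homI)
  fix A assume "A \<in> carrier dom.Q"
  then obtain x where x: "x \<in> S" "A = N +>\<^bsub>M\<^esub> x"
    by (rule dom.coset_cases)
  have xM: "x \<in> carrier M"
    using x(1) by (rule dom.num_closed)
  show "induced M' N' h A \<in> carrier cod.Q"
    using x induced_coset cod.coset_closed num_map by simp
  show "induced M' N' h (k \<odot>\<^bsub>dom.Q\<^esub> A) = k \<odot>\<^bsub>cod.Q\<^esub> induced M' N' h A" if k: "k \<in> carrier K" for k
  proof -
    have "induced M' N' h (k \<odot>\<^bsub>dom.Q\<^esub> A) = N' +>\<^bsub>M'\<^esub> h (k \<odot>\<^bsub>M\<^esub> x)"
      unfolding x(2) dom.coset_smult[OF k x(1), symmetric]
      by (rule induced_coset[OF dom.submoduleE(4)[OF dom.num k x(1)]])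
    then show ?thesis
      unfolding left_hom_smult[OF hom k xM] x(2) induced_coset[OF x(1)] cod.coset_smult[OF k num_map[OF x(1)]] .
  qed
  fix A' assume "A' \<in> carrier dom.Q"
  then obtain x' where x': "x' \<in> S" "A' = N +>\<^bsub>M\<^esub> x'"
    by (rule dom.coset_cases)
  have xM': "x' \<in> carrier M"
    using x'(1) by (rule dom.num_closed)
  have "induced M' N' h (A \<oplus>\<^bsub>dom.Q\<^esub> A') = N' +>\<^bsub>M'\<^esub> h (x \<oplus>\<^bsub>M\<^esub> x')"
    unfolding x(2) x'(2) dom.coset_add[OF x(1) x'(1), symmetric]
    by (rule induced_coset[OF dom.submoduleE(5)[OF dom.num x(1) x'(1)]])
  then show "induced M' N' h (A \<oplus>\<^bsub>dom.Q\<^esub> A') = induced M' N' h A \<oplus>\<^bsub>cod.Q\<^esub> induced M' N' h A'"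
    unfolding left_hom_add[OF hom xM xM'] x(2) x'(2) induced_coset[OF x(1)] induced_coset[OF x'(1)]
      cod.coset_add[OF num_map[OF x(1)] num_map[OF x'(1)]] .
qed

end


section \<open>Extension groups with coefficients in a scalar module\<close>

text \<open>
  The module \<open>K\<^sup>B\<close> on which \<open>R\<close> acts through \<open>\<epsilon>\<close>. The operations are prescribed on the carrier
  only: a module defined by a matrix representation has the same values there but arbitrary ones
  elsewhere.
\<close>

definition scalar_module ::
  "('d, 'x) ring_scheme \<Rightarrow> ('k, 'z) ring_scheme \<Rightarrow> ('d \<Rightarrow> 'k) \<Rightarrow> 'b set \<Rightarrow> ('d, 'b \<Rightarrow> 'k, 'y) module_scheme \<Rightarrow> bool"
  where "scalar_module R K \<epsilon> B M \<longleftrightarrow>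
    carrier M = B \<rightarrow>\<^sub>E carrier K \<and> \<zero>\<^bsub>M\<^esub> = (\<lambda>b\<in>B. \<zero>\<^bsub>K\<^esub>) \<and>
    (\<forall>f\<in>carrier M. \<forall>f'\<in>carrier M. f \<oplus>\<^bsub>M\<^esub> f' = (\<lambda>b\<in>B. f b \<oplus>\<^bsub>K\<^esub> f' b)) \<and>
    (\<forall>r\<in>carrier R. \<forall>f\<in>carrier M. r \<odot>\<^bsub>M\<^esub> f = (\<lambda>b\<in>B. \<epsilon> r \<otimes>\<^bsub>K\<^esub> f b))"

lemma scalar_moduleD:
  assumes "scalar_module R K \<epsilon> B M"
  shows "carrier M = B \<rightarrow>\<^sub>E carrier K" "\<zero>\<^bsub>M\<^esub> = (\<lambda>b\<in>B. \<zero>\<^bsub>K\<^esub>)"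
    "f \<in> carrier M \<Longrightarrow> f' \<in> carrier M \<Longrightarrow> f \<oplus>\<^bsub>M\<^esub> f' = (\<lambda>b\<in>B. f b \<oplus>\<^bsub>K\<^esub> f' b)"
    "r \<in> carrier R \<Longrightarrow> f \<in> carrier M \<Longrightarrow> r \<odot>\<^bsub>M\<^esub> f = (\<lambda>b\<in>B. \<epsilon> r \<otimes>\<^bsub>K\<^esub> f b)"
  using assms unfolding scalar_module_def by blast+

lemma scalar_module_group:
  assumes "cring K" "scalar_module R K \<epsilon> B M"
  shows "abelian_group M"
proof (rule abelian_groupI)
  interpret K: cring K by fact
  note sc = scalar_moduleD[OF assms(2)]
  have ac: "f \<oplus>\<^bsub>M\<^esub> f' \<in> carrier M" if "f \<in> carrier M" "f' \<in> carrier M" for f f'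
    unfolding sc(3)[OF that] using that unfolding sc(1) by auto
  have z: "\<zero>\<^bsub>M\<^esub> \<in> carrier M"
    unfolding sc(1,2) by auto
  then show "\<zero>\<^bsub>M\<^esub> \<in> carrier M" .
  fix f assume f: "f \<in> carrier M"
  show "\<zero>\<^bsub>M\<^esub> \<oplus>\<^bsub>M\<^esub> f = f"
    unfolding sc(3)[OF z f] using f unfolding sc(1,2) by (auto simp: PiE_iff extensional_def fun_eq_iff)
  have n: "(\<lambda>b\<in>B. \<ominus>\<^bsub>K\<^esub> f b) \<in> carrier M"
    using f unfolding sc(1) by auto
  have "(\<lambda>b\<in>B. \<ominus>\<^bsub>K\<^esub> f b) \<oplus>\<^bsub>M\<^esub> f = \<zero>\<^bsub>M\<^esub>"
    unfolding sc(3)[OF n f] using f unfolding sc(1,2) by (auto simp: PiE_iff K.l_neg fun_eq_iff)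
  then show "\<exists>y\<in>carrier M. y \<oplus>\<^bsub>M\<^esub> f = \<zero>\<^bsub>M\<^esub>"
    using n by blast
  fix f' assume f': "f' \<in> carrier M"
  show "f \<oplus>\<^bsub>M\<^esub> f' \<in> carrier M"
    by (rule ac[OF f f'])
  show "f \<oplus>\<^bsub>M\<^esub> f' = f' \<oplus>\<^bsub>M\<^esub> f"
    unfolding sc(3)[OF f f'] sc(3)[OF f' f] using f f' unfolding sc(1) by (auto simp: K.a_comm PiE_iff fun_eq_iff)
  fix f'' assume f'': "f'' \<in> carrier M"
  show "f \<oplus>\<^bsub>M\<^esub> f' \<oplus>\<^bsub>M\<^esub> f'' = f \<oplus>\<^bsub>M\<^esub> (f' \<oplus>\<^bsub>M\<^esub> f'')"
    unfolding sc(3)[OF ac[OF f f'] f''] sc(3)[OF f ac[OF f' f'']]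
    unfolding sc(3)[OF f f'] sc(3)[OF f' f'']
    using f f' f'' unfolding sc(1) by (auto simp: K.a_assoc PiE_iff fun_eq_iff)
qed

text \<open>
  The resolved module \<open>N\<close> is \<open>K\<close> itself, a scalar module whose only index is \<open>i0\<close>. Since \<open>\<eta>\<close> is a
  section of \<open>\<epsilon>\<close>, the scalar action of \<open>K\<close> on homomorphisms into a scalar module, which is defined
  through \<open>\<eta>\<close>, is the pointwise one.
\<close>

locale scalar_coefficients = resolved R N P + K: cring K
  for R :: "('d, 'x) ring_scheme" and N :: "('d, 'b \<Rightarrow> 'k, 'y) module_scheme"
    and P :: "('d, 'p, 'b \<Rightarrow> 'k) resolution" and K :: "('k, 'z) ring_scheme" +
  fixes \<eta> :: "'k \<Rightarrow> 'd" and \<epsilon> :: "'d \<Rightarrow> 'k" and i0 :: 'b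
  assumes eta_closed: "k \<in> carrier K \<Longrightarrow> \<eta> k \<in> carrier R"
    and eps_closed: "r \<in> carrier R \<Longrightarrow> \<epsilon> r \<in> carrier K"
    and eps_eta: "k \<in> carrier K \<Longrightarrow> \<epsilon> (\<eta> k) = k"
    and scalar_N: "scalar_module R K \<epsilon> {i0} N"
begin

abbreviation H where "H M m \<equiv> hom_module R \<eta> (Pm m) M"
abbreviation E where "E M m \<equiv> ext_module R \<eta> P M m"
abbreviation Z where "Z M m \<equiv> cocycles R \<eta> P M m"
abbreviation C where "C M m \<equiv> coboundaries R \<eta> P M m"

lemma P_closed:
  "r \<in> carrier R \<Longrightarrow> x \<in> carrier (Pm n) \<Longrightarrow> r \<odot>\<^bsub>Pm n\<^esub> x \<in> carrier (Pm n)"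
  "x \<in> carrier (Pm n) \<Longrightarrow> y \<in> carrier (Pm n) \<Longrightarrow> x \<oplus>\<^bsub>Pm n\<^esub> y \<in> carrier (Pm n)"
  using left_module.smult_closed[OF left_module_P] abelian_monoid.a_closed[OF abelian_group.axioms(1)[OF group_P]]
  by blast+

context
  fixes M :: "('d, 'b \<Rightarrow> 'k, 'u) module_scheme" and B :: "'b set"
  assumes sc: "scalar_module R K \<epsilon> B M"
begin

lemmas scD = scalar_moduleD[OF sc]

lemma group_M: "abelian_group M"
  by (rule scalar_module_group[OF K.cring_axioms sc])

lemma hom_values: "f \<in> carrier (H M m) \<Longrightarrow> x \<in> carrier (Pm m) \<Longrightarrow> f x \<in> B \<rightarrow>\<^sub>E carrier K"
  using scD(1) by (auto simp: hom_module_def)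

lemma hom_value_closed: "f \<in> carrier (H M m) \<Longrightarrow> x \<in> carrier (Pm m) \<Longrightarrow> b \<in> B \<Longrightarrow> f x b \<in> carrier K"
  using hom_values by blast

lemma hom_value_add:
  assumes "f \<in> carrier (H M m)" "x \<in> carrier (Pm m)" "y \<in> carrier (Pm m)" "b \<in> B"
  shows "f (x \<oplus>\<^bsub>Pm m\<^esub> y) b = f x b \<oplus>\<^bsub>K\<^esub> f y b"
proof -
  have f: "f \<in> left_hom R (Pm m) M"
    using assms(1) by (simp add: hom_module_def)
  show ?thesis
    using left_hom_add[OF f assms(2,3)] scD(3)[OF left_hom_closed[OF f assms(2)] left_hom_closed[OF f assms(3)]]
      assms(4) by simp
qed

lemma hom_value_smult:
  assumes "f \<in> carrier (H M m)" "r \<in> carrier R" "x \<in> carrier (Pm m)" "b \<in> B"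
  shows "f (r \<odot>\<^bsub>Pm m\<^esub> x) b = \<epsilon> r \<otimes>\<^bsub>K\<^esub> f x b"
proof -
  have f: "f \<in> left_hom R (Pm m) M"
    using assms(1) by (simp add: hom_module_def)
  show ?thesis
    using left_hom_smult[OF f assms(2,3)] scD(4)[OF assms(2) left_hom_closed[OF f assms(3)]] assms(4) by simp
qed

text \<open>
  Homomorphisms into \<open>K\<^sup>B\<close> are handled through their scalar values \<open>f x b\<close>, on which all operations
  are those of \<open>K\<close>.
\<close>

lemma hom_eqI:
  assumes "f \<in> carrier (H M m)" "f' \<in> carrier (H M m)"
    and "\<And>x b. x \<in> carrier (Pm m) \<Longrightarrow> b \<in> B \<Longrightarrow> f x b = f' x b"
  shows "f = f'"
proof (rule extensionalityI[of _ "carrier (Pm m)"])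
  fix x assume x: "x \<in> carrier (Pm m)"
  show "f x = f' x"
    using hom_values[OF assms(1) x] hom_values[OF assms(2) x] assms(3)[OF x] by (rule PiE_ext)
qed (use assms(1,2) in \<open>auto simp: hom_module_def PiE_iff\<close>)

lemma homI:
  assumes "\<And>x b. x \<in> carrier (Pm m) \<Longrightarrow> b \<in> B \<Longrightarrow> F x b \<in> carrier K"
    and "\<And>x y b. x \<in> carrier (Pm m) \<Longrightarrow> y \<in> carrier (Pm m) \<Longrightarrow> b \<in> B \<Longrightarrow>
      F (x \<oplus>\<^bsub>Pm m\<^esub> y) b = F x b \<oplus>\<^bsub>K\<^esub> F y b"
    and "\<And>r x b. r \<in> carrier R \<Longrightarrow> x \<in> carrier (Pm m) \<Longrightarrow> b \<in> B \<Longrightarrow> F (r \<odot>\<^bsub>Pm m\<^esub> x) b = \<epsilon> r \<otimes>\<^bsub>K\<^esub> F x b"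
  shows "(\<lambda>x\<in>carrier (Pm m). \<lambda>b\<in>B. F x b) \<in> carrier (H M m)"
proof -
  let ?f = "\<lambda>x\<in>carrier (Pm m). \<lambda>b\<in>B. F x b"
  have cl: "?f x \<in> carrier M" if "x \<in> carrier (Pm m)" for x
    using that assms(1) by (auto simp: scD(1))
  have "?f \<in> left_hom R (Pm m) M"
  proof (rule left_homI)
    fix x assume x: "x \<in> carrier (Pm m)"
    show "?f x \<in> carrier M"
      by (rule cl[OF x])
    show "?f (x \<oplus>\<^bsub>Pm m\<^esub> y) = ?f x \<oplus>\<^bsub>M\<^esub> ?f y" if y: "y \<in> carrier (Pm m)" for y
      unfolding scD(3)[OF cl[OF x] cl[OF y]] using x y assms(2) by (auto simp: P_closed)
    show "?f (r \<odot>\<^bsub>Pm m\<^esub> x) = r \<odot>\<^bsub>M\<^esub> ?f x" if r: "r \<in> carrier R" for r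
      unfolding scD(4)[OF r cl[OF x]] using x r assms(3) by (auto simp: P_closed)
  qed
  then show ?thesis
    using cl by (auto simp: hom_module_def)
qed

lemma hom_add_value:
  assumes "f \<in> carrier (H M m)" "f' \<in> carrier (H M m)" "x \<in> carrier (Pm m)" "b \<in> B"
  shows "(f \<oplus>\<^bsub>H M m\<^esub> f') x b = f x b \<oplus>\<^bsub>K\<^esub> f' x b"
proof -
  have "f x \<in> carrier M" "f' x \<in> carrier M"
    using hom_values[OF assms(1,3)] hom_values[OF assms(2,3)] scD(1) by auto
  from scD(3)[OF this] show ?thesis
    using assms(3,4) by (simp add: hom_module_def)
qed

lemma hom_smult_value:
  assumes "k \<in> carrier K" "f \<in> carrier (H M m)" "x \<in> carrier (Pm m)" "b \<in> B"
  shows "(k \<odot>\<^bsub>H M m\<^esub> f) x b = k \<otimes>\<^bsub>K\<^esub> f x b"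
proof -
  have "f x \<in> carrier M"
    using hom_values[OF assms(2,3)] scD(1) by auto
  from scD(4)[OF eta_closed[OF assms(1)] this] show ?thesis
    using assms by (simp add: hom_module_def eps_eta)
qed

lemma hom_zero_value:
  "x \<in> carrier (Pm m) \<Longrightarrow> b \<in> B \<Longrightarrow> \<zero>\<^bsub>H M m\<^esub> x b = \<zero>\<^bsub>K\<^esub>"
  by (simp add: hom_module_def scD(2))

lemma hom_add_closed:
  assumes "f \<in> carrier (H M m)" "f' \<in> carrier (H M m)"
  shows "f \<oplus>\<^bsub>H M m\<^esub> f' \<in> carrier (H M m)"
proof -
  have "(\<lambda>x\<in>carrier (Pm m). \<lambda>b\<in>B. f x b \<oplus>\<^bsub>K\<^esub> f' x b) \<in> carrier (H M m)"
    using assms hom_value_closed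
    by (intro homI) (simp_all add: hom_value_add hom_value_smult K.r_distr eps_closed K.a_ac P_closed)
  moreover have "f \<oplus>\<^bsub>H M m\<^esub> f' = (\<lambda>x\<in>carrier (Pm m). \<lambda>b\<in>B. f x b \<oplus>\<^bsub>K\<^esub> f' x b)"
  proof -
    have "f x \<oplus>\<^bsub>M\<^esub> f' x = (\<lambda>b\<in>B. f x b \<oplus>\<^bsub>K\<^esub> f' x b)" if "x \<in> carrier (Pm m)" for x
      using scD(3) hom_values[OF assms(1) that] hom_values[OF assms(2) that] scD(1) by simp
    then show ?thesis
      by (simp add: hom_module_def cong: restrict_cong)
  qed
  ultimately show ?thesis
    by simp
qed

lemma hom_smult_closed:
  assumes "k \<in> carrier K" "f \<in> carrier (H M m)"
  shows "k \<odot>\<^bsub>H M m\<^esub> f \<in> carrier (H M m)"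
proof -
  have "(\<lambda>x\<in>carrier (Pm m). \<lambda>b\<in>B. k \<otimes>\<^bsub>K\<^esub> f x b) \<in> carrier (H M m)"
    using assms hom_value_closed
    by (intro homI) (simp_all add: hom_value_add hom_value_smult K.r_distr eps_closed K.m_lcomm P_closed)
  moreover have "k \<odot>\<^bsub>H M m\<^esub> f = (\<lambda>x\<in>carrier (Pm m). \<lambda>b\<in>B. k \<otimes>\<^bsub>K\<^esub> f x b)"
  proof -
    have "\<eta> k \<odot>\<^bsub>M\<^esub> f x = (\<lambda>b\<in>B. k \<otimes>\<^bsub>K\<^esub> f x b)" if "x \<in> carrier (Pm m)" for x
      using scD(4)[OF eta_closed[OF assms(1)]] hom_values[OF assms(2) that] scD(1) eps_eta[OF assms(1)] by simp
    then show ?thesis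
      by (simp add: hom_module_def cong: restrict_cong)
  qed
  ultimately show ?thesis
    by simp
qed

lemma hom_zero_closed: "\<zero>\<^bsub>H M m\<^esub> \<in> carrier (H M m)"
proof -
  have "(\<lambda>x\<in>carrier (Pm m). \<lambda>b\<in>B. \<zero>\<^bsub>K\<^esub>) \<in> carrier (H M m)"
    by (intro homI) (simp_all add: eps_closed)
  then show ?thesis
    by (simp add: hom_module_def scD(2))
qed

lemma hom_module_is_module: "module K (H M m)"
proof (rule moduleI)
  note vals = hom_add_value hom_smult_value hom_zero_value hom_value_closed
    hom_add_closed hom_smult_closed hom_zero_closed
  show "cring K"
    by (rule K.cring_axioms)
  show "abelian_group (H M m)"
  proof (rule abelian_groupI)
    fix f assume f: "f \<in> carrier (H M m)"
    show "\<zero>\<^bsub>H M m\<^esub> \<oplus>\<^bsub>H M m\<^esub> f = f"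
      using f by (intro hom_eqI[where m = m]) (simp_all add: vals)
    let ?n = "(\<ominus>\<^bsub>K\<^esub> \<one>\<^bsub>K\<^esub>) \<odot>\<^bsub>H M m\<^esub> f"
    have "?n \<oplus>\<^bsub>H M m\<^esub> f = \<zero>\<^bsub>H M m\<^esub>"
      using f by (intro hom_eqI[where m = m]) (simp_all add: vals K.l_minus K.l_neg)
    moreover have "?n \<in> carrier (H M m)"
      using f by (simp add: vals)
    ultimately show "\<exists>f'\<in>carrier (H M m). f' \<oplus>\<^bsub>H M m\<^esub> f = \<zero>\<^bsub>H M m\<^esub>"
      by blast
    fix f' assume f': "f' \<in> carrier (H M m)"
    show "f \<oplus>\<^bsub>H M m\<^esub> f' = f' \<oplus>\<^bsub>H M m\<^esub> f"
      using f f' by (intro hom_eqI[where m = m]) (simp_all add: vals K.a_comm)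
    fix f'' assume f'': "f'' \<in> carrier (H M m)"
    show "f \<oplus>\<^bsub>H M m\<^esub> f' \<oplus>\<^bsub>H M m\<^esub> f'' = f \<oplus>\<^bsub>H M m\<^esub> (f' \<oplus>\<^bsub>H M m\<^esub> f'')"
      using f f' f'' by (intro hom_eqI[where m = m]) (simp_all add: vals K.a_assoc)
  qed (simp_all add: vals)
  fix f assume f: "f \<in> carrier (H M m)"
  show "\<one>\<^bsub>K\<^esub> \<odot>\<^bsub>H M m\<^esub> f = f"
    using f by (intro hom_eqI[where m = m]) (simp_all add: vals)
next
  note vals = hom_add_value hom_smult_value hom_zero_value hom_value_closed
    hom_add_closed hom_smult_closed hom_zero_closed
  fix a f assume a: "a \<in> carrier K" and f: "f \<in> carrier (H M m)"
  show "a \<odot>\<^bsub>H M m\<^esub> f \<in> carrier (H M m)"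
    using a f by (simp add: vals)
  show "(a \<oplus>\<^bsub>K\<^esub> b) \<odot>\<^bsub>H M m\<^esub> f = a \<odot>\<^bsub>H M m\<^esub> f \<oplus>\<^bsub>H M m\<^esub> b \<odot>\<^bsub>H M m\<^esub> f" if "b \<in> carrier K" for b
    using a f that by (intro hom_eqI[where m = m]) (simp_all add: vals K.l_distr)
  show "a \<otimes>\<^bsub>K\<^esub> b \<odot>\<^bsub>H M m\<^esub> f = a \<odot>\<^bsub>H M m\<^esub> (b \<odot>\<^bsub>H M m\<^esub> f)" if "b \<in> carrier K" for b
    using a f that by (intro hom_eqI[where m = m]) (simp_all add: vals K.m_assoc)
  show "a \<odot>\<^bsub>H M m\<^esub> (f \<oplus>\<^bsub>H M m\<^esub> f') = a \<odot>\<^bsub>H M m\<^esub> f \<oplus>\<^bsub>H M m\<^esub> a \<odot>\<^bsub>H M m\<^esub> f'"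
    if "f' \<in> carrier (H M m)" for f'
    using a f that by (intro hom_eqI[where m = m]) (simp_all add: vals K.r_distr)
qed

lemma pullback_hom:
  assumes s: "s \<in> left_hom R (Pm n) (Pm m)"
  shows "(\<lambda>f. \<lambda>x\<in>carrier (Pm n). f (s x)) \<in> left_hom K (H M m) (H M n)"
proof -
  have closed: "(\<lambda>x\<in>carrier (Pm n). f (s x)) \<in> carrier (H M n)" if "f \<in> carrier (H M m)" for f
  proof -
    have "f \<in> left_hom R (Pm m) M"
      using that by (simp add: hom_module_def)
    from restrict_in_hom_module[OF left_hom_compose[OF s this]] show ?thesis .
  qed
  note sx = left_hom_closed[OF s]
  show ?thesis
  proof (rule left_homI)
    fix f assume f: "f \<in> carrier (H M m)"
    show "(\<lambda>x\<in>carrier (Pm n). f (s x)) \<in> carrier (H M n)"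
      by (rule closed[OF f])
    show "(\<lambda>x\<in>carrier (Pm n). (f \<oplus>\<^bsub>H M m\<^esub> f') (s x))
        = (\<lambda>x\<in>carrier (Pm n). f (s x)) \<oplus>\<^bsub>H M n\<^esub> (\<lambda>x\<in>carrier (Pm n). f' (s x))"
      if f': "f' \<in> carrier (H M m)" for f'
      using f f' by (intro hom_eqI[where m = n] closed hom_add_closed) (simp_all add: hom_add_value closed sx)
    show "(\<lambda>x\<in>carrier (Pm n). (k \<odot>\<^bsub>H M m\<^esub> f) (s x)) = k \<odot>\<^bsub>H M n\<^esub> (\<lambda>x\<in>carrier (Pm n). f (s x))"
      if k: "k \<in> carrier K" for k
      using f k by (intro hom_eqI[where m = n] closed hom_smult_closed) (simp_all add: hom_smult_value closed sx)
  qed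
qed

abbreviation (input) \<delta> where "\<delta> m \<equiv> (\<lambda>f. \<lambda>x\<in>carrier (Pm (Suc m)). f (d m x))"

lemmas delta_hom = pullback_hom[OF d_hom]

lemma cocycles_eq_kernel: "Z M m = {f \<in> carrier (H M m). \<delta> m f = \<zero>\<^bsub>H M (Suc m)\<^esub>}"
  unfolding cocycles_def by (auto simp: hom_module_def fun_eq_iff)

lemma coboundaries_eq_image: "C M (Suc m) = \<delta> m ` carrier (H M m)"
  by auto

lemma coboundary_kernel:
  assumes "f \<in> C M m"
  shows "f \<in> Z M m"
proof -
  have "r \<odot>\<^bsub>M\<^esub> \<zero>\<^bsub>M\<^esub> = \<zero>\<^bsub>M\<^esub>" if r: "r \<in> carrier R" for r
  proof -
    have z: "\<zero>\<^bsub>M\<^esub> \<in> carrier M"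
      unfolding scD(1,2) by auto
    show ?thesis
      unfolding scD(4)[OF r z] using eps_closed[OF r] by (auto simp: scD(2))
  qed
  from coboundary_hom[OF group_M this assms] show ?thesis
    by (simp add: cocycles_def)
qed

text \<open>
  Cocycles are the kernel of precomposition with the differential, and coboundaries in positive
  degree are its image.
\<close>

lemma ext_subquotient: "subquotient K (H M m) (Z M m) (C M m)"
proof -
  interpret H: module K "H M m"
    by (rule hom_module_is_module)
  interpret H': module K "H M (Suc m)"
    by (rule hom_module_is_module)
  have "submodule (Z M m) K (H M m)"
    unfolding cocycles_eq_kernel
    by (rule H.kernel_submodule[OF delta_hom module_imp_left_module[OF H'.module_axioms]])
  moreover have "submodule (C M m) K (H M m)"
  proof (cases m)
    case 0
    have "submodule {\<zero>\<^bsub>H M m\<^esub>} K (H M m)"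
      by (rule H.submoduleI) (simp_all add: minus_zero[OF H.M.abelian_group_axioms])
    then show ?thesis
      by (simp add: 0)
  next
    case (Suc n)
    then show ?thesis
      using image_submodule[OF hom_module_is_module hom_module_is_module delta_hom]
      by (simp only: coboundaries_eq_image)
  qed
  ultimately show ?thesis
    unfolding subquotient_def subquotient_axioms_def
    using coboundary_kernel H.module_axioms by blast
qed

lemma ext_is_module: "module K (E M m)"
  unfolding ext_module_def by (rule subquotient.subquotient_is_module[OF ext_subquotient])

end

end


section \<open>Coordinates of extension classes\<close>

context scalar_coefficients
begin

text \<open>
  The values of \<open>coord m i f\<close> are functions on \<open>{i0}\<close> because this is how \<open>K\<close> appears as the
  trivial module \<open>N\<close>; \<open>join\<close> is the inverse passage from families to \<open>K\<^sup>B\<close>.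
\<close>

definition coord :: "nat \<Rightarrow> 'b \<Rightarrow> ('p \<Rightarrow> 'b \<Rightarrow> 'k) \<Rightarrow> 'p \<Rightarrow> 'b \<Rightarrow> 'k"
  where "coord m i f = (\<lambda>x\<in>carrier (Pm m). \<lambda>j\<in>{i0}. f x i)"

definition join :: "'b set \<Rightarrow> nat \<Rightarrow> ('b \<Rightarrow> 'p \<Rightarrow> 'b \<Rightarrow> 'k) \<Rightarrow> 'p \<Rightarrow> 'b \<Rightarrow> 'k"
  where "join B m F = (\<lambda>x\<in>carrier (Pm m). \<lambda>i\<in>B. F i x i0)"

definition ext_coord :: "nat \<Rightarrow> 'b \<Rightarrow> ('p \<Rightarrow> 'b \<Rightarrow> 'k) set \<Rightarrow> ('p \<Rightarrow> 'b \<Rightarrow> 'k) set"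
  where "ext_coord m i = induced (H N m) (C N m) (coord m i)"

definition precompose_lift ::
  "nat \<Rightarrow> nat \<Rightarrow> ('p \<Rightarrow> 'b \<Rightarrow> 'k) set \<Rightarrow> ('p \<Rightarrow> 'b \<Rightarrow> 'k) \<Rightarrow> 'p \<Rightarrow> 'b \<Rightarrow> 'k"
  where "precompose_lift m l A f = (\<lambda>x\<in>carrier (Pm (m + l)). f (class_lift R P l A m x))"

lemma yoneda_eq_induced:
  "yoneda R \<eta> P M m l A A' = induced (H M (m + l)) (C M (m + l)) (precompose_lift m l A') A"
  by (simp add: yoneda_def induced_def precompose_lift_def)

lemma coord_value: "x \<in> carrier (Pm m) \<Longrightarrow> coord m i f x i0 = f x i"
  by (simp add: coord_def)

lemma coord_delta:
  "coord (Suc m) i (\<lambda>x\<in>carrier (Pm (Suc m)). f (d m x)) = (\<lambda>x\<in>carrier (Pm (Suc m)). coord m i f (d m x))"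
  using d_closed by (auto simp: coord_def fun_eq_iff)

context
  fixes M :: "('d, 'b \<Rightarrow> 'k, 'u) module_scheme" and B :: "'b set"
  assumes sc: "scalar_module R K \<epsilon> B M"
begin

lemma coord_hom:
  assumes i: "i \<in> B"
  shows "coord m i \<in> left_hom K (H M m) (H N m)"
proof -
  have closed: "coord m i f \<in> carrier (H N m)" if f: "f \<in> carrier (H M m)" for f
    unfolding coord_def using i
    by (intro homI[OF scalar_N])
      (simp_all add: hom_value_closed[OF sc f] hom_value_add[OF sc f] hom_value_smult[OF sc f])
  note M = hom_add_closed[OF sc] hom_add_value[OF sc] hom_smult_closed[OF sc] hom_smult_value[OF sc]
  note N = hom_add_closed[OF scalar_N] hom_add_value[OF scalar_N]
    hom_smult_closed[OF scalar_N] hom_smult_value[OF scalar_N]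
  show ?thesis
  proof (rule left_homI)
    fix f assume f: "f \<in> carrier (H M m)"
    show "coord m i f \<in> carrier (H N m)"
      by (rule closed[OF f])
    show "coord m i (f \<oplus>\<^bsub>H M m\<^esub> f') = coord m i f \<oplus>\<^bsub>H N m\<^esub> coord m i f'" if f': "f' \<in> carrier (H M m)" for f'
      using f f' i by (intro hom_eqI[OF scalar_N, where m = m]) (simp_all add: closed M N coord_value)
    show "coord m i (k \<odot>\<^bsub>H M m\<^esub> f) = k \<odot>\<^bsub>H N m\<^esub> coord m i f" if k: "k \<in> carrier K" for k
      using f k i by (intro hom_eqI[OF scalar_N, where m = m]) (simp_all add: closed M N coord_value)
  qed
qed

lemma coord_cocycle:
  assumes "i \<in> B" "f \<in> Z M m"
  shows "coord m i f \<in> Z N m"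
  using assms left_hom_closed[OF coord_hom[OF assms(1)]] d_closed
  by (auto simp: cocycles_def coord_def scalar_moduleD(2)[OF sc] scalar_moduleD(2)[OF scalar_N] fun_eq_iff)

lemma coord_coboundary:
  assumes i: "i \<in> B" and f: "f \<in> C M m"
  shows "coord m i f \<in> C N m"
proof (cases m)
  case 0
  then show ?thesis
    using f left_hom_zero[OF coord_hom[OF i] module_abelian_group[OF hom_module_is_module[OF sc]]
        module_abelian_group[OF hom_module_is_module[OF scalar_N]]]
    by simp
next
  case (Suc n)
  then obtain h where "h \<in> carrier (H M n)" "f = (\<lambda>x\<in>carrier (Pm (Suc n)). h (d n x))"
    using f by auto
  then show ?thesis
    using Suc left_hom_closed[OF coord_hom[OF i]] by (auto simp: coord_delta)
qed

lemma coord_subquotient_map: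
  assumes "i \<in> B"
  shows "subquotient_map K (H M m) (Z M m) (C M m) (H N m) (Z N m) (C N m) (coord m i)"
  using ext_subquotient[OF sc] ext_subquotient[OF scalar_N] coord_hom[OF assms]
    coord_cocycle[OF assms] coord_coboundary[OF assms]
  by (intro subquotient_map.intro subquotient_map_axioms.intro)

lemma ext_coord_hom: "i \<in> B \<Longrightarrow> ext_coord m i \<in> left_hom K (E M m) (E N m)"
  unfolding ext_coord_def ext_module_def by (rule subquotient_map.induced_hom[OF coord_subquotient_map])

lemma ext_coord_coset:
  "i \<in> B \<Longrightarrow> f \<in> Z M m \<Longrightarrow> ext_coord m i (C M m +>\<^bsub>H M m\<^esub> f) = C N m +>\<^bsub>H N m\<^esub> coord m i f"
  unfolding ext_coord_def by (rule subquotient_map.induced_coset[OF coord_subquotient_map])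

lemma join_closed:
  assumes "\<And>i. i \<in> B \<Longrightarrow> F i \<in> carrier (H N m)"
  shows "join B m F \<in> carrier (H M m)"
  unfolding join_def using hom_value_closed[OF scalar_N assms] hom_value_add[OF scalar_N assms]
    hom_value_smult[OF scalar_N assms]
  by (intro homI[OF sc]) simp_all

lemma join_value: "x \<in> carrier (Pm m) \<Longrightarrow> i \<in> B \<Longrightarrow> join B m F x i = F i x i0"
  by (simp add: join_def)

lemma coord_join:
  assumes F: "\<And>i. i \<in> B \<Longrightarrow> F i \<in> carrier (H N m)" and i: "i \<in> B"
  shows "coord m i (join B m F) = F i"
proof (rule hom_eqI[OF scalar_N])
  show "coord m i (join B m F) \<in> carrier (H N m)"
    by (rule left_hom_closed[OF coord_hom[OF i] join_closed[OF F]])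
qed (use F i in \<open>auto simp: coord_value join_value\<close>)

lemma join_cocycle:
  assumes "\<And>i. i \<in> B \<Longrightarrow> F i \<in> Z N m"
  shows "join B m F \<in> Z M m"
proof -
  have F: "F i \<in> carrier (H N m)" "\<And>x. x \<in> carrier (Pm (Suc m)) \<Longrightarrow> F i (d m x) = \<zero>\<^bsub>N\<^esub>" if "i \<in> B" for i
    using assms[OF that] by (simp_all add: cocycles_def)
  have "join B m F (d m x) = \<zero>\<^bsub>M\<^esub>" if x: "x \<in> carrier (Pm (Suc m))" for x
    using F(2)[OF _ x] d_closed[OF x]
    by (simp add: join_def scalar_moduleD(2)[OF sc] scalar_moduleD(2)[OF scalar_N] cong: restrict_cong)
  then show ?thesis
    using join_closed[OF F(1)] by (simp add: cocycles_def)
qed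

text \<open>
  Choose a bounding cochain for each coordinate and join them.
\<close>

lemma coboundary_if_coords:
  assumes f: "f \<in> carrier (H M m)" and co: "\<And>i. i \<in> B \<Longrightarrow> coord m i f \<in> C N m"
  shows "f \<in> C M m"
proof (cases m)
  case 0
  have "f = \<zero>\<^bsub>H M m\<^esub>"
  proof (rule hom_eqI[OF sc f hom_zero_closed[OF sc]])
    fix x i assume x: "x \<in> carrier (Pm m)" and i: "i \<in> B"
    have "f x i = coord m i f x i0"
      using coord_value[OF x] by simp
    also have "coord m i f = \<zero>\<^bsub>H N m\<^esub>"
      using co[OF i] by (simp add: 0)
    finally show "f x i = \<zero>\<^bsub>H M m\<^esub> x i"
      using x i by (simp add: hom_zero_value[OF sc] hom_zero_value[OF scalar_N])
  qed
  then show ?thesis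
    by (simp add: 0)
next
  case (Suc n)
  have "\<exists>h\<in>carrier (H N n). coord m i f = (\<lambda>x\<in>carrier (Pm (Suc n)). h (d n x))" if "i \<in> B" for i
    using co[OF that] Suc by auto
  then obtain h where h: "\<And>i. i \<in> B \<Longrightarrow> h i \<in> carrier (H N n)"
    and fh: "\<And>i. i \<in> B \<Longrightarrow> coord m i f = (\<lambda>x\<in>carrier (Pm (Suc n)). h i (d n x))"
    by metis
  let ?j = "join B n h"
  have j: "?j \<in> carrier (H M n)"
    by (rule join_closed[OF h])
  have "f = (\<lambda>x\<in>carrier (Pm (Suc n)). ?j (d n x))"
  proof (rule hom_eqI[OF sc f])
    show "(\<lambda>x\<in>carrier (Pm (Suc n)). ?j (d n x)) \<in> carrier (H M m)"
      unfolding Suc by (rule left_hom_closed[OF pullback_hom[OF sc d_hom] j])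
    fix x i assume x: "x \<in> carrier (Pm m)" and i: "i \<in> B"
    have "f x i = coord m i f x i0"
      using coord_value[OF x] by simp
    also have "\<dots> = (\<lambda>x\<in>carrier (Pm (Suc n)). ?j (d n x)) x i"
      unfolding fh[OF i, folded Suc] using x i d_closed by (simp add: Suc join_value)
    finally show "f x i = (\<lambda>x\<in>carrier (Pm (Suc n)). ?j (d n x)) x i" .
  qed
  then show ?thesis
    using j by (auto simp: Suc)
qed

lemma ext_coord_inj:
  assumes "A \<in> carrier (E M m)" "A' \<in> carrier (E M m)" "\<And>i. i \<in> B \<Longrightarrow> ext_coord m i A = ext_coord m i A'"
  shows "A = A'"
proof -
  interpret M: subquotient K "H M m" "Z M m" "C M m"
    by (rule ext_subquotient[OF sc])
  interpret N: subquotient K "H N m" "Z N m" "C N m"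
    by (rule ext_subquotient[OF scalar_N])
  obtain f where f: "f \<in> Z M m" "A = C M m +>\<^bsub>H M m\<^esub> f"
    using assms(1) unfolding ext_module_def by (rule M.coset_cases)
  obtain f' where f': "f' \<in> Z M m" "A' = C M m +>\<^bsub>H M m\<^esub> f'"
    using assms(2) unfolding ext_module_def by (rule M.coset_cases)
  have H: "f \<in> carrier (H M m)" "f' \<in> carrier (H M m)"
    using f f' M.num_closed by auto
  have "f \<ominus>\<^bsub>H M m\<^esub> f' \<in> C M m"
  proof (rule coboundary_if_coords)
    show "f \<ominus>\<^bsub>H M m\<^esub> f' \<in> carrier (H M m)"
      using H by simp
    fix i assume i: "i \<in> B"
    have c: "coord m i f \<in> carrier (H N m)" "coord m i f' \<in> carrier (H N m)"
      using H left_hom_closed[OF coord_hom[OF i]] by auto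
    have "C N m +>\<^bsub>H N m\<^esub> coord m i f = C N m +>\<^bsub>H N m\<^esub> coord m i f'"
      using assms(3)[OF i] ext_coord_coset[OF i] f f' by simp
    then have "coord m i f \<ominus>\<^bsub>H N m\<^esub> coord m i f' \<in> C N m"
      using N.coset_eq_iff[OF c] by simp
    then show "coord m i (f \<ominus>\<^bsub>H M m\<^esub> f') \<in> C N m"
      using left_hom_minus[OF coord_hom[OF i] M.M.abelian_group_axioms N.M.abelian_group_axioms H] by simp
  qed
  then show ?thesis
    using M.coset_eq_iff[OF H] f f' by simp
qed

lemma ext_coord_surj:
  assumes "\<And>i. i \<in> B \<Longrightarrow> w i \<in> carrier (E N m)"
  obtains A where "A \<in> carrier (E M m)" "\<And>i. i \<in> B \<Longrightarrow> ext_coord m i A = w i"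
proof -
  interpret M: subquotient K "H M m" "Z M m" "C M m"
    by (rule ext_subquotient[OF sc])
  interpret N: subquotient K "H N m" "Z N m" "C N m"
    by (rule ext_subquotient[OF scalar_N])
  have "\<exists>f\<in>Z N m. w i = C N m +>\<^bsub>H N m\<^esub> f" if "i \<in> B" for i
    using assms[OF that] by (auto simp: ext_module_def N.subquotient_sel(1))
  then obtain F where F: "\<And>i. i \<in> B \<Longrightarrow> F i \<in> Z N m" and w: "\<And>i. i \<in> B \<Longrightarrow> w i = C N m +>\<^bsub>H N m\<^esub> F i"
    by metis
  have j: "join B m F \<in> Z M m"
    by (rule join_cocycle[OF F])
  show thesis
  proof
    show "C M m +>\<^bsub>H M m\<^esub> join B m F \<in> carrier (E M m)"
      unfolding ext_module_def by (rule M.coset_closed[OF j])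
    show "ext_coord m i (C M m +>\<^bsub>H M m\<^esub> join B m F) = w i" if "i \<in> B" for i
      using ext_coord_coset[OF that j] coord_join[OF N.num_closed[OF F] that] w[OF that] by simp
  qed
qed

end


section \<open>The Yoneda product\<close>

text \<open>
  The chosen lift belongs to some representative of the class \<open>A\<close>. It depends on \<open>A\<close> and not on the
  coefficient module, so one chain map computes the products with \<open>A\<close> for all coefficients.
\<close>

lemma class_lift_chain_lift:
  assumes "A \<in> carrier (E N l)"
  obtains \<phi> where "\<phi> \<in> A" "chain_lift R P l \<phi> (class_lift R P l A)"
proof -
  interpret N: subquotient K "H N l" "Z N l" "C N l"
    by (rule ext_subquotient[OF scalar_N])
  obtain \<phi> where \<phi>: "\<phi> \<in> Z N l" "A = C N l +>\<^bsub>H N l\<^esub> \<phi>"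
    using assms unfolding ext_module_def by (rule N.coset_cases)
  have "\<phi> \<in> A"
    using N.coset_self[OF \<phi>(1)] \<phi>(2) by simp
  moreover have "\<exists>t. chain_lift R P l \<phi> t"
    using \<phi>(1) by (intro chain_lift_exists) (auto simp: cocycles_def hom_module_def)
  ultimately have "\<exists>t. \<exists>\<phi>\<in>A. chain_lift R P l \<phi> t"
    by blast
  then have "\<exists>\<phi>\<in>A. chain_lift R P l \<phi> (class_lift R P l A)"
    unfolding class_lift_def by (rule someI_ex)
  then show thesis
    using that by blast
qed

context
  fixes M :: "('d, 'b \<Rightarrow> 'k, 'u) module_scheme" and B :: "'b set"
  assumes sc: "scalar_module R K \<epsilon> B M"
begin

lemma precompose_lift_map:
  assumes "A \<in> carrier (E N l)"
  shows "subquotient_map K (H M m) (Z M m) (C M m) (H M (m + l)) (Z M (m + l)) (C M (m + l))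
    (precompose_lift m l A)"
proof -
  obtain \<phi> where t: "chain_lift R P l \<phi> (class_lift R P l A)"
    using class_lift_chain_lift[OF assms] by blast
  let ?t = "class_lift R P l A"
  have th: "?t n \<in> left_hom R (Pm (n + l)) (Pm n)" for n
    using chain_lift_hom[OF t, of n] by (simp add: add.commute)
  have hom: "precompose_lift m l A \<in> left_hom K (H M m) (H M (m + l))"
    unfolding precompose_lift_def by (rule pullback_hom[OF sc th])
  have "precompose_lift m l A f \<in> Z M (m + l)" if f: "f \<in> Z M m" for f
  proof -
    have "precompose_lift m l A f (d (m + l) x) = \<zero>\<^bsub>M\<^esub>" if x: "x \<in> carrier (Pm (Suc (m + l)))" for x
    proof -
      have "f (?t m (d (m + l) x)) = f (d m (?t (Suc m) x))"
        using chain_lift_commute[OF t, of x m] x by (simp add: add.commute)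
      also have "\<dots> = \<zero>\<^bsub>M\<^esub>"
        using f left_hom_closed[OF th, of x "Suc m"] x by (simp add: cocycles_def)
      finally show ?thesis
        using d_closed[OF x] by (simp add: precompose_lift_def)
    qed
    then show ?thesis
      using left_hom_closed[OF hom] f by (simp add: cocycles_def)
  qed
  moreover have "precompose_lift m l A f \<in> C M (m + l)" if f: "f \<in> C M m" for f
  proof (cases m)
    case 0
    interpret S: subquotient K "H M (m + l)" "Z M (m + l)" "C M (m + l)"
      by (rule ext_subquotient[OF sc])
    have "precompose_lift m l A f = \<zero>\<^bsub>H M (m + l)\<^esub>"
      using f left_hom_zero[OF hom module_abelian_group[OF hom_module_is_module[OF sc]] S.M.abelian_group_axioms]
      by (simp add: 0)
    then show ?thesis
      using S.N.zero_closed by simp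
  next
    case (Suc n)
    then obtain h where h: "h \<in> left_hom R (Pm n) M" "f = (\<lambda>x\<in>carrier (Pm (Suc n)). h (d n x))"
      using f by (auto simp: hom_module_def)
    have "precompose_lift m l A f = (\<lambda>x\<in>carrier (Pm (Suc (n + l))). h (?t n (d (n + l) x)))"
    proof -
      have "f (?t (Suc n) x) = h (?t n (d (n + l) x))" if x: "x \<in> carrier (Pm (Suc (n + l)))" for x
        using chain_lift_commute[OF t, of x n] left_hom_closed[OF th, of x "Suc n"] x
        by (simp add: h(2) add.commute)
      then show ?thesis
        by (simp add: precompose_lift_def Suc cong: restrict_cong)
    qed
    then show ?thesis
      using coboundary_SucI[OF left_hom_compose[OF th h(1)], where \<eta> = \<eta>] by (simp add: Suc)
  qed
  ultimately show ?thesis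
    using ext_subquotient[OF sc] hom by (intro subquotient_map.intro subquotient_map_axioms.intro)
qed

text \<open>
  Linearity in the left factor is immediate because the chain map depends on the right factor only.
\<close>

lemma yoneda_hom:
  assumes "A' \<in> carrier (E N l)"
  shows "(\<lambda>A. yoneda R \<eta> P M m l A A') \<in> left_hom K (E M m) (E M (m + l))"
  using subquotient_map.induced_hom[OF precompose_lift_map[OF assms]]
  by (simp add: yoneda_eq_induced ext_module_def)

lemma yoneda_zero_right:
  assumes "A \<in> carrier (E M m)"
  shows "yoneda R \<eta> P M m l A \<zero>\<^bsub>E N l\<^esub> = \<zero>\<^bsub>E M (m + l)\<^esub>"
proof -
  interpret Ml: subquotient K "H M (m + l)" "Z M (m + l)" "C M (m + l)"
    by (rule ext_subquotient[OF sc])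
  interpret M: subquotient K "H M m" "Z M m" "C M m"
    by (rule ext_subquotient[OF sc])
  interpret N: subquotient K "H N l" "Z N l" "C N l"
    by (rule ext_subquotient[OF scalar_N])
  interpret En: module K "E N l"
    by (rule ext_is_module[OF scalar_N])
  have zero: "\<zero>\<^bsub>E N l\<^esub> = C N l"
    unfolding ext_module_def by (rule N.subquotient_sel(2))
  obtain \<phi> where t: "\<phi> \<in> C N l" "chain_lift R P l \<phi> (class_lift R P l \<zero>\<^bsub>E N l\<^esub>)"
    using class_lift_chain_lift[OF En.M.zero_closed] unfolding zero by blast
  obtain f where f: "f \<in> Z M m" "A = C M m +>\<^bsub>H M m\<^esub> f"
    using assms unfolding ext_module_def by (rule M.coset_cases)
  have "precompose_lift m l \<zero>\<^bsub>E N l\<^esub> f \<in> C M (m + l)"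
  proof -
    have "f \<in> left_hom R (Pm m) M" "\<And>x. x \<in> carrier (Pm (Suc m)) \<Longrightarrow> f (d m x) = \<zero>\<^bsub>M\<^esub>"
      using f(1) by (simp_all add: cocycles_def hom_module_def)
    from compose_lift_of_coboundary[OF t(2,1) this group_M[OF sc]] show ?thesis
      unfolding precompose_lift_def by (simp add: add.commute)
  qed
  moreover have "yoneda R \<eta> P M m l A \<zero>\<^bsub>E N l\<^esub> = C M (m + l) +>\<^bsub>H M (m + l)\<^esub> precompose_lift m l \<zero>\<^bsub>E N l\<^esub> f"
    unfolding yoneda_eq_induced f(2)
    by (rule subquotient_map.induced_coset[OF precompose_lift_map[OF En.M.zero_closed] f(1)])
  ultimately show ?thesis
    using Ml.coset_den unfolding ext_module_def Ml.subquotient_sel(2) by simp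
qed

end

text \<open>
  Taking a coordinate is postcomposition and multiplying by a class is precomposition, with the same
  chain map on both sides.
\<close>

lemma ext_coord_yoneda:
  assumes sc: "scalar_module R K \<epsilon> B M"
    and "A \<in> carrier (E M m)" "A' \<in> carrier (E N l)" and i: "i \<in> B"
  shows "ext_coord (m + l) i (yoneda R \<eta> P M m l A A') = yoneda R \<eta> P N m l (ext_coord m i A) A'"
proof -
  interpret M: subquotient K "H M m" "Z M m" "C M m"
    by (rule ext_subquotient[OF sc])
  obtain f where f: "f \<in> Z M m" "A = C M m +>\<^bsub>H M m\<^esub> f"
    using assms(2) unfolding ext_module_def by (rule M.coset_cases)
  note map_M = precompose_lift_map[OF sc assms(3), of m]
  note map_N = precompose_lift_map[OF scalar_N assms(3), of m]
  have cf: "coord m i f \<in> Z N m"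
    by (rule coord_cocycle[OF sc i f(1)])
  have "ext_coord (m + l) i (yoneda R \<eta> P M m l A A')
      = C N (m + l) +>\<^bsub>H N (m + l)\<^esub> coord (m + l) i (precompose_lift m l A' f)"
    unfolding yoneda_eq_induced f(2) subquotient_map.induced_coset[OF map_M f(1)]
    by (rule ext_coord_coset[OF sc i subquotient_map.num_map[OF map_M f(1)]])
  moreover have "yoneda R \<eta> P N m l (ext_coord m i A) A'
      = C N (m + l) +>\<^bsub>H N (m + l)\<^esub> precompose_lift m l A' (coord m i f)"
    unfolding yoneda_eq_induced f(2) ext_coord_coset[OF sc i f(1)]
    by (rule subquotient_map.induced_coset[OF map_N cf])
  moreover have "coord (m + l) i (precompose_lift m l A' f) = precompose_lift m l A' (coord m i f)"
  proof -
    obtain \<phi> where t: "chain_lift R P l \<phi> (class_lift R P l A')"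
      using class_lift_chain_lift[OF assms(3)] by blast
    have "class_lift R P l A' m x \<in> carrier (Pm m)" if "x \<in> carrier (Pm (m + l))" for x
      using left_hom_closed[OF chain_lift_hom[OF t, of m], of x] that by (simp add: add.commute)
    then show ?thesis
      by (auto simp: coord_def precompose_lift_def fun_eq_iff)
  qed
  ultimately show ?thesis
    by simp
qed

end


section \<open>The total extension module\<close>

lemma direct_sum_module:
  assumes E: "\<And>m. module K (E m)"
    and carrier: "carrier S = {x. (\<forall>m. x m \<in> carrier (E m)) \<and> finite {m. x m \<noteq> \<zero>\<^bsub>E m\<^esub>}}"
    and zero: "\<zero>\<^bsub>S\<^esub> = (\<lambda>m. \<zero>\<^bsub>E m\<^esub>)"
    and add: "\<And>x y. x \<oplus>\<^bsub>S\<^esub> y = (\<lambda>m. x m \<oplus>\<^bsub>E m\<^esub> y m)"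
    and smult: "\<And>k x. k \<odot>\<^bsub>S\<^esub> x = (\<lambda>m. k \<odot>\<^bsub>E m\<^esub> x m)"
  shows "module K S"
proof -
  note K = module.axioms(1)[OF E] and G = module.axioms(2)[OF E]
  note E_simps = module.smult_closed[OF E] module.smult_l_distr[OF E] module.smult_r_distr[OF E]
    module.smult_assoc1[OF E] module.smult_one[OF E] module.smult_r_null[OF E]
    abelian_monoid.a_closed[OF abelian_group.axioms(1)[OF G]]
    abelian_monoid.l_zero[OF abelian_group.axioms(1)[OF G]]
    abelian_monoid.zero_closed[OF abelian_group.axioms(1)[OF G]]
    abelian_monoid.a_assoc[OF abelian_group.axioms(1)[OF G]]
    abelian_group.a_inv_closed[OF G] abelian_group.l_neg[OF G]
  have add_closed: "x \<oplus>\<^bsub>S\<^esub> y \<in> carrier S" if "x \<in> carrier S" "y \<in> carrier S" for x y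
  proof -
    have "{m. x m \<oplus>\<^bsub>E m\<^esub> y m \<noteq> \<zero>\<^bsub>E m\<^esub>} \<subseteq> {m. x m \<noteq> \<zero>\<^bsub>E m\<^esub>} \<union> {m. y m \<noteq> \<zero>\<^bsub>E m\<^esub>}"
      by (auto simp: E_simps)
    then show ?thesis
      using that by (auto simp: carrier add E_simps intro: finite_subset)
  qed
  have smult_closed: "k \<odot>\<^bsub>S\<^esub> x \<in> carrier S" if "k \<in> carrier K" "x \<in> carrier S" for k x
  proof -
    have "{m. k \<odot>\<^bsub>E m\<^esub> x m \<noteq> \<zero>\<^bsub>E m\<^esub>} \<subseteq> {m. x m \<noteq> \<zero>\<^bsub>E m\<^esub>}"
      using that(1) by (auto simp: E_simps)
    then show ?thesis
      using that by (auto simp: carrier smult E_simps intro: finite_subset)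
  qed
  have "abelian_group S"
  proof (rule abelian_groupI)
    fix x assume x: "x \<in> carrier S"
    have "{m. \<ominus>\<^bsub>E m\<^esub> x m \<noteq> \<zero>\<^bsub>E m\<^esub>} \<subseteq> {m. x m \<noteq> \<zero>\<^bsub>E m\<^esub>}"
      by (auto simp: minus_zero[OF G])
    then have "(\<lambda>m. \<ominus>\<^bsub>E m\<^esub> x m) \<in> carrier S"
      using x by (auto simp: carrier E_simps intro: finite_subset)
    moreover have "(\<lambda>m. \<ominus>\<^bsub>E m\<^esub> x m) \<oplus>\<^bsub>S\<^esub> x = \<zero>\<^bsub>S\<^esub>"
      using x by (simp add: carrier add zero E_simps)
    ultimately show "\<exists>y\<in>carrier S. y \<oplus>\<^bsub>S\<^esub> x = \<zero>\<^bsub>S\<^esub>"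
      by blast
    fix y assume y: "y \<in> carrier S"
    show "x \<oplus>\<^bsub>S\<^esub> y = y \<oplus>\<^bsub>S\<^esub> x"
      using x y abelian_monoid.a_comm[OF abelian_group.axioms(1)[OF G]] by (auto simp: carrier add fun_eq_iff)
  qed (auto simp: add_closed, auto simp: carrier zero add E_simps)
  then show ?thesis
    using K smult_closed
    by (intro moduleI) (auto simp: carrier add smult E_simps)
qed

context scalar_coefficients
begin

abbreviation Tot where "Tot M \<equiv> ext_total R \<eta> P M"

lemma ext_total_sel:
  "carrier (Tot M) = {x. (\<forall>m. x m \<in> carrier (E M m)) \<and> finite {m. x m \<noteq> \<zero>\<^bsub>E M m\<^esub>}}"
  "\<zero>\<^bsub>Tot M\<^esub> = (\<lambda>m. \<zero>\<^bsub>E M m\<^esub>)"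
  "x \<oplus>\<^bsub>Tot M\<^esub> y = (\<lambda>m. x m \<oplus>\<^bsub>E M m\<^esub> y m)"
  "k \<odot>\<^bsub>Tot M\<^esub> x = (\<lambda>m. k \<odot>\<^bsub>E M m\<^esub> x m)"
  "degree_part (Tot M) m = {x \<in> carrier (Tot M). \<forall>n. n \<noteq> m \<longrightarrow> x n = \<zero>\<^bsub>E M n\<^esub>}"
  "right_act (Tot M) x a = (\<lambda>n. \<Oplus>\<^bsub>E M n\<^esub>m\<in>{..n}. yoneda R \<eta> P M m (n - m) (x m) (a (n - m)))"
  by (simp_all add: ext_total_def Let_def)

lemma ext_totalD:
  assumes "x \<in> carrier (Tot M)"
  shows "x m \<in> carrier (E M m)" "finite {m. x m \<noteq> \<zero>\<^bsub>E M m\<^esub>}"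
  using assms unfolding ext_total_sel by blast+

definition total_coord where "total_coord i x = (\<lambda>m. ext_coord m i (x m))"

context
  fixes M :: "('d, 'b \<Rightarrow> 'k, 'u) module_scheme" and B :: "'b set"
  assumes sc: "scalar_module R K \<epsilon> B M"
begin

lemma ext_total_is_module: "module K (Tot M)"
  by (rule direct_sum_module[OF ext_is_module[OF sc] ext_total_sel(1-4)])

lemma ext_group: "abelian_group (E M m)"
  by (rule module_abelian_group[OF ext_is_module[OF sc]])

lemma degree_part_submodule: "submodule (degree_part (Tot M) m) K (Tot M)"
proof -
  interpret T: module K "Tot M"
    by (rule ext_total_is_module)
  have neg: "\<ominus>\<^bsub>Tot M\<^esub> x = (\<ominus>\<^bsub>K\<^esub> \<one>\<^bsub>K\<^esub>) \<odot>\<^bsub>Tot M\<^esub> x" if "x \<in> carrier (Tot M)" for x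
    using that by (simp add: T.smult_l_minus)
  have smult: "k \<odot>\<^bsub>Tot M\<^esub> x \<in> degree_part (Tot M) m" if "k \<in> carrier K" "x \<in> degree_part (Tot M) m" for k x
    using that T.smult_closed[of k x] module.smult_r_null[OF ext_is_module[OF sc]]
    unfolding ext_total_sel(5) by (simp add: ext_total_sel(4))
  show ?thesis
  proof (rule T.submoduleI)
    show "\<zero>\<^bsub>Tot M\<^esub> \<in> degree_part (Tot M) m"
      unfolding ext_total_sel(5) using T.M.zero_closed by (simp add: ext_total_sel(2))
    show "x \<oplus>\<^bsub>Tot M\<^esub> y \<in> degree_part (Tot M) m" if "x \<in> degree_part (Tot M) m" "y \<in> degree_part (Tot M) m" for x y
      using that T.M.a_closed[of x y] abelian_monoid.l_zero[OF abelian_group.axioms(1)[OF ext_group]]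
        abelian_monoid.zero_closed[OF abelian_group.axioms(1)[OF ext_group]]
      unfolding ext_total_sel(5) by (simp add: ext_total_sel(3))
    show "\<ominus>\<^bsub>Tot M\<^esub> x \<in> degree_part (Tot M) m" if "x \<in> degree_part (Tot M) m" for x
      using that smult[OF _ that] neg by (simp add: ext_total_sel(5))
  qed (use smult in \<open>auto simp: ext_total_sel(5)\<close>)
qed

lemma yoneda_closed:
  assumes "A \<in> carrier (E M m)" "A' \<in> carrier (E N l)"
  shows "yoneda R \<eta> P M m l A A' \<in> carrier (E M (m + l))"
  by (rule left_hom_closed[OF yoneda_hom[OF sc assms(2)] assms(1)])

lemma yoneda_zero_left:
  "A' \<in> carrier (E N l) \<Longrightarrow> yoneda R \<eta> P M m l \<zero>\<^bsub>E M m\<^esub> A' = \<zero>\<^bsub>E M (m + l)\<^esub>"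
  by (rule left_hom_zero[OF yoneda_hom[OF sc] ext_group ext_group])

lemma summand_closed:
  assumes "x \<in> carrier (Tot M)" "a \<in> carrier (Tot N)"
  shows "(\<lambda>m. yoneda R \<eta> P M m (n - m) (x m) (a (n - m))) \<in> {..n} \<rightarrow> carrier (E M n)"
proof
  fix m assume "m \<in> {..n}"
  then show "yoneda R \<eta> P M m (n - m) (x m) (a (n - m)) \<in> carrier (E M n)"
    using yoneda_closed[OF ext_totalD(1)[OF assms(1), of m] ext_totalD(1)[OF assms(2), of "n - m"]] by simp
qed

text \<open>
  A product can be nonzero only in degrees \<open>m + l\<close> where \<open>x\<close> is nonzero in degree \<open>m\<close> and \<open>a\<close> in
  degree \<open>l\<close>, and there are finitely many of these.
\<close>

lemma right_act_closed:
  assumes x: "x \<in> carrier (Tot M)" and a: "a \<in> carrier (Tot N)"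
  shows "right_act (Tot M) x a \<in> carrier (Tot M)"
proof -
  let ?S = "{m. x m \<noteq> \<zero>\<^bsub>E M m\<^esub>}" and ?T = "{l. a l \<noteq> \<zero>\<^bsub>E N l\<^esub>}"
  have "right_act (Tot M) x a n = \<zero>\<^bsub>E M n\<^esub>" if n: "n \<notin> (\<lambda>(m, l). m + l) ` (?S \<times> ?T)" for n
  proof -
    interpret En: abelian_group "E M n"
      by (rule ext_group)
    have "yoneda R \<eta> P M m (n - m) (x m) (a (n - m)) = \<zero>\<^bsub>E M n\<^esub>" if m: "m \<in> {..n}" for m
    proof -
      have "m \<notin> ?S \<or> n - m \<notin> ?T"
        using n m by (force simp: image_iff)
      then have "yoneda R \<eta> P M m (n - m) (x m) (a (n - m)) = \<zero>\<^bsub>E M (m + (n - m))\<^esub>"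
        using yoneda_zero_left[OF ext_totalD(1)[OF a]] yoneda_zero_right[OF sc ext_totalD(1)[OF x]] by auto
      then show ?thesis
        using m by simp
    qed
    then show ?thesis
      unfolding ext_total_sel by (intro En.add.finprod_one_eqI) auto
  qed
  then have "{n. right_act (Tot M) x a n \<noteq> \<zero>\<^bsub>E M n\<^esub>} \<subseteq> (\<lambda>(m, l). m + l) ` (?S \<times> ?T)"
    by blast
  moreover have "finite ((\<lambda>(m, l). m + l) ` (?S \<times> ?T))"
    using ext_totalD(2)[OF x] ext_totalD(2)[OF a] by simp
  moreover have "right_act (Tot M) x a n \<in> carrier (E M n)" for n
    unfolding ext_total_sel(6)
    by (rule abelian_monoid.finsum_closed[OF abelian_group.axioms(1)[OF ext_group] summand_closed[OF x a]])
  ultimately show ?thesis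
    unfolding ext_total_sel(1) by (blast intro: finite_subset)
qed

lemma right_act_hom:
  assumes a: "a \<in> carrier (Tot N)"
  shows "(\<lambda>x. right_act (Tot M) x a) \<in> left_hom K (Tot M) (Tot M)"
proof (rule left_homI)
  fix x assume x: "x \<in> carrier (Tot M)"
  show "right_act (Tot M) x a \<in> carrier (Tot M)"
    by (rule right_act_closed[OF x a])
  show "right_act (Tot M) (x \<oplus>\<^bsub>Tot M\<^esub> y) a = right_act (Tot M) x a \<oplus>\<^bsub>Tot M\<^esub> right_act (Tot M) y a"
    if y: "y \<in> carrier (Tot M)" for y
  proof
    fix n
    interpret En: abelian_group "E M n"
      by (rule ext_group)
    let ?y = "\<lambda>x m. yoneda R \<eta> P M m (n - m) (x m) (a (n - m))"
    have "?y (x \<oplus>\<^bsub>Tot M\<^esub> y) m = ?y x m \<oplus>\<^bsub>E M n\<^esub> ?y y m" if "m \<in> {..n}" for m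
      using left_hom_add[OF yoneda_hom[OF sc ext_totalD(1)[OF a]] ext_totalD(1)[OF x] ext_totalD(1)[OF y], of m "n - m"]
        that by (simp add: ext_total_sel(3))
    then have "(\<Oplus>\<^bsub>E M n\<^esub>m\<in>{..n}. ?y (x \<oplus>\<^bsub>Tot M\<^esub> y) m) = (\<Oplus>\<^bsub>E M n\<^esub>m\<in>{..n}. ?y x m \<oplus>\<^bsub>E M n\<^esub> ?y y m)"
      using funcset_mem[OF summand_closed[OF x a, of n]] funcset_mem[OF summand_closed[OF y a, of n]]
      by (intro En.add.finprod_cong') auto
    also have "\<dots> = (\<Oplus>\<^bsub>E M n\<^esub>m\<in>{..n}. ?y x m) \<oplus>\<^bsub>E M n\<^esub> (\<Oplus>\<^bsub>E M n\<^esub>m\<in>{..n}. ?y y m)"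
      using summand_closed[OF x a] summand_closed[OF y a] by (rule En.finsum_addf)
    finally show "right_act (Tot M) (x \<oplus>\<^bsub>Tot M\<^esub> y) a n = (right_act (Tot M) x a \<oplus>\<^bsub>Tot M\<^esub> right_act (Tot M) y a) n"
      unfolding ext_total_sel(3)[of M "right_act (Tot M) x a"] unfolding ext_total_sel(6) .
  qed
  show "right_act (Tot M) (k \<odot>\<^bsub>Tot M\<^esub> x) a = k \<odot>\<^bsub>Tot M\<^esub> right_act (Tot M) x a" if k: "k \<in> carrier K" for k
  proof
    fix n
    interpret En: module K "E M n"
      by (rule ext_is_module[OF sc])
    let ?y = "\<lambda>x m. yoneda R \<eta> P M m (n - m) (x m) (a (n - m))"
    have "?y (k \<odot>\<^bsub>Tot M\<^esub> x) m = k \<odot>\<^bsub>E M n\<^esub> ?y x m" if "m \<in> {..n}" for m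
      using left_hom_smult[OF yoneda_hom[OF sc ext_totalD(1)[OF a]] k ext_totalD(1)[OF x], of m "n - m"]
        that by (simp add: ext_total_sel(4))
    then have "(\<Oplus>\<^bsub>E M n\<^esub>m\<in>{..n}. ?y (k \<odot>\<^bsub>Tot M\<^esub> x) m) = (\<Oplus>\<^bsub>E M n\<^esub>m\<in>{..n}. k \<odot>\<^bsub>E M n\<^esub> ?y x m)"
      using funcset_mem[OF summand_closed[OF x a, of n]] k by (intro En.M.add.finprod_cong') auto
    also have "\<dots> = k \<odot>\<^bsub>E M n\<^esub> (\<Oplus>\<^bsub>E M n\<^esub>m\<in>{..n}. ?y x m)"
      using k summand_closed[OF x a] by (intro En.finsum_smult_ldistr[symmetric]) auto
    finally show "right_act (Tot M) (k \<odot>\<^bsub>Tot M\<^esub> x) a n = (k \<odot>\<^bsub>Tot M\<^esub> right_act (Tot M) x a) n"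
      unfolding ext_total_sel(4)[of M k "right_act (Tot M) x a"] unfolding ext_total_sel(6) .
  qed
qed

lemma total_coord_hom:
  assumes i: "i \<in> B"
  shows "total_coord i \<in> left_hom K (Tot M) (Tot N)"
proof (rule left_homI)
  note co = ext_coord_hom[OF sc i]
  fix x assume x: "x \<in> carrier (Tot M)"
  have "ext_coord m i \<zero>\<^bsub>E M m\<^esub> = \<zero>\<^bsub>E N m\<^esub>" for m
    by (rule left_hom_zero[OF co ext_group module_abelian_group[OF ext_is_module[OF scalar_N]]])
  then have "{m. total_coord i x m \<noteq> \<zero>\<^bsub>E N m\<^esub>} \<subseteq> {m. x m \<noteq> \<zero>\<^bsub>E M m\<^esub>}"
    by (auto simp: total_coord_def)
  then show "total_coord i x \<in> carrier (Tot N)"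
    using ext_totalD[OF x] left_hom_closed[OF co]
    by (auto simp: ext_total_sel(1) total_coord_def intro: finite_subset)
  show "total_coord i (x \<oplus>\<^bsub>Tot M\<^esub> y) = total_coord i x \<oplus>\<^bsub>Tot N\<^esub> total_coord i y" if y: "y \<in> carrier (Tot M)" for y
    using left_hom_add[OF co] ext_totalD(1)[OF x] ext_totalD(1)[OF y]
    by (simp add: ext_total_sel(3) total_coord_def)
  show "total_coord i (k \<odot>\<^bsub>Tot M\<^esub> x) = k \<odot>\<^bsub>Tot N\<^esub> total_coord i x" if k: "k \<in> carrier K" for k
    using left_hom_smult[OF co k] ext_totalD(1)[OF x]
    by (simp add: ext_total_sel(4) total_coord_def)
qed

lemma total_coord_inj:
  assumes "x \<in> carrier (Tot M)" "y \<in> carrier (Tot M)" "\<And>i. i \<in> B \<Longrightarrow> total_coord i x = total_coord i y"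
  shows "x = y"
proof
  fix m
  have "ext_coord m i (x m) = ext_coord m i (y m)" if "i \<in> B" for i
    using fun_cong[OF assms(3)[OF that], of m] by (simp add: total_coord_def)
  then show "x m = y m"
    by (rule ext_coord_inj[OF sc ext_totalD(1)[OF assms(1)] ext_totalD(1)[OF assms(2)]])
qed

text \<open>
  The preimage is found in each degree separately. It vanishes in every degree in which all the
  \<open>w i\<close> do: this gives its finite support, and also that the isomorphism respects degrees.
\<close>

lemma total_coord_surj:
  assumes B: "finite B" and w: "w \<in> B \<rightarrow> carrier (Tot N)"
  obtains x where "x \<in> carrier (Tot M)" "\<And>i. i \<in> B \<Longrightarrow> total_coord i x = w i"
    "\<And>m. (\<And>i. i \<in> B \<Longrightarrow> w i m = \<zero>\<^bsub>E N m\<^esub>) \<Longrightarrow> x m = \<zero>\<^bsub>E M m\<^esub>"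
proof -
  have "\<exists>A\<in>carrier (E M m). \<forall>i\<in>B. ext_coord m i A = w i m" for m
    using ext_coord_surj[OF sc, of "\<lambda>i. w i m" m] w ext_totalD(1)[of _ N m] by (metis PiE Pi_mem)
  then obtain x where x: "\<And>m. x m \<in> carrier (E M m)" "\<And>m i. i \<in> B \<Longrightarrow> ext_coord m i (x m) = w i m"
    by metis
  have zero: "x m = \<zero>\<^bsub>E M m\<^esub>" if "\<And>i. i \<in> B \<Longrightarrow> w i m = \<zero>\<^bsub>E N m\<^esub>" for m
  proof (rule ext_coord_inj[OF sc x(1)])
    show "\<zero>\<^bsub>E M m\<^esub> \<in> carrier (E M m)"
      by (rule abelian_monoid.zero_closed[OF abelian_group.axioms(1)[OF ext_group]])
    show "ext_coord m i (x m) = ext_coord m i \<zero>\<^bsub>E M m\<^esub>" if i: "i \<in> B" for i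
      using left_hom_zero[OF ext_coord_hom[OF sc i] ext_group module_abelian_group[OF ext_is_module[OF scalar_N]]]
        x(2)[OF i] \<open>\<And>i. i \<in> B \<Longrightarrow> w i m = \<zero>\<^bsub>E N m\<^esub>\<close>[OF i] by simp
  qed
  have "{m. x m \<noteq> \<zero>\<^bsub>E M m\<^esub>} \<subseteq> (\<Union>i\<in>B. {m. w i m \<noteq> \<zero>\<^bsub>E N m\<^esub>})"
    using zero by blast
  moreover have "finite (\<Union>i\<in>B. {m. w i m \<noteq> \<zero>\<^bsub>E N m\<^esub>})"
    using B w ext_totalD(2) by (intro finite_UN_I) auto
  ultimately have "x \<in> carrier (Tot M)"
    using x(1) finite_subset by (auto simp: ext_total_sel(1))
  then show thesis
    using that x(2) zero by (auto simp: total_coord_def)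
qed

lemma total_coord_right_act:
  assumes i: "i \<in> B" and x: "x \<in> carrier (Tot M)" and a: "a \<in> carrier (Tot N)"
  shows "total_coord i (right_act (Tot M) x a) = right_act (Tot N) (total_coord i x) a"
proof
  fix n
  interpret En: abelian_group "E N n"
    by (rule module_abelian_group[OF ext_is_module[OF scalar_N]])
  let ?y = "\<lambda>m. yoneda R \<eta> P M m (n - m) (x m) (a (n - m))"
  have eq: "ext_coord n i (?y m) = yoneda R \<eta> P N m (n - m) (total_coord i x m) (a (n - m))" if "m \<in> {..n}" for m
    using ext_coord_yoneda[OF sc ext_totalD(1)[OF x] ext_totalD(1)[OF a] i, of m "n - m"] that
    by (simp add: total_coord_def)
  have "total_coord i (right_act (Tot M) x a) n = ext_coord n i (\<Oplus>\<^bsub>E M n\<^esub>m\<in>{..n}. ?y m)"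
    by (simp add: total_coord_def ext_total_sel(6))
  also have "\<dots> = (\<Oplus>\<^bsub>E N n\<^esub>m\<in>{..n}. ext_coord n i (?y m))"
    using summand_closed[OF x a] En.abelian_group_axioms
    by (intro left_hom_finsum[OF ext_coord_hom[OF sc i] ext_group]) auto
  also have "\<dots> = right_act (Tot N) (total_coord i x) a n"
    unfolding ext_total_sel(6)
    using eq left_hom_closed[OF ext_coord_hom[OF sc i]] funcset_mem[OF summand_closed[OF x a, of n]]
    by (intro En.add.finprod_cong') (auto simp flip: eq)
  finally show "total_coord i (right_act (Tot M) x a) n = right_act (Tot N) (total_coord i x) a n" .
qed

end

end


section \<open>Extensions of scalar modules are tensor products\<close>

lemma tensor_graded_sel:
  "carrier (tensor_graded K V W) = carrier (tensor_module K V W)"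
  "add (tensor_graded K V W) = add (tensor_module K V W)"
  "smult (tensor_graded K V W) = smult (tensor_module K V W)"
  "degree_part (tensor_graded K V W) m = submodule_span K (tensor_module K V W)
     {pure_tensor K V W v w | v w. v \<in> carrier V \<and> w \<in> degree_part W m}"
  "right_act (tensor_graded K V W) t a = tensor_id_map K V W (\<lambda>w. right_act W w a) t"
  by (simp_all add: tensor_graded_def module.defs)

context scalar_coefficients
begin

definition aug_cocycle where "aug_cocycle = restrict aug (carrier (Pm 0))"

lemma aug_cocycle: "aug_cocycle \<in> Z N 0"
  using restrict_in_hom_module[OF aug_hom] d_closed aug_d by (simp add: aug_cocycle_def cocycles_def)

definition unit_point where
  "unit_point = (SOME p. p \<in> carrier (Pm 0) \<and> aug p = (\<lambda>j\<in>{i0}. \<one>\<^bsub>K\<^esub>))"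

lemma unit_point: "unit_point \<in> carrier (Pm 0)" "aug unit_point = (\<lambda>j\<in>{i0}. \<one>\<^bsub>K\<^esub>)"
proof -
  have "(\<lambda>j\<in>{i0}. \<one>\<^bsub>K\<^esub>) \<in> carrier N"
    by (simp add: scalar_moduleD(1)[OF scalar_N])
  then have "\<exists>p. p \<in> carrier (Pm 0) \<and> aug p = (\<lambda>j\<in>{i0}. \<one>\<^bsub>K\<^esub>)"
    unfolding aug_image[symmetric] by force
  from someI_ex[OF this] show "unit_point \<in> carrier (Pm 0)" "aug unit_point = (\<lambda>j\<in>{i0}. \<one>\<^bsub>K\<^esub>)"
    unfolding unit_point_def by blast+
qed

definition base_class where
  "base_class M B i = C M 0 +>\<^bsub>H M 0\<^esub> join B 0 (\<lambda>j. if j = i then aug_cocycle else \<zero>\<^bsub>H N 0\<^esub>)"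

text \<open>
  In degree \<open>0\<close> the only coboundary is zero, so a class has exactly one representative and the
  choice below is no choice.
\<close>

definition base_coord where "base_coord i A = (SOME f. f \<in> A) unit_point i"

context
  fixes M :: "('d, 'b \<Rightarrow> 'k, 'u) module_scheme" and B :: "'b set"
  assumes sc: "scalar_module R K \<epsilon> B M"
begin

lemma base_coord_coset:
  assumes f: "f \<in> Z M 0"
  shows "base_coord i (C M 0 +>\<^bsub>H M 0\<^esub> f) = f unit_point i"
proof -
  interpret S: subquotient K "H M 0" "Z M 0" "C M 0"
    by (rule ext_subquotient[OF sc])
  let ?f = "SOME f'. f' \<in> C M 0 +>\<^bsub>H M 0\<^esub> f"
  have mem: "?f \<in> C M 0 +>\<^bsub>H M 0\<^esub> f"
    using S.coset_self[OF f] by (rule someI[where P = "\<lambda>f'. f' \<in> C M 0 +>\<^bsub>H M 0\<^esub> f"])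
  have H: "f \<in> carrier (H M 0)" "?f \<in> carrier (H M 0)"
    using S.num_closed f S.coset_memD(1)[OF S.coset_closed[OF f] mem] by auto
  have "?f \<ominus>\<^bsub>H M 0\<^esub> f \<in> C M 0"
    using S.mem_coset_iff[OF H] mem by simp
  then have "?f = f"
    using minus_eq_zero_iff[OF S.M.abelian_group_axioms H(2,1)] by simp
  then show ?thesis
    by (simp add: base_coord_def)
qed

text \<open>
  A point \<open>x\<close> of the resolution differs by a boundary from the multiple of the unit point with
  the same augmentation, and a cocycle kills boundaries.
\<close>

lemma zero_cocycle_determined:
  assumes f: "f \<in> Z M 0" and x: "x \<in> carrier (Pm 0)" and i: "i \<in> B"
  shows "f x i = aug x i0 \<otimes>\<^bsub>K\<^esub> f unit_point i"
proof -
  have fH: "f \<in> carrier (H M 0)" and fd: "\<And>z. z \<in> carrier (Pm (Suc 0)) \<Longrightarrow> f (d 0 z) = \<zero>\<^bsub>M\<^esub>"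
    using f by (simp_all add: cocycles_def)
  have fhom: "f \<in> left_hom R (Pm 0) M"
    using fH by (simp add: hom_module_def)
  let ?k = "aug x i0"
  have augx: "aug x \<in> {i0} \<rightarrow>\<^sub>E carrier K"
    using left_hom_closed[OF aug_hom x] by (simp add: scalar_moduleD(1)[OF scalar_N])
  then have k: "?k \<in> carrier K"
    by auto
  \<comment> \<open>the multiple of the unit point with the same augmentation as \<open>x\<close>\<close>
  define y where "y = \<eta> ?k \<odot>\<^bsub>Pm 0\<^esub> unit_point"
  have y: "y \<in> carrier (Pm 0)"
    unfolding y_def by (intro P_closed(1) eta_closed k unit_point(1))
  have "aug y = \<eta> ?k \<odot>\<^bsub>N\<^esub> aug unit_point"
    unfolding y_def by (rule left_hom_smult[OF aug_hom eta_closed[OF k] unit_point(1)])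
  also have "\<dots> = (\<lambda>j\<in>{i0}. ?k \<otimes>\<^bsub>K\<^esub> aug unit_point j)"
    using scalar_moduleD(4)[OF scalar_N eta_closed[OF k] left_hom_closed[OF aug_hom unit_point(1)]]
    by (simp add: eps_eta[OF k])
  also have "\<dots> = aug x"
    using augx k by (auto simp: unit_point(2) fun_eq_iff PiE_iff extensional_def)
  finally have "aug (x \<ominus>\<^bsub>Pm 0\<^esub> y) = \<zero>\<^bsub>N\<^esub>"
    using left_hom_minus[OF aug_hom group_P target_group x y] left_hom_closed[OF aug_hom x]
    by (simp add: minus_eq_zero_iff[OF target_group])
  then have "x \<ominus>\<^bsub>Pm 0\<^esub> y \<in> d 0 ` carrier (Pm (Suc 0))"
    using abelian_group.minus_closed[OF group_P x y] by (simp add: exact_0)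
  then have "f (x \<ominus>\<^bsub>Pm 0\<^esub> y) = \<zero>\<^bsub>M\<^esub>"
    using fd by auto
  then have "f x = f y"
    using left_hom_minus[OF fhom group_P group_M[OF sc] x y] minus_eq_zero_iff[OF group_M[OF sc]]
      left_hom_closed[OF fhom] x y by simp
  then show ?thesis
    using hom_value_smult[OF sc fH eta_closed[OF k] unit_point(1) i] by (simp add: y_def eps_eta[OF k])
qed

lemma tensor_basis_ext:
  assumes B: "finite B"
  shows "tensor_basis K (E M 0) (Tot N) B (base_class M B) base_coord"
proof -
  interpret S: subquotient K "H M 0" "Z M 0" "C M 0"
    rewrites "subquotient_module (H M 0) (Z M 0) (C M 0) = E M 0"
    by (rule ext_subquotient[OF sc]) (simp add: ext_module_def)
  interpret SN: subquotient K "H N 0" "Z N 0" "C N 0"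
    by (rule ext_subquotient[OF scalar_N])
  let ?F = "\<lambda>i j. if j = i then aug_cocycle else \<zero>\<^bsub>H N 0\<^esub>"
  have j: "join B 0 (?F i) \<in> Z M 0" for i
    using aug_cocycle SN.zero_in_num by (intro join_cocycle[OF sc]) auto
  show ?thesis
    unfolding tensor_basis_def tensor_pair_def tensor_basis_axioms_def
  proof (intro conjI allI impI)
    show "module K (E M 0)"
      by (rule ext_is_module[OF sc])
    show "module K (Tot N)"
      by (rule ext_total_is_module[OF scalar_N])
    show "finite B"
      by (rule B)
    show "base_class M B i \<in> carrier (E M 0)" for i
      unfolding base_class_def by (rule S.coset_closed[OF j])
    fix i assume i: "i \<in> B"
    show "base_coord i (base_class M B j) = indic K (i = j)" if "j \<in> B" for j
      unfolding base_class_def base_coord_coset[OF j]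
      using i unit_point by (simp add: join_value[OF sc] aug_cocycle_def indic_def hom_zero_value[OF scalar_N])
    fix A assume "A \<in> carrier (E M 0)"
    then obtain f where f: "f \<in> Z M 0" "A = C M 0 +>\<^bsub>H M 0\<^esub> f"
      by (rule S.coset_cases)
    show "base_coord i A \<in> carrier K"
      using f base_coord_coset hom_value_closed[OF sc S.num_closed[OF f(1)] unit_point(1) i] by simp
    show "base_coord i (k \<odot>\<^bsub>E M 0\<^esub> A) = k \<otimes>\<^bsub>K\<^esub> base_coord i A" if k: "k \<in> carrier K" for k
      unfolding f(2) S.coset_smult[OF k f(1), symmetric] base_coord_coset[OF f(1)]
        base_coord_coset[OF S.submoduleE(4)[OF S.num k f(1)]]
      by (rule hom_smult_value[OF sc k S.num_closed[OF f(1)] unit_point(1) i])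
    fix A' assume "A' \<in> carrier (E M 0)"
    then obtain f' where f': "f' \<in> Z M 0" "A' = C M 0 +>\<^bsub>H M 0\<^esub> f'"
      by (rule S.coset_cases)
    show "base_coord i (A \<oplus>\<^bsub>E M 0\<^esub> A') = base_coord i A \<oplus>\<^bsub>K\<^esub> base_coord i A'"
      unfolding f(2) f'(2) S.coset_add[OF f(1) f'(1), symmetric] base_coord_coset[OF f(1)]
        base_coord_coset[OF f'(1)] base_coord_coset[OF S.submoduleE(5)[OF S.num f(1) f'(1)]]
      by (rule hom_add_value[OF sc S.num_closed[OF f(1)] S.num_closed[OF f'(1)] unit_point(1) i])
  next
    fix A A' assume A: "A \<in> carrier (E M 0)" "A' \<in> carrier (E M 0)"
      and eq: "\<forall>i. i \<in> B \<longrightarrow> base_coord i A = base_coord i A'"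
    obtain f where f: "f \<in> Z M 0" "A = C M 0 +>\<^bsub>H M 0\<^esub> f"
      using A(1) by (rule S.coset_cases)
    obtain f' where f': "f' \<in> Z M 0" "A' = C M 0 +>\<^bsub>H M 0\<^esub> f'"
      using A(2) by (rule S.coset_cases)
    have "f = f'"
    proof (rule hom_eqI[OF sc S.num_closed[OF f(1)] S.num_closed[OF f'(1)]])
      fix x i assume x: "x \<in> carrier (Pm 0)" and i: "i \<in> B"
      have "f unit_point i = f' unit_point i"
        using eq i base_coord_coset f f' by auto
      then show "f x i = f' x i"
        using zero_cocycle_determined[OF f(1) x i] zero_cocycle_determined[OF f'(1) x i] by simp
    qed
    then show "A = A'"
      using f f' by simp
  qed
qed

text \<open>
  The isomorphism sends \<open>x\<close> to the sum of the \<open>e\<^sub>i \<otimes> x\<^sub>i\<close>. Both \<open>x \<mapsto> (x\<^sub>i)\<^sub>i\<close> and \<open>combine\<close> are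
  bijections that respect degrees and the right action, which is why their composite does.
\<close>

theorem ext_total_isomorphic_tensor:
  assumes B: "finite B" and A: "carrier A = carrier (Tot N)"
  shows "graded_right_module_isomorphic K A (Tot M) (tensor_graded K (E M 0) (Tot N))"
proof -
  interpret T: tensor_basis K "E M 0" "Tot N" B "base_class M B" base_coord
    by (rule tensor_basis_ext[OF B])
  define \<theta> where "\<theta> x = T.combine (\<lambda>i. total_coord i x)" for x
  have co: "(\<lambda>i. total_coord i x) \<in> B \<rightarrow> carrier (Tot N)" if "x \<in> carrier (Tot M)" for x
    using left_hom_closed[OF total_coord_hom[OF sc] that] by auto
  have hom: "\<theta> \<in> left_hom K (Tot M) T.VW"
  proof (rule left_homI)
    fix x assume x: "x \<in> carrier (Tot M)"
    show "\<theta> x \<in> carrier T.VW"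
      unfolding \<theta>_def by (rule T.combine_closed[OF co[OF x]])
    show "\<theta> (x \<oplus>\<^bsub>Tot M\<^esub> y) = \<theta> x \<oplus>\<^bsub>T.VW\<^esub> \<theta> y" if y: "y \<in> carrier (Tot M)" for y
      unfolding \<theta>_def T.combine_add[OF co[OF x] co[OF y], symmetric]
      using left_hom_add[OF total_coord_hom[OF sc] x y] co[OF x] co[OF y]
      by (intro T.combine_cong) (auto intro!: T.W.M.a_closed)
    show "\<theta> (k \<odot>\<^bsub>Tot M\<^esub> x) = k \<odot>\<^bsub>T.VW\<^esub> \<theta> x" if k: "k \<in> carrier K" for k
      unfolding \<theta>_def T.combine_smult[OF k co[OF x], symmetric]
      using left_hom_smult[OF total_coord_hom[OF sc] k x] co[OF x] k
      by (intro T.combine_cong) auto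
  qed
  have "inj_on \<theta> (carrier (Tot M))"
  proof (rule inj_onI)
    fix x y assume x: "x \<in> carrier (Tot M)" and y: "y \<in> carrier (Tot M)" and "\<theta> x = \<theta> y"
    then show "x = y"
      unfolding \<theta>_def using T.combine_inj[OF co[OF x] co[OF y]] by (intro total_coord_inj[OF sc x y]) auto
  qed
  moreover have image: "\<exists>x\<in>carrier (Tot M). \<theta> x = T.combine w \<and>
      (\<forall>m. (\<forall>i\<in>B. w i m = \<zero>\<^bsub>E N m\<^esub>) \<longrightarrow> x m = \<zero>\<^bsub>E M m\<^esub>)"
    if w: "w \<in> B \<rightarrow> carrier (Tot N)" for w
  proof -
    obtain x where x: "x \<in> carrier (Tot M)" "\<And>i. i \<in> B \<Longrightarrow> total_coord i x = w i"
      "\<And>m. (\<And>i. i \<in> B \<Longrightarrow> w i m = \<zero>\<^bsub>E N m\<^esub>) \<Longrightarrow> x m = \<zero>\<^bsub>E M m\<^esub>"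
    proof (rule total_coord_surj[OF sc B w])
      fix x
      assume "x \<in> carrier (Tot M)" "\<And>i. i \<in> B \<Longrightarrow> total_coord i x = w i"
        "\<And>m. (\<And>i. i \<in> B \<Longrightarrow> w i m = \<zero>\<^bsub>E N m\<^esub>) \<Longrightarrow> x m = \<zero>\<^bsub>E M m\<^esub>"
      then show thesis
        by (rule that)
    qed
    have "\<theta> x = T.combine w"
      unfolding \<theta>_def by (rule T.combine_cong[OF x(2) w])
    then show ?thesis
      using x(1,3) by (intro bexI[OF _ x(1)] conjI allI impI) simp_all
  qed
  moreover have "\<theta> ` carrier (Tot M) = carrier T.VW"
  proof
    show "\<theta> ` carrier (Tot M) \<subseteq> carrier T.VW"
      using left_hom_closed[OF hom] by auto
    show "carrier T.VW \<subseteq> \<theta> ` carrier (Tot M)"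
    proof
      fix t assume "t \<in> carrier T.VW"
      then obtain w where w: "w \<in> B \<rightarrow> carrier (Tot N)" "t = T.combine w"
        using T.combine_surj by blast
      obtain x where "x \<in> carrier (Tot M)" "\<theta> x = t"
        using image[OF w(1)] unfolding w(2) by (elim bexE conjE)
      then show "t \<in> \<theta> ` carrier (Tot M)"
        by blast
    qed
  qed
  ultimately have bij: "bij_betw \<theta> (carrier (Tot M)) (carrier T.VW)"
    by (simp add: bij_betw_def)
  have degree: "\<theta> ` degree_part (Tot M) m = submodule_span K T.VW
     {T.pure v w | v w. v \<in> carrier (E M 0) \<and> w \<in> degree_part (Tot N) m}" for m
    unfolding T.span_pure_eq_combine_image[OF degree_part_submodule[OF scalar_N]]
  proof
    show "\<theta> ` degree_part (Tot M) m \<subseteq> T.combine ` (B \<rightarrow> degree_part (Tot N) m)"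
    proof (rule image_subsetI)
      fix x assume "x \<in> degree_part (Tot M) m"
      then have x: "x \<in> carrier (Tot M)" and zero: "\<And>n. n \<noteq> m \<Longrightarrow> x n = \<zero>\<^bsub>E M n\<^esub>"
        by (auto simp: ext_total_sel(5))
      have "total_coord i x n = \<zero>\<^bsub>E N n\<^esub>" if "i \<in> B" "n \<noteq> m" for i n
        using left_hom_zero[OF ext_coord_hom[OF sc that(1)] ext_group[OF sc] ext_group[OF scalar_N]] zero[OF that(2)]
        by (simp add: total_coord_def)
      then have "(\<lambda>i. total_coord i x) \<in> B \<rightarrow> degree_part (Tot N) m"
        using co[OF x] by (auto simp: ext_total_sel(5))
      then show "\<theta> x \<in> T.combine ` (B \<rightarrow> degree_part (Tot N) m)"
        unfolding \<theta>_def by (rule imageI)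
    qed
    show "T.combine ` (B \<rightarrow> degree_part (Tot N) m) \<subseteq> \<theta> ` degree_part (Tot M) m"
    proof (rule image_subsetI)
      fix w assume w: "w \<in> B \<rightarrow> degree_part (Tot N) m"
      then have w': "w \<in> B \<rightarrow> carrier (Tot N)"
        and zero: "\<And>n. n \<noteq> m \<Longrightarrow> \<forall>i\<in>B. w i n = \<zero>\<^bsub>E N n\<^esub>"
        by (auto simp: ext_total_sel(5))
      obtain x where x: "x \<in> carrier (Tot M)" "\<theta> x = T.combine w"
        "\<forall>n. (\<forall>i\<in>B. w i n = \<zero>\<^bsub>E N n\<^esub>) \<longrightarrow> x n = \<zero>\<^bsub>E M n\<^esub>"
        using image[OF w'] by (elim bexE conjE)
      then have "x \<in> degree_part (Tot M) m" "T.combine w = \<theta> x"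
        using zero by (simp_all add: ext_total_sel(5))
      then show "T.combine w \<in> \<theta> ` degree_part (Tot M) m"
        by blast
    qed
  qed
  have act: "\<theta> (right_act (Tot M) x a) = tensor_id_map K (E M 0) (Tot N) (\<lambda>w. right_act (Tot N) w a) (\<theta> x)"
    if x: "x \<in> carrier (Tot M)" and a: "a \<in> carrier (Tot N)" for x a
  proof -
    have r: "(\<lambda>w. right_act (Tot N) w a) \<in> left_hom K (Tot N) (Tot N)"
      by (rule right_act_hom[OF scalar_N a])
    have "\<theta> (right_act (Tot M) x a) = T.combine (\<lambda>i. right_act (Tot N) (total_coord i x) a)"
      unfolding \<theta>_def using total_coord_right_act[OF sc _ x a] co[OF x] left_hom_closed[OF r]
      by (intro T.combine_cong) auto
    then show ?thesis
      unfolding \<theta>_def T.combine_tensor_id_map[OF r co[OF x]] .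
  qed
  show ?thesis
    unfolding graded_right_module_isomorphic_def
  proof (intro exI[of _ \<theta>] conjI allI ballI)
    show "\<theta> \<in> left_hom K (Tot M) (tensor_graded K (E M 0) (Tot N))"
      using hom by (simp add: left_hom_def tensor_graded_sel)
  qed (use bij degree act in \<open>simp_all add: tensor_graded_sel A\<close>)
qed

end

end


section \<open>The double of an abelian group\<close>

lemma coadjoint_abelian:
  assumes "comm_group G" "x \<in> carrier G \<times> carrier G" "k \<in> carrier G"
  shows "coadjoint G K (h, k) x y = indic K (h = \<one>\<^bsub>G\<^esub> \<and> x = y)"
proof -
  interpret G: comm_group G by fact
  obtain a b where x: "x = (a, b)" "a \<in> carrier G" "b \<in> carrier G"
    using assms(2) by auto
  have conj: "k \<otimes>\<^bsub>G\<^esub> c \<otimes>\<^bsub>G\<^esub> inv\<^bsub>G\<^esub> k = c" if "c \<in> carrier G" for c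
  proof -
    have "k \<otimes>\<^bsub>G\<^esub> c \<otimes>\<^bsub>G\<^esub> inv\<^bsub>G\<^esub> k = c \<otimes>\<^bsub>G\<^esub> k \<otimes>\<^bsub>G\<^esub> inv\<^bsub>G\<^esub> k"
      using that assms(3) by (simp add: G.m_comm)
    also have "\<dots> = c"
      using that assms(3) by (simp add: G.m_assoc)
    finally show ?thesis .
  qed
  have "inv\<^bsub>G\<^esub> b \<otimes>\<^bsub>G\<^esub> a \<otimes>\<^bsub>G\<^esub> b \<otimes>\<^bsub>G\<^esub> inv\<^bsub>G\<^esub> a = \<one>\<^bsub>G\<^esub>"
  proof -
    have "inv\<^bsub>G\<^esub> b \<otimes>\<^bsub>G\<^esub> a \<otimes>\<^bsub>G\<^esub> b = a \<otimes>\<^bsub>G\<^esub> (inv\<^bsub>G\<^esub> b \<otimes>\<^bsub>G\<^esub> b)"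
      using x by (simp add: G.m_comm[of "inv\<^bsub>G\<^esub> b" a] G.m_assoc del: G.l_inv)
    then have "inv\<^bsub>G\<^esub> b \<otimes>\<^bsub>G\<^esub> a \<otimes>\<^bsub>G\<^esub> b = a"
      using x by simp
    then show ?thesis
      using x by simp
  qed
  then show ?thesis
    using x by (simp add: coadjoint_def conj eq_commute[of y])
qed

text \<open>
  In the coproduct \<open>\<Sum>\<^sub>c (\<delta>\<^sub>c \<otimes> k) \<otimes> (\<delta>\<^bsub>a inv(c)\<^esub> \<otimes> k)\<close> only the term \<open>c = e\<close> survives the action on the
  first factor.
\<close>

lemma tensor_coeff_abelian:
  assumes "comm_group G" "finite (carrier G)" "cring K"
    and "set w \<subseteq> carrier G \<times> carrier G" "a \<in> carrier G" "k \<in> carrier G"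
  shows "tensor_coeff G K (coadjoint G K) (a, k) w w' = indic K (a = \<one>\<^bsub>G\<^esub> \<and> w = w')"
  using assms(4,5)
proof (induction w arbitrary: a w')
  case Nil
  then show ?case
    by (cases w') (simp_all add: double_counit_def indic_def)
next
  case (Cons x w)
  interpret G: comm_group G by fact
  interpret K: cring K by fact
  show ?case
  proof (cases w')
    case Nil
    then show ?thesis
      by (simp add: indic_def)
  next
    case (Cons y v)
    have x: "x \<in> carrier G \<times> carrier G"
      using Cons.prems by auto
    have "tensor_coeff G K (coadjoint G K) (a, k) (x # w) (y # v) =
      (\<Oplus>\<^bsub>K\<^esub>c\<in>carrier G. if \<one>\<^bsub>G\<^esub> = c then indic K (a = \<one>\<^bsub>G\<^esub> \<and> x # w = y # v) else \<zero>\<^bsub>K\<^esub>)"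
      unfolding tensor_coeff.simps
    proof (rule K.add.finprod_cong')
      fix c assume c: "c \<in> carrier G"
      have "tensor_coeff G K (coadjoint G K) (a \<otimes>\<^bsub>G\<^esub> inv\<^bsub>G\<^esub> c, k) w v
        = indic K (a \<otimes>\<^bsub>G\<^esub> inv\<^bsub>G\<^esub> c = \<one>\<^bsub>G\<^esub> \<and> w = v)"
        using Cons.prems c by (intro Cons.IH) auto
      then show "coadjoint G K (c, k) x y \<otimes>\<^bsub>K\<^esub> tensor_coeff G K (coadjoint G K) (a \<otimes>\<^bsub>G\<^esub> inv\<^bsub>G\<^esub> c, k) w v
        = (if \<one>\<^bsub>G\<^esub> = c then indic K (a = \<one>\<^bsub>G\<^esub> \<and> x # w = y # v) else \<zero>\<^bsub>K\<^esub>)"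
        using Cons.prems(2) c by (auto simp: coadjoint_abelian[OF assms(1) x assms(6)] indic_def)
    qed (auto simp: indic_def)
    also have "\<dots> = indic K (a = \<one>\<^bsub>G\<^esub> \<and> x # w = y # v)"
      by (rule K.add.finprod_singleton[OF G.one_closed assms(2)]) (simp add: indic_def)
    finally show ?thesis
      by (simp add: Cons)
  qed
qed

text \<open>
  The counit, extended linearly from its values \<open>double_counit\<close> on the basis.
\<close>

definition counit_value :: "('a, 'y) monoid_scheme \<Rightarrow> ('k, 'x) ring_scheme \<Rightarrow> ('a \<times> 'a \<Rightarrow> 'k) \<Rightarrow> 'k"
  where "counit_value G K f = (\<Oplus>\<^bsub>K\<^esub>z\<in>carrier G \<times> carrier G. f z \<otimes>\<^bsub>K\<^esub> double_counit G K z)"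

lemma drinfeld_double_carrier: "carrier (drinfeld_double G K) = carrier G \<times> carrier G \<rightarrow>\<^sub>E carrier K"
  by (simp add: drinfeld_double_def Let_def)

lemma double_unit_eq:
  assumes "cring K" "k \<in> carrier K"
  shows "double_unit G K k = (\<lambda>z\<in>carrier G \<times> carrier G. k \<otimes>\<^bsub>K\<^esub> indic K (snd z = \<one>\<^bsub>G\<^esub>))"
  by (auto simp: double_unit_def drinfeld_double_def Let_def fun_eq_iff)

text \<open>
  By \<open>tensor_coeff_abelian\<close> the matrix of the action of each basis element is its counit times the
  identity.
\<close>

lemma L_power_scalar:
  assumes "comm_group G" "finite (carrier G)" "cring K"
  shows "scalar_module (drinfeld_double G K) K (counit_value G K)
    {w. set w \<subseteq> carrier G \<times> carrier G \<and> length w = g} (L_power G K g)"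
proof -
  interpret G: comm_group G by fact
  interpret K: cring K by fact
  let ?B = "{w. set w \<subseteq> carrier G \<times> carrier G \<and> length w = g}" and ?GG = "carrier G \<times> carrier G"
  let ?t = "tensor_coeff G K (coadjoint G K)"
  have finGG: "finite ?GG"
    using assms(2) by simp
  have finB: "finite ?B"
    by (rule finite_lists_length_eq[OF finGG])
  have counit: "double_counit G K z \<in> carrier K" for z
    by (simp add: double_counit_def indic_def)
  have act: "(\<Oplus>\<^bsub>K\<^esub>z\<in>?GG. \<Oplus>\<^bsub>K\<^esub>x\<in>?B. r z \<otimes>\<^bsub>K\<^esub> f x \<otimes>\<^bsub>K\<^esub> ?t z x y) = counit_value G K r \<otimes>\<^bsub>K\<^esub> f y"
    if r: "r \<in> ?GG \<rightarrow>\<^sub>E carrier K" and f: "f \<in> ?B \<rightarrow>\<^sub>E carrier K" and y: "y \<in> ?B" for r f y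
  proof -
    have fy: "f y \<in> carrier K"
      using f y by (rule PiE_mem)
    have inner: "(\<Oplus>\<^bsub>K\<^esub>x\<in>?B. r z \<otimes>\<^bsub>K\<^esub> f x \<otimes>\<^bsub>K\<^esub> ?t z x y) = r z \<otimes>\<^bsub>K\<^esub> double_counit G K z \<otimes>\<^bsub>K\<^esub> f y"
      if z: "z \<in> ?GG" for z
    proof -
      have rz: "r z \<in> carrier K"
        using r z by (rule PiE_mem)
      have "(\<Oplus>\<^bsub>K\<^esub>x\<in>?B. r z \<otimes>\<^bsub>K\<^esub> f x \<otimes>\<^bsub>K\<^esub> ?t z x y)
        = (\<Oplus>\<^bsub>K\<^esub>x\<in>?B. if y = x then r z \<otimes>\<^bsub>K\<^esub> f x \<otimes>\<^bsub>K\<^esub> double_counit G K z else \<zero>\<^bsub>K\<^esub>)"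
      proof (rule K.add.finprod_cong')
        show "(\<lambda>x. if y = x then r z \<otimes>\<^bsub>K\<^esub> f x \<otimes>\<^bsub>K\<^esub> double_counit G K z else \<zero>\<^bsub>K\<^esub>) \<in> ?B \<rightarrow> carrier K"
          using K.m_closed[OF K.m_closed[OF rz fy] counit[of z]] by (intro Pi_I) auto
        fix x assume x: "x \<in> ?B"
        have fx: "f x \<in> carrier K"
          using f x by (rule PiE_mem)
        have "?t z x y = indic K (fst z = \<one>\<^bsub>G\<^esub> \<and> x = y)"
          using tensor_coeff_abelian[OF assms, of x "fst z" "snd z" y] x z by (simp add: mem_Times_iff)
        then show "r z \<otimes>\<^bsub>K\<^esub> f x \<otimes>\<^bsub>K\<^esub> ?t z x y = (if y = x then r z \<otimes>\<^bsub>K\<^esub> f x \<otimes>\<^bsub>K\<^esub> double_counit G K z else \<zero>\<^bsub>K\<^esub>)"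
          using rz fx by (cases "x = y") (simp_all add: double_counit_def indic_def)
      qed simp
      also have "\<dots> = r z \<otimes>\<^bsub>K\<^esub> f y \<otimes>\<^bsub>K\<^esub> double_counit G K z"
      proof (rule K.add.finprod_singleton[OF y finB])
        show "(\<lambda>x. r z \<otimes>\<^bsub>K\<^esub> f x \<otimes>\<^bsub>K\<^esub> double_counit G K z) \<in> ?B \<rightarrow> carrier K"
          using rz PiE_mem[OF f] counit by (intro Pi_I K.m_closed)
      qed
      also have "\<dots> = r z \<otimes>\<^bsub>K\<^esub> double_counit G K z \<otimes>\<^bsub>K\<^esub> f y"
        using rz fy counit[of z] by (simp add: K.m_ac)
      finally show ?thesis .
    qed
    have "(\<Oplus>\<^bsub>K\<^esub>z\<in>?GG. \<Oplus>\<^bsub>K\<^esub>x\<in>?B. r z \<otimes>\<^bsub>K\<^esub> f x \<otimes>\<^bsub>K\<^esub> ?t z x y)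
      = (\<Oplus>\<^bsub>K\<^esub>z\<in>?GG. r z \<otimes>\<^bsub>K\<^esub> double_counit G K z \<otimes>\<^bsub>K\<^esub> f y)"
    proof (rule K.add.finprod_cong')
      show "(\<lambda>z. r z \<otimes>\<^bsub>K\<^esub> double_counit G K z \<otimes>\<^bsub>K\<^esub> f y) \<in> ?GG \<rightarrow> carrier K"
        using PiE_mem[OF r] fy counit by (intro Pi_I K.m_closed)
    qed (use inner in simp_all)
    also have "\<dots> = counit_value G K r \<otimes>\<^bsub>K\<^esub> f y"
      unfolding counit_value_def
    proof (rule K.finsum_ldistr[symmetric, OF finGG fy])
      show "(\<lambda>z. r z \<otimes>\<^bsub>K\<^esub> double_counit G K z) \<in> ?GG \<rightarrow> carrier K"
        using PiE_mem[OF r] counit by (intro Pi_I K.m_closed)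
    qed
    finally show ?thesis .
  qed
  then show ?thesis
    unfolding scalar_module_def L_power_def based_module_def drinfeld_double_carrier
    by (simp add: restrict_def fun_eq_iff)
qed

lemma counit_value_closed:
  assumes "cring K" "r \<in> carrier (drinfeld_double G K)"
  shows "counit_value G K r \<in> carrier K"
proof -
  interpret K: cring K by fact
  show ?thesis
    unfolding counit_value_def using assms(2) unfolding drinfeld_double_carrier
    by (intro K.finsum_closed) (auto simp: double_counit_def indic_def PiE_iff)
qed

lemma double_unit_closed:
  assumes "cring K" "k \<in> carrier K"
  shows "double_unit G K k \<in> carrier (drinfeld_double G K)"
proof -
  interpret K: cring K by fact
  show ?thesis
    unfolding drinfeld_double_carrier double_unit_eq[OF assms] using assms(2) by (auto simp: indic_def)
qed

lemma counit_value_double_unit: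
  assumes "group G" "finite (carrier G)" "cring K" "k \<in> carrier K"
  shows "counit_value G K (double_unit G K k) = k"
proof -
  interpret G: group G by fact
  interpret K: cring K by fact
  have "counit_value G K (double_unit G K k)
    = (\<Oplus>\<^bsub>K\<^esub>z\<in>carrier G \<times> carrier G. if (\<one>\<^bsub>G\<^esub>, \<one>\<^bsub>G\<^esub>) = z then k else \<zero>\<^bsub>K\<^esub>)"
    unfolding counit_value_def double_unit_eq[OF assms(3,4)] using assms(4)
    by (intro K.add.finprod_cong') (auto simp: double_counit_def indic_def)
  also have "\<dots> = k"
    using assms(2,4) by (intro K.add.finprod_singleton) auto
  finally show ?thesis .
qed


theorem proposition6p4:
  fixes K :: "('k, 'x) ring_scheme"
    and G :: "('a, 'y) monoid_scheme"
    and P :: "('a \<times> 'a \<Rightarrow> 'k, 'p, ('a \<times> 'a) list \<Rightarrow> 'k) resolution"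
    and g :: nat
  assumes "algebraically_closed K"
    and "comm_group G" and "finite (carrier G)"
    and "projective_resolution (drinfeld_double G K) (trivial_module G K) P"
  shows "graded_right_module_isomorphic K (state_algebra G K P)
    (state_space_total G K P g)
    (tensor_graded K (state_space G K P g 0) (state_space_total G K P 0))"
proof -
  interpret alg: algebraically_closed K by fact
  have K: "cring K"
    by (rule alg.cring_axioms)
  interpret G: comm_group G by fact
  let ?words = "\<lambda>h. {w. set w \<subseteq> carrier G \<times> carrier G \<and> length w = h}"
  have words_0: "?words 0 = {[]}"
    by auto
  note scalar = L_power_scalar[OF assms(2,3) K]
  have scalar_0: "scalar_module (drinfeld_double G K) K (counit_value G K) {[]} (L_power G K 0)"
    using scalar[of 0] unfolding words_0 .
  interpret scalar_coefficients "drinfeld_double G K" "L_power G K 0" P K "double_unit G K" "counit_value G K" "[]"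
    using assms(4) scalar_module_group[OF K scalar_0] K scalar_0
      double_unit_closed[OF K] counit_value_closed[OF K]
      counit_value_double_unit[OF G.group_axioms assms(3) K]
    by (intro scalar_coefficients.intro resolved.intro scalar_coefficients_axioms.intro)
      (simp_all add: L_power_0)
  have "finite (?words g)"
    using assms(3) by (intro finite_lists_length_eq) simp
  then show ?thesis
    unfolding state_space_total_def state_space_def
    by (rule ext_total_isomorphic_tensor[OF scalar])
      (simp add: state_algebra_def ext_algebra_def L_power_0)
qed

end
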